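(* Let $A_1,A_2\in\mathcal{L}(H)$ be such that, for $j=1,2$, $-A_j$ is sectorial and $\|e^{-t_0A_j}\|<1$ for some $t_0>0$, and let $B:\mathbf{C}\to H$ and $C:H\to\mathbf{C}$ be bounded operators such that $(-A_1,-A_2;B,C)$ gives a $(2,2)$ admissible linear system. Let $\tau(x;t)$ be the corresponding tau function (see context). Then Sato's integral vanishes identically: for all $r>\max\{\|A_1\|,\|A_2\|\}$, all $x>0$, and all $t=(t_j)_{j=1}^\infty$, $t'=(t_j')_{j=1}^\infty\in\mathbf{C}^\infty_0$, $$\int_{|\zeta|=r}\tau\big(x;t+[1/\zeta]\big)\,\tau\big(x;t'-[1/\zeta]\big)\exp\Big(-\sum_{j=1}^\infty(t_j-t_j')\zeta^j\Big)\,d\zeta=0.$$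
   Context: $H$ is a complex separable Hilbert space, $\mathcal{L}(H)$ its bounded operators. A linear system $(-A,B,C)$ with input/output space $\mathbf{C}$ is $(2,2)$ admissible if $\Theta_0f=\int_0^\infty e^{-sA^\dagger}C^\dagger f(s)\,ds$ and $\Xi_0f=\int_0^\infty e^{-sA}Bf(s)\,ds$ define Hilbert--Schmidt operators $L^2((0,\infty);\mathbf{C})\to H$; $(-A_1,-A_2;B,C)$ is shorthand for the pair of $(2,2)$ admissible systems $(-A_1,B,C)$ and $(-A_2,B,C)$. An operator $-A$ is sectorial if for some $\pi/2<\theta<\pi$ the sector $S_\theta=\{z\neq0:|\arg z|<\theta\}$ lies in the resolvent set of $-A$ and $|\lambda|\|(\lambda I+A)^{-1}\|$ is bounded on $S_\theta$. For $\eta\ge0$ let $\mathbf{C}^\infty_\eta=\{(t_j)_{j=1}^\infty: t_j\in\mathbf{C},\ \limsup_{j\to\infty}|t_j|^{1/j}\le\eta\}$. Let $$V(t)=\exp\Big(\sum_{j=1}^\infty t_jA_2^j\Big),\qquad W(t)=\exp\Big(-\sum_{j=1}^\infty t_j(-A_1)^j\Big)$$ for $t\in\mathbf{C}^\infty_0$, and for other $t$ whenever these series converge absolutely. The tau function is $\tau(x;t)=\det\big(I+V(t)R_xW(t)\big)$, where $R_x=\int_x^\infty e^{-vA_2}BCe^{-vA_1}\,dv$. For $s\in\mathbf{C}$, $[s]=(s^j/j)_{j=1}^\infty$; thus $V([s])=(I-sA_2)^{-1}$ and $W([s])=I+sA_1$ for small $|s|$. *)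

theory Defs
  imports
    "HOL-Complex_Analysis.Complex_Analysis"
    "HOL-Combinatorics.Permutations"
begin

section \<open>Complex Hilbert spaces\<close>

class complex_normed_vector = real_normed_vector +
  fixes scaleC :: "complex \<Rightarrow> 'a \<Rightarrow> 'a"  (infixr "*\<^sub>C" 75)
  assumes scaleC_of_real: "complex_of_real r *\<^sub>C x = r *\<^sub>R x"
    and scaleC_add_left: "(a + b) *\<^sub>C x = a *\<^sub>C x + b *\<^sub>C x"
    and scaleC_add_right: "a *\<^sub>C (x + y) = a *\<^sub>C x + a *\<^sub>C y"
    and scaleC_scaleC: "a *\<^sub>C (b *\<^sub>C x) = (a * b) *\<^sub>C x"
    and norm_scaleC: "norm (a *\<^sub>C x) = cmod a * norm x"

text \<open>
  The complex inner product is linear in its first argument, and its real part is the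
  inner product of the underlying real Hilbert space; positive definiteness and
  \<open>\<parallel>x\<parallel>\<^sup>2 = \<langle>x, x\<rangle>\<close> are inherited from \<^class>\<open>real_inner\<close>.
\<close>

class complex_hilbert = complex_normed_vector + real_inner + banach +
  fixes cinner :: "'a \<Rightarrow> 'a \<Rightarrow> complex"
  assumes cinner_add_left: "cinner (x + y) z = cinner x z + cinner y z"
    and cinner_scaleC_left: "cinner (a *\<^sub>C x) y = a * cinner x y"
    and cinner_commute: "cinner x y = cnj (cinner y x)"
    and Re_cinner: "Re (cinner x y) = inner x y"

instantiation complex :: complex_hilbert
begin

definition scaleC_complex :: "complex \<Rightarrow> complex \<Rightarrow> complex"
  where "scaleC_complex a x = a * x"

definition cinner_complex :: "complex \<Rightarrow> complex \<Rightarrow> complex"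
  where "cinner_complex x y = x * cnj y"

instance
  by standard
    (auto simp: scaleC_complex_def cinner_complex_def scaleR_conv_of_real algebra_simps
      norm_mult inner_complex_def)

end

lemma bounded_linear_scaleC: "bounded_linear ((*\<^sub>C) c :: 'a::complex_normed_vector \<Rightarrow> 'a)"
proof
  fix x y :: 'a and r :: real
  show "c *\<^sub>C (x + y) = c *\<^sub>C x + c *\<^sub>C y" by (rule scaleC_add_right)
  show "c *\<^sub>C (r *\<^sub>R x) = r *\<^sub>R (c *\<^sub>C x)"
    by (simp add: scaleC_of_real[symmetric] scaleC_scaleC mult.commute)
  show "\<exists>K. \<forall>x::'a. norm (c *\<^sub>C x) \<le> norm x * K"
    by (intro exI[of _ "cmod c"]) (simp add: norm_scaleC mult.commute)
qed


section \<open>Bounded operators\<close>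

text \<open>
  Bounded operators are elements of the library type \<open>'a \<Rightarrow>\<^sub>L 'b\<close> (bounded real-linear maps
  with the operator norm) satisfying the predicate \<open>cbounded\<close>.
\<close>

instantiation blinfun :: (real_normed_vector, complex_normed_vector) complex_normed_vector
begin

lift_definition scaleC_blinfun :: "complex \<Rightarrow> 'a \<Rightarrow>\<^sub>L 'b \<Rightarrow> 'a \<Rightarrow>\<^sub>L 'b"
  is "\<lambda>c T x. c *\<^sub>C T x"
  by (rule bounded_linear_compose[OF bounded_linear_scaleC])

instance
proof
  fix a b :: complex and r :: real and S T :: "'a \<Rightarrow>\<^sub>L 'b"
  show "complex_of_real r *\<^sub>C T = r *\<^sub>R T"
    by transfer (simp add: scaleC_of_real)
  show "(a + b) *\<^sub>C T = a *\<^sub>C T + b *\<^sub>C T"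
    by transfer (simp add: scaleC_add_left)
  show "a *\<^sub>C (S + T) = a *\<^sub>C S + a *\<^sub>C T"
    by transfer (simp add: scaleC_add_right)
  show "a *\<^sub>C (b *\<^sub>C T) = (a * b) *\<^sub>C T"
    by transfer (simp add: scaleC_scaleC)
  show "norm (a *\<^sub>C T) = cmod a * norm T"
  proof (transfer fixing: a)
    fix f :: "'a \<Rightarrow> 'b" assume f: "bounded_linear f"
    have "onorm (\<lambda>x. a *\<^sub>C f x) = onorm (\<lambda>x. cmod a *\<^sub>R f x)"
      by (simp add: onorm_def norm_scaleC)
    then show "onorm (\<lambda>x. a *\<^sub>C f x) = cmod a * onorm f"
      using onorm_scaleR[OF f, of "cmod a"] by simp
  qed
qed

end

definition cbounded :: "'a::complex_normed_vector \<Rightarrow>\<^sub>L 'b::complex_normed_vector \<Rightarrow> bool"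
  where "cbounded T \<longleftrightarrow> (\<forall>c x. blinfun_apply T (c *\<^sub>C x) = c *\<^sub>C blinfun_apply T x)"

definition cadjoint :: "'a::complex_hilbert \<Rightarrow>\<^sub>L 'b::complex_hilbert \<Rightarrow> 'b \<Rightarrow>\<^sub>L 'a"
  where "cadjoint T =
    (THE S. \<forall>x y. cinner (blinfun_apply T x) y = cinner x (blinfun_apply S y))"

primrec op_pow :: "'a::real_normed_vector \<Rightarrow>\<^sub>L 'a \<Rightarrow> nat \<Rightarrow> 'a \<Rightarrow>\<^sub>L 'a"
  where
    "op_pow T 0 = id_blinfun"
  | "op_pow T (Suc n) = T o\<^sub>L op_pow T n"

definition op_exp :: "'a::banach \<Rightarrow>\<^sub>L 'a \<Rightarrow> 'a \<Rightarrow>\<^sub>L 'a"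
  where "op_exp T = (\<Sum>n. (1 / fact n) *\<^sub>R op_pow T n)"


section \<open>Sectorial operators\<close>

definition op_inverse_of :: "'a::real_normed_vector \<Rightarrow>\<^sub>L 'a \<Rightarrow> 'a \<Rightarrow>\<^sub>L 'a \<Rightarrow> bool"
  where "op_inverse_of S T \<longleftrightarrow> S o\<^sub>L T = id_blinfun \<and> T o\<^sub>L S = id_blinfun"

definition resolvent_set :: "'a::complex_normed_vector \<Rightarrow>\<^sub>L 'a \<Rightarrow> complex set"
  where "resolvent_set G = {\<mu>. \<exists>S. op_inverse_of S (\<mu> *\<^sub>C id_blinfun - G)}"

definition resolvent :: "'a::complex_normed_vector \<Rightarrow>\<^sub>L 'a \<Rightarrow> complex \<Rightarrow> 'a \<Rightarrow>\<^sub>L 'a"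
  where "resolvent G \<mu> = (THE S. op_inverse_of S (\<mu> *\<^sub>C id_blinfun - G))"

definition sector :: "real \<Rightarrow> complex set"
  where "sector \<theta> = {z. z \<noteq> 0 \<and> \<bar>Arg z\<bar> < \<theta>}"

definition sectorial :: "'a::complex_normed_vector \<Rightarrow>\<^sub>L 'a \<Rightarrow> bool"
  where "sectorial G \<longleftrightarrow>
    (\<exists>\<theta>. pi / 2 < \<theta> \<and> \<theta> < pi \<and> sector \<theta> \<subseteq> resolvent_set G \<and>
      (\<exists>M. \<forall>\<mu>\<in>sector \<theta>. cmod \<mu> * norm (resolvent G \<mu>) \<le> M))"


section \<open>Hilbert--Schmidt operators on $L^2(0,\infty)$ and admissibility\<close>

text \<open>
  Elements of $L^2$ are represented by square integrable functions.  An operator given on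
  representatives that is linear and bounded in the $L^2$ seminorm takes equal values on
  functions that agree almost everywhere.
\<close>

abbreviation half_line :: "real measure"
  where "half_line \<equiv> lebesgue_on {0<..}"

definition L2 :: "(real \<Rightarrow> complex) set"
  where "L2 = {f \<in> borel_measurable half_line. integrable half_line (\<lambda>s. (cmod (f s))\<^sup>2)}"

definition L2_inner :: "(real \<Rightarrow> complex) \<Rightarrow> (real \<Rightarrow> complex) \<Rightarrow> complex"
  where "L2_inner f g = (LINT s|half_line. f s * cnj (g s))"

definition L2_norm :: "(real \<Rightarrow> complex) \<Rightarrow> real"
  where "L2_norm f = sqrt (LINT s|half_line. (cmod (f s))\<^sup>2)"

definition L2_orthonormal_basis :: "(nat \<Rightarrow> real \<Rightarrow> complex) \<Rightarrow> bool"
  where "L2_orthonormal_basis \<phi> \<longleftrightarrow>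
    (\<forall>n. \<phi> n \<in> L2) \<and>
    (\<forall>m n. L2_inner (\<phi> m) (\<phi> n) = (if m = n then 1 else 0)) \<and>
    (\<forall>f\<in>L2. (\<forall>n. L2_inner f (\<phi> n) = 0) \<longrightarrow> (AE s in half_line. f s = 0))"

definition hilbert_schmidt_L2 :: "((real \<Rightarrow> complex) \<Rightarrow> 'h::complex_hilbert) \<Rightarrow> bool"
  where "hilbert_schmidt_L2 T \<longleftrightarrow>
    (\<forall>f\<in>L2. \<forall>g\<in>L2. T (\<lambda>s. f s + g s) = T f + T g) \<and>
    (\<forall>c. \<forall>f\<in>L2. T (\<lambda>s. c * f s) = c *\<^sub>C T f) \<and>
    (\<exists>K. \<forall>f\<in>L2. norm (T f) \<le> K * L2_norm f) \<and>
    (\<exists>\<phi>. L2_orthonormal_basis \<phi> \<and> summable (\<lambda>n. (norm (T (\<phi> n)))\<^sup>2))"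

text \<open>
  In the following definitions \<open>G\<close> is the generator of the system, so \<open>G = - A\<close> for the
  system $(-A,B,C)$.
\<close>

definition Theta_integrand ::
    "'h::complex_hilbert \<Rightarrow>\<^sub>L 'h \<Rightarrow> 'h \<Rightarrow>\<^sub>L complex \<Rightarrow> (real \<Rightarrow> complex) \<Rightarrow> real \<Rightarrow> 'h"
  where "Theta_integrand G C f s =
    blinfun_apply (op_exp (s *\<^sub>R cadjoint G)) (blinfun_apply (cadjoint C) (f s))"

definition Xi_integrand ::
    "'h::complex_hilbert \<Rightarrow>\<^sub>L 'h \<Rightarrow> complex \<Rightarrow>\<^sub>L 'h \<Rightarrow> (real \<Rightarrow> complex) \<Rightarrow> real \<Rightarrow> 'h"
  where "Xi_integrand G B f s = blinfun_apply (op_exp (s *\<^sub>R G)) (blinfun_apply B (f s))"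

definition admissible_2_2 ::
    "'h::{complex_hilbert, second_countable_topology} \<Rightarrow>\<^sub>L 'h \<Rightarrow> complex \<Rightarrow>\<^sub>L 'h \<Rightarrow>
      'h \<Rightarrow>\<^sub>L complex \<Rightarrow> bool"
  where "admissible_2_2 G B C \<longleftrightarrow>
    (\<forall>f\<in>L2. integrable half_line (Theta_integrand G C f)) \<and>
    (\<forall>f\<in>L2. integrable half_line (Xi_integrand G B f)) \<and>
    hilbert_schmidt_L2 (\<lambda>f. LINT s|half_line. Theta_integrand G C f s) \<and>
    hilbert_schmidt_L2 (\<lambda>f. LINT s|half_line. Xi_integrand G B f s)"


section \<open>The Fredholm determinant\<close>

definition orthonormal :: "'h::complex_hilbert set \<Rightarrow> bool"
  where "orthonormal E \<longleftrightarrow> (\<forall>e\<in>E. \<forall>f\<in>E. cinner e f = (if e = f then 1 else 0))"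

definition orthonormal_basis :: "'h::complex_hilbert set \<Rightarrow> bool"
  where "orthonormal_basis E \<longleftrightarrow>
    orthonormal E \<and> (\<forall>x. (\<forall>e\<in>E. cinner x e = 0) \<longrightarrow> x = 0)"

lemma cinner_self: "cinner x x = complex_of_real ((norm x)\<^sup>2)" for x :: "'h::complex_hilbert"
proof (rule complex_eqI)
  show "Re (cinner x x) = Re (complex_of_real ((norm x)\<^sup>2))"
    by (simp add: Re_cinner power2_norm_eq_inner)
  have "Im (cinner x x) = - Im (cinner x x)"
    by (subst cinner_commute) simp
  then show "Im (cinner x x) = Im (complex_of_real ((norm x)\<^sup>2))"
    by simp
qed

lemma orthonormal_basis_exists: "\<exists>E :: 'h::complex_hilbert set. orthonormal_basis E"
proof -
  have "\<exists>M\<in>{E :: 'h set. orthonormal E}. \<forall>X\<in>{E. orthonormal E}. M \<subseteq> X \<longrightarrow> X = M"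
  proof (rule subset_Zorn')
    fix \<C> :: "'h set set" assume ch: "subset.chain {E. orthonormal E} \<C>"
    show "\<Union> \<C> \<in> {E. orthonormal E}"
      unfolding mem_Collect_eq orthonormal_def
    proof (intro ballI)
      fix e f assume "e \<in> \<Union> \<C>" "f \<in> \<Union> \<C>"
      then obtain X Y where "X \<in> \<C>" "e \<in> X" "Y \<in> \<C>" "f \<in> Y" by blast
      then obtain Z where "Z \<in> \<C>" "e \<in> Z" "f \<in> Z"
        using ch unfolding subset.chain_def by blast
      moreover then have "orthonormal Z"
        using ch unfolding subset.chain_def by blast
      ultimately show "cinner e f = (if e = f then 1 else 0)"
        unfolding orthonormal_def by blast
    qed
  qed
  then obtain M :: "'h set" where M: "orthonormal M"
    and max: "\<And>X. orthonormal X \<Longrightarrow> M \<subseteq> X \<Longrightarrow> X = M" by blast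
  have "x = 0" if x: "\<forall>e\<in>M. cinner x e = 0" for x
  proof (rule ccontr)
    assume nz: "x \<noteq> 0"
    define u where "u = complex_of_real (1 / norm x) *\<^sub>C x"
    have norm_u: "norm u = 1"
      using nz by (simp add: u_def norm_scaleC norm_divide)
    have uu: "cinner u u = 1"
      by (simp add: cinner_self norm_u)
    have ue: "cinner u e = 0" if "e \<in> M" for e
      using x that by (simp add: u_def cinner_scaleC_left)
    have eu: "cinner e u = 0" if "e \<in> M" for e
      using ue[OF that] by (subst cinner_commute) simp
    have notin: "u \<notin> M"
      using ue uu by force
    have "orthonormal (insert u M)"
      using M uu ue eu notin unfolding orthonormal_def by auto
    then have "insert u M = M"
      by (rule max) blast
    with notin show False by blast
  qed
  with M show ?thesis
    unfolding orthonormal_basis_def by blast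
qed

definition some_onb :: "'h::complex_hilbert set"
  where "some_onb = (SOME E. orthonormal_basis E)"

lemma orthonormal_basis_some_onb: "orthonormal_basis (some_onb :: 'h::complex_hilbert set)"
  unfolding some_onb_def by (rule someI_ex[OF orthonormal_basis_exists])

text \<open>The determinant of a matrix whose rows and columns are indexed by a finite set.\<close>

definition det_on :: "'i set \<Rightarrow> ('i \<Rightarrow> 'i \<Rightarrow> complex) \<Rightarrow> complex"
  where "det_on S M = (\<Sum>p | p permutes S. of_int (sign p) * (\<Prod>i\<in>S. M i (p i)))"

text \<open>
  The trace of the exterior power $\Lambda^k T$, computed in the orthonormal basis
  $e_{i_1} \wedge \dots \wedge e_{i_k}$ of $\Lambda^k H$ coming from an orthonormal basis
  $(e_i)$ of $H$; the corresponding diagonal entries of $\Lambda^k T$ are the principal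
  $k \times k$ minors of the matrix of $T$.
\<close>

definition trace_ext_power :: "nat \<Rightarrow> ('h::complex_hilbert \<Rightarrow> 'h) \<Rightarrow> complex"
  where "trace_ext_power k T =
    (\<Sum>\<^sub>\<infinity>S\<in>{S. S \<subseteq> some_onb \<and> finite S \<and> card S = k}. det_on S (\<lambda>e f. cinner (T f) e))"

text \<open>
  \<open>det_I_plus T\<close> is $\det(I + T) = \sum_k \mathrm{tr}\, \Lambda^k T$ for a trace class
  operator \<open>T\<close>; for such \<open>T\<close> all the sums converge absolutely and the value does not
  depend on the orthonormal basis.
\<close>

definition det_I_plus :: "('h::complex_hilbert \<Rightarrow> 'h) \<Rightarrow> complex"
  where "det_I_plus T = (\<Sum>k. trace_ext_power k T)"


section \<open>The tau function\<close>

text \<open>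
  A sequence $(t_j)_{j \ge 1}$ is a function on \<^typ>\<open>nat\<close> whose value at \<open>0\<close> is ignored.
\<close>

definition C_infty :: "real \<Rightarrow> (nat \<Rightarrow> complex) set"
  where "C_infty \<eta> = {t. limsup (\<lambda>j. ereal (root j (cmod (t j)))) \<le> ereal \<eta>}"

definition bracket :: "complex \<Rightarrow> nat \<Rightarrow> complex"
  where "bracket s j = s ^ j / of_nat j"

text \<open>
  The series below are meaningful only when they converge; for absolutely convergent series
  \<^const>\<open>suminf\<close> is the limit in operator norm.
\<close>

definition tau_V :: "'h::complex_hilbert \<Rightarrow>\<^sub>L 'h \<Rightarrow> (nat \<Rightarrow> complex) \<Rightarrow> 'h \<Rightarrow>\<^sub>L 'h"
  where "tau_V A2 t = op_exp (\<Sum>j. t (Suc j) *\<^sub>C op_pow A2 (Suc j))"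

definition tau_W :: "'h::complex_hilbert \<Rightarrow>\<^sub>L 'h \<Rightarrow> (nat \<Rightarrow> complex) \<Rightarrow> 'h \<Rightarrow>\<^sub>L 'h"
  where "tau_W A1 t = op_exp (- (\<Sum>j. t (Suc j) *\<^sub>C op_pow (- A1) (Suc j)))"

text \<open>The operator integral defining $R_x$ is taken pointwise, as a Bochner integral in \<open>H\<close>.\<close>

definition R_op ::
    "'h::{complex_hilbert, second_countable_topology} \<Rightarrow>\<^sub>L 'h \<Rightarrow> 'h \<Rightarrow>\<^sub>L 'h \<Rightarrow>
      complex \<Rightarrow>\<^sub>L 'h \<Rightarrow> 'h \<Rightarrow>\<^sub>L complex \<Rightarrow> real \<Rightarrow> 'h \<Rightarrow> 'h"
  where "R_op A1 A2 B C x h =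
    (LINT v|lebesgue_on {x<..}.
      blinfun_apply (op_exp (- (v *\<^sub>R A2)) o\<^sub>L B o\<^sub>L C o\<^sub>L op_exp (- (v *\<^sub>R A1))) h)"

definition tau ::
    "'h::{complex_hilbert, second_countable_topology} \<Rightarrow>\<^sub>L 'h \<Rightarrow> 'h \<Rightarrow>\<^sub>L 'h \<Rightarrow>
      complex \<Rightarrow>\<^sub>L 'h \<Rightarrow> 'h \<Rightarrow>\<^sub>L complex \<Rightarrow> real \<Rightarrow> (nat \<Rightarrow> complex) \<Rightarrow> complex"
  where "tau A1 A2 B C x t =
    det_I_plus (\<lambda>h. blinfun_apply (tau_V A2 t) (R_op A1 A2 B C x (blinfun_apply (tau_W A1 t) h)))"

end

theory Submission
  imports Defs
begin

text \<open>
  Write \<open>R\<close> for $R_x$ and put $b = e^{-xA_2}B$, $c = Ce^{-xA_1}$.  Differentiating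
  $e^{-vA_2}BCe^{-vA_1}$ in \<open>v\<close> and integrating over $(x,\infty)$ gives the Sylvester equation
  $A_2R + RA_1 = bc$, whose right-hand side has rank one.  With $s = 1/\zeta$ one has
  $V(t+[s]) = V(t)(I-sA_2)^{-1}$ and $W(t+[s]) = (I+sA_1)W(t)$, so the Sylvester equation turns
  the two shifted operators into
  \[ V(t)\bigl(R + (\zeta-A_2)^{-1}bc\bigr)W(t), \qquad
     V(t')\bigl(R - bc(\zeta+A_1)^{-1}\bigr)W(t'), \]
  rank-one perturbations of $V(t)RW(t)$ and $V(t')RW(t')$ in which $\zeta$ occurs only through
  one resolvent.  A determinant is affine along rank-one matrices; hence the first tau function
  is a constant plus a linear functional of $(\zeta-A_2)^{-1}b$, and the second is a constant
  minus $c(\zeta+A_1)^{-1}$ applied to a fixed vector.  In their product the two resolvents meet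
  in $(\zeta-A_2)^{-1}bc(\zeta+A_1)^{-1}$, and by the Sylvester equation again this equals
  $(\zeta-A_2)^{-1}R - R(\zeta+A_1)^{-1}$.  So every term of the integrand contains at most one
  resolvent, and Cauchy's formula
  $\oint g(\zeta)(\zeta-A)^{-1}\,d\zeta = 2\pi i\,g(A)$ evaluates the integral.  For
  $g(\zeta) = \exp(-\sum_j(t_j-t'_j)\zeta^j)$ one has $V(t)g(A_2) = V(t')$ and
  $g(-A_1)W(t') = W(t)$, and with these the terms cancel by Cramer's rule.  Using cofactors in
  place of $(I+V(t)RW(t))^{-1}$ also covers the zeros of the tau functions.

  The cancellation involves matrix entries only, so it is exact for the compressions of the
  operators to the span of any finite set of vectors (lemma \<open>compressed_integral_zero\<close>), and
  no infinite determinant has to be manipulated.  It remains to let the finite sets exhaust the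
  orthonormal basis and to interchange limit and contour integral by dominated convergence.
  This requires a bound, uniform on the circle, for the sum of the absolute values of all
  principal minors.  It comes from a representation $R = \sum_n u_n w_n$ with vectors $u_n$ and
  functionals $w_n$: expanding the minors by multilinearity and applying the Cauchy--Schwarz
  inequality bounds the sum by $\sum_J |J|!\prod_{n\in J}\|u_n\|\|w_n\|$ over finite sets \<open>J\<close> of
  indices.  As $|J|! \le \prod_{n\in J}(n+1)$, this is at most
  $\prod_n(1+(n+1)\|u_n\|\|w_n\|)$ (lemma \<open>sum_minors_le_prod\<close>), so a decomposition whose
  terms decay fast takes the place of Hadamard's inequality.  Such a decomposition
  (lemmas \<open>nuclear_sums\<close> and \<open>summable_nuclear_vector\<close>) results from cutting $(x,\infty)$ into
  unit intervals and expanding $e^{-vA_2}B$ in a Taylor series on each of them: exponential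
  stability makes the terms decay geometrically from interval to interval, and the Taylor
  coefficients decay factorially.

  The functions of $A_1$ and $A_2$ that occur are obtained from one holomorphic functional
  calculus, defined by Taylor series on a disc larger than the norm of the operator; identities
  between operators then follow from identities between scalar functions.
\<close>


section \<open>Finite determinants under rank-one perturbations\<close>

lemma det_on_cong:
  assumes "\<And>i. i \<in> S \<Longrightarrow> M i = N i"
  shows "det_on S M = det_on S N"
proof -
  have "(\<Prod>i\<in>S. M i (p i)) = (\<Prod>i\<in>S. N i (p i))" for p
    using assms by (intro prod.cong) auto
  then show ?thesis by (simp add: det_on_def)
qed

lemma det_on_transpose:
  assumes "finite S"
  shows "det_on S (\<lambda>i j. M j i) = det_on S M"
proof -
  have "det_on S (\<lambda>i j. M j i) = (\<Sum>p | p permutes S. of_int (sign p) * (\<Prod>i\<in>S. M (p i) i))"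
    by (simp add: det_on_def)
  also have "\<dots> = (\<Sum>p | p permutes S. of_int (sign (inv p)) * (\<Prod>i\<in>S. M ((inv p) i) i))"
    by (rule sum.reindex_bij_witness[of _ inv inv])
       (auto simp: permutes_inv permutes_inv_inv)
  also have "\<dots> = (\<Sum>p | p permutes S. of_int (sign p) * (\<Prod>i\<in>S. M i (p i)))"
  proof (rule sum.cong[OF refl])
    fix p assume "p \<in> {p. p permutes S}"
    then have p: "p permutes S" by simp
    have "(\<Prod>i\<in>S. M ((inv p) i) i) = (\<Prod>i\<in>S. M i (p i))"
      using p by (intro prod.reindex_bij_witness[of _ p "inv p"])
        (auto simp: permutes_in_image permutes_inv permutes_inverses)
    moreover have "sign (inv p) = sign p"
      using p assms by (meson permutation_permutes sign_inverse)
    ultimately show "of_int (sign (inv p)) * (\<Prod>i\<in>S. M ((inv p) i) i)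
        = of_int (sign p) * (\<Prod>i\<in>S. M i (p i))" by simp
  qed
  finally show ?thesis by (simp add: det_on_def)
qed

text \<open>
  Separating the factor of row \<open>e\<close> makes the dependence of the determinant on that row
  explicit; linearity in the row is read off from this form.
\<close>

lemma det_on_row:
  assumes "finite S" "e \<in> S"
  shows "det_on S (M(e := r)) =
    (\<Sum>p | p permutes S. of_int (sign p) * (r (p e) * (\<Prod>i\<in>S - {e}. M i (p i))))"
  unfolding det_on_def
proof (rule sum.cong[OF refl])
  fix p
  have "(\<Prod>i\<in>S. (M(e := r)) i (p i)) = r (p e) * (\<Prod>i\<in>S - {e}. (M(e := r)) i (p i))"
    using assms by (subst prod.remove[of S e]) auto
  also have "(\<Prod>i\<in>S - {e}. (M(e := r)) i (p i)) = (\<Prod>i\<in>S - {e}. M i (p i))"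
    by (rule prod.cong) auto
  finally show "of_int (sign p) * (\<Prod>i\<in>S. (M(e := r)) i (p i))
      = of_int (sign p) * (r (p e) * (\<Prod>i\<in>S - {e}. M i (p i)))" by simp
qed

lemma det_on_row_add:
  assumes "finite S" "e \<in> S"
  shows "det_on S (M(e := \<lambda>j. r j + c * q j)) = det_on S (M(e := r)) + c * det_on S (M(e := q))"
  unfolding det_on_row[OF assms] sum_distrib_left sum.distrib[symmetric]
  by (rule sum.cong) (auto simp: algebra_simps)

text \<open>
  Composing the permutations with the transposition of the two rows changes every sign and
  no product, so the determinant equals its own negative.
\<close>

lemma det_on_identical_rows:
  assumes "finite S" "a \<in> S" "b \<in> S" "a \<noteq> b" and "\<And>j. j \<in> S \<Longrightarrow> M a j = M b j"
  shows "det_on S M = 0"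
proof -
  let ?t = "Transposition.transpose a b"
  have t: "?t permutes S" using assms by (simp add: permutes_swap_id)
  have "det_on S M = (\<Sum>p | p permutes S. of_int (sign (p \<circ> ?t)) * (\<Prod>i\<in>S. M i ((p \<circ> ?t) i)))"
    unfolding det_on_def
    by (rule sum.reindex_bij_witness[of _ "\<lambda>p. p \<circ> ?t" "\<lambda>p. p \<circ> ?t"])
       (auto simp: comp_assoc permutes_compose[OF t])
  also have "\<dots> = (\<Sum>p | p permutes S. - (of_int (sign p) * (\<Prod>i\<in>S. M i (p i))))"
  proof (rule sum.cong[OF refl])
    fix p assume "p \<in> {p. p permutes S}"
    then have p: "p permutes S" by simp
    have "sign (p \<circ> ?t) = - sign p"
    proof -
      have "permutation p" "permutation ?t"
        using p t assms(1) permutation_permutes by blast+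
      then show ?thesis using assms(4) by (simp add: sign_compose sign_swap_id)
    qed
    moreover have "(\<Prod>i\<in>S. M i ((p \<circ> ?t) i)) = (\<Prod>i\<in>S. M (?t i) (p i))"
      by (rule prod.reindex_bij_witness[of _ ?t ?t]) (use t in \<open>auto simp: permutes_in_image\<close>)
    moreover have "(\<Prod>i\<in>S. M (?t i) (p i)) = (\<Prod>i\<in>S. M i (p i))"
      using assms p by (intro prod.cong) (auto simp: Transposition.transpose_def permutes_in_image)
    ultimately show "of_int (sign (p \<circ> ?t)) * (\<Prod>i\<in>S. M i ((p \<circ> ?t) i))
      = - (of_int (sign p) * (\<Prod>i\<in>S. M i (p i)))" by simp
  qed
  finally show ?thesis by (simp add: det_on_def sum_negf)
qed

lemma det_on_add_multiples_of_row:
  assumes "finite S" "q \<in> S" "Q \<subseteq> S" "q \<notin> Q"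
  shows "det_on S (\<lambda>i. if i = q then w else if i \<in> Q then (\<lambda>j. M i j + u i * w j) else M i)
    = det_on S (M(q := w))"
proof -
  have "finite Q" using assms finite_subset by blast
  then show ?thesis using assms(3,4)
  proof (induction Q rule: finite_induct)
    case empty
    show ?case by (rule det_on_cong) auto
  next
    case (insert e Q)
    let ?N = "\<lambda>i. if i = q then w else if i \<in> Q then (\<lambda>j. M i j + u i * w j) else M i"
    have e: "e \<in> S" "e \<noteq> q" using insert.prems by auto
    have "det_on S (\<lambda>i. if i = q then w else if i \<in> insert e Q then (\<lambda>j. M i j + u i * w j) else M i)
        = det_on S (?N(e := \<lambda>j. M e j + u e * w j))"
      using e by (intro det_on_cong) auto
    also have "\<dots> = det_on S (?N(e := M e)) + u e * det_on S (?N(e := w))"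
      by (rule det_on_row_add) (use assms e in auto)
    also have "det_on S (?N(e := w)) = 0"
      by (rule det_on_identical_rows[of _ e q]) (use assms e in auto)
    also have "det_on S (?N(e := M e)) = det_on S ?N"
      using insert.hyps e by (intro det_on_cong) auto
    also have "det_on S ?N = det_on S (M(q := w))"
      using insert.prems by (intro insert.IH) auto
    finally show ?case by (simp del: fun_upd_apply)
  qed
qed

text \<open>
  The perturbed matrix arises by adding \<open>u\<^sub>i w\<close> to one row \<open>i\<close> after the other.  By linearity each
  step contributes \<open>u\<^sub>i\<close> times a determinant whose row \<open>i\<close> is \<open>w\<close>, in which the multiples of \<open>w\<close>
  already added to other rows do not matter.
\<close>

lemma det_on_rank_one_rows:
  assumes "finite S"
  shows "det_on S (\<lambda>i j. M i j + u i * w j) = det_on S M + (\<Sum>e\<in>S. u e * det_on S (M(e := w)))"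
proof -
  have main: "det_on S (\<lambda>i. if i \<in> Q then (\<lambda>j. M i j + u i * w j) else M i)
      = det_on S M + (\<Sum>e\<in>Q. u e * det_on S (M(e := w)))" if "finite Q" "Q \<subseteq> S" for Q
    using that
  proof (induction Q rule: finite_induct)
    case empty
    show ?case by simp
  next
    case (insert q Q)
    let ?N = "\<lambda>i. if i \<in> Q then (\<lambda>j. M i j + u i * w j) else M i"
    have q: "q \<in> S" using insert.prems by auto
    have "det_on S (\<lambda>i. if i \<in> insert q Q then (\<lambda>j. M i j + u i * w j) else M i)
        = det_on S (?N(q := \<lambda>j. M q j + u q * w j))"
      by (rule det_on_cong) auto
    also have "\<dots> = det_on S (?N(q := M q)) + u q * det_on S (?N(q := w))"
      by (rule det_on_row_add) (use assms q in auto)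
    also have "det_on S (?N(q := M q)) = det_on S ?N"
      using insert.hyps by (intro det_on_cong) auto
    also have "det_on S (?N(q := w))
        = det_on S (\<lambda>i. if i = q then w else if i \<in> Q then (\<lambda>j. M i j + u i * w j) else M i)"
      by (rule det_on_cong) auto
    also have "\<dots> = det_on S (M(q := w))"
      by (rule det_on_add_multiples_of_row) (use assms q insert in auto)
    also have "det_on S ?N = det_on S M + (\<Sum>e\<in>Q. u e * det_on S (M(e := w)))"
      using insert.prems by (intro insert.IH) simp
    finally show ?case using insert.hyps by (simp del: fun_upd_apply)
  qed
  have "det_on S (\<lambda>i j. M i j + u i * w j)
      = det_on S (\<lambda>i. if i \<in> S then (\<lambda>j. M i j + u i * w j) else M i)"
    by (rule det_on_cong) simp
  also have "\<dots> = det_on S M + (\<Sum>e\<in>S. u e * det_on S (M(e := w)))"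
    using assms by (rule main) simp
  finally show ?thesis .
qed

abbreviation (input) set_column :: "('i \<Rightarrow> 'i \<Rightarrow> complex) \<Rightarrow> 'i \<Rightarrow> ('i \<Rightarrow> complex) \<Rightarrow> 'i \<Rightarrow> 'i \<Rightarrow> complex"
  where "set_column M f u \<equiv> (\<lambda>i j. if j = f then u i else M i j)"

lemma det_on_set_column:
  assumes "finite S"
  shows "det_on S (set_column M f u) = det_on S ((\<lambda>i j. M j i)(f := u))"
proof -
  have "((\<lambda>i j. M j i)(f := u)) = (\<lambda>i j. set_column M f u j i)"
    by (auto simp: fun_eq_iff)
  then show ?thesis
    by (simp only: det_on_transpose[OF assms, of "set_column M f u"])
qed

lemma det_on_rank_one_columns:
  assumes "finite S"
  shows "det_on S (\<lambda>i j. M i j + u i * w j) = det_on S M + (\<Sum>f\<in>S. w f * det_on S (set_column M f u))"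
proof -
  have "det_on S (\<lambda>i j. M i j + u i * w j) = det_on S (\<lambda>i j. M j i + w i * u j)"
    using det_on_transpose[OF assms, of "\<lambda>i j. M j i + w i * u j"] by (simp add: mult.commute)
  also have "\<dots> = det_on S (\<lambda>i j. M j i) + (\<Sum>f\<in>S. w f * det_on S ((\<lambda>i j. M j i)(f := u)))"
    by (rule det_on_rank_one_rows[OF assms])
  finally show ?thesis
    by (simp only: det_on_set_column[OF assms] det_on_transpose[OF assms, of M])
qed

text \<open>
  Perturb by the rank-one matrix formed by column \<open>g\<close> of \<open>M\<close> and the row \<open>w\<close>.  Expanded along rows
  the change of the determinant is the sum on the left; expanded along columns only the column
  \<open>g\<close> contributes, because the other determinants have two equal columns.
\<close>

lemma Cramer_rows:
  assumes "finite S" "g \<in> S"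
  shows "(\<Sum>e\<in>S. det_on S (M(e := w)) * M e g) = det_on S M * w g"
proof -
  have z: "det_on S (set_column M f (\<lambda>i. M i g)) = (if f = g then det_on S M else 0)" if "f \<in> S" for f
  proof (cases "f = g")
    case True
    then have "set_column M f (\<lambda>i. M i g) = M" by (auto simp: fun_eq_iff)
    with True show ?thesis by simp
  next
    case False
    then show ?thesis unfolding det_on_set_column[OF assms(1)]
      by (simp, intro det_on_identical_rows[of _ f g]) (use assms that in auto)
  qed
  have "(\<Sum>e\<in>S. M e g * det_on S (M(e := w))) = (\<Sum>f\<in>S. w f * det_on S (set_column M f (\<lambda>i. M i g)))"
    using det_on_rank_one_rows[OF assms(1), of M "\<lambda>i. M i g" w]
      det_on_rank_one_columns[OF assms(1), of M "\<lambda>i. M i g" w] by simp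
  also have "\<dots> = (\<Sum>f\<in>S. if f = g then w f * det_on S M else 0)"
    using z by (intro sum.cong) auto
  also have "\<dots> = w g * det_on S M" using assms by simp
  finally show ?thesis by (simp add: mult.commute)
qed

lemma Cramer_columns:
  assumes "finite S" "g \<in> S"
  shows "(\<Sum>f\<in>S. M g f * det_on S (set_column M f u)) = det_on S M * u g"
proof -
  have "(\<Sum>f\<in>S. M g f * det_on S (set_column M f u))
      = (\<Sum>f\<in>S. det_on S ((\<lambda>i j. M j i)(f := u)) * M g f)"
    by (simp only: det_on_set_column[OF assms(1)] mult.commute)
  also have "\<dots> = det_on S (\<lambda>i j. M j i) * u g"
    by (rule Cramer_rows[OF assms])
  finally show ?thesis by (simp only: det_on_transpose[OF assms(1), of M])
qed

text \<open>
  A permutation that contributes to the term of \<open>S\<close> must fix every point outside \<open>S\<close>, since it picks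
  diagonal entries of the identity there.
\<close>

lemma det_on_identity_plus:
  assumes "finite F"
  shows "det_on F (\<lambda>e f. (if e = f then 1 else 0) + M e f) = (\<Sum>S\<in>Pow F. det_on S M)"
proof -
  have fin: "finite {p. p permutes F}" using assms by (rule finite_permutations)
  have "det_on F (\<lambda>e f. (if e = f then 1 else 0) + M e f)
      = (\<Sum>p | p permutes F. of_int (sign p) * (\<Prod>i\<in>F. M i (p i) + (if i = p i then 1 else 0)))"
    by (simp add: det_on_def add.commute)
  also have "\<dots> = (\<Sum>p | p permutes F. \<Sum>S\<in>Pow F. of_int (sign p) *
      ((\<Prod>i\<in>S. M i (p i)) * (\<Prod>i\<in>F - S. (if i = p i then 1 else 0))))"
    using assms by (simp add: prod_add sum_distrib_left)
  also have "\<dots> = (\<Sum>S\<in>Pow F. \<Sum>p | p permutes F. of_int (sign p) *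
      ((\<Prod>i\<in>S. M i (p i)) * (\<Prod>i\<in>F - S. (if i = p i then 1 else 0))))"
    by (rule sum.swap)
  also have "\<dots> = (\<Sum>S\<in>Pow F. det_on S M)"
  proof (rule sum.cong[OF refl])
    fix S assume "S \<in> Pow F"
    then have S: "S \<subseteq> F" by simp
    have "(\<Sum>p | p permutes F. of_int (sign p) *
        ((\<Prod>i\<in>S. M i (p i)) * (\<Prod>i\<in>F - S. (if i = p i then 1 else 0))))
      = (\<Sum>p | p permutes S. of_int (sign p) *
        ((\<Prod>i\<in>S. M i (p i)) * (\<Prod>i\<in>F - S. (if i = p i then 1 else 0))))"
    proof (rule sum.mono_neutral_right[OF fin])
      show "{p. p permutes S} \<subseteq> {p. p permutes F}" using S permutes_subset by blast
      show "\<forall>p\<in>{p. p permutes F} - {p. p permutes S}. of_int (sign p) *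
        ((\<Prod>i\<in>S. M i (p i)) * (\<Prod>i\<in>F - S. (if i = p i then 1 else 0))) = 0"
      proof
        fix p assume p: "p \<in> {p. p permutes F} - {p. p permutes S}"
        then have "\<exists>i\<in>F - S. p i \<noteq> i"
          using permutes_superset[of p F S] by auto
        then have "(\<Prod>i\<in>F - S. (if i = p i then 1 else 0 :: complex)) = 0"
          using assms by (intro prod_zero) force+
        then show "of_int (sign p) *
            ((\<Prod>i\<in>S. M i (p i)) * (\<Prod>i\<in>F - S. (if i = p i then 1 else 0))) = 0" by simp
      qed
    qed
    also have "\<dots> = det_on S M"
      unfolding det_on_def
    proof (rule sum.cong[OF refl])
      fix p assume "p \<in> {p. p permutes S}"
      then have "(\<Prod>i\<in>F - S. (if i = p i then 1 else 0 :: complex)) = 1"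
        by (intro prod.neutral) (auto simp: permutes_def)
      then show "of_int (sign p) * ((\<Prod>i\<in>S. M i (p i)) * (\<Prod>i\<in>F - S. (if i = p i then 1 else 0)))
        = of_int (sign p) * (\<Prod>i\<in>S. M i (p i))" by simp
    qed
    finally show "(\<Sum>p | p permutes F. of_int (sign p) *
      ((\<Prod>i\<in>S. M i (p i)) * (\<Prod>i\<in>F - S. (if i = p i then 1 else 0)))) = det_on S M" .
  qed
  finally show ?thesis .
qed

section \<open>Absolute sums of principal minors\<close>

text \<open>
  The elements of a set of natural numbers, listed in increasing order, are at least
  $0, 1, 2, \dots$
\<close>

lemma fact_card_le_prod:
  fixes J :: "nat set"
  assumes "finite J"
  shows "fact (card J) \<le> (\<Prod>n\<in>J. real n + 1)"
  using assms
proof (induction J rule: finite_linorder_max_induct)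
  case empty
  show ?case by simp
next
  case (insert b A)
  have "card A \<le> card {..<b}" using insert by (intro card_mono) auto
  then have "real (card A) + 1 \<le> real b + 1" by simp
  then have "(real (card A) + 1) * fact (card A) \<le> (real b + 1) * (\<Prod>n\<in>A. real n + 1)"
    using insert.IH by (intro mult_mono) auto
  moreover have "b \<notin> A" using insert by auto
  ultimately show ?case using insert.hyps by (simp add: algebra_simps)
qed

text \<open>
  This is the expansion behind the Cauchy--Binet formula; only injective choices of summands
  survive, because a choice that uses some \<open>w\<^sub>n\<close> twice leads to two equal rows.
\<close>

lemma det_on_sum_of_rank_ones:
  fixes u w :: "nat \<Rightarrow> 'i \<Rightarrow> complex"
  assumes "finite S"
  shows "det_on S (\<lambda>e f. \<Sum>n<N. u n e * w n f)
    = (\<Sum>\<nu> | \<nu> \<in> S \<rightarrow>\<^sub>E {..<N} \<and> inj_on \<nu> S.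
        (\<Prod>e\<in>S. u (\<nu> e) e) * det_on S (\<lambda>e. w (\<nu> e)))"
proof -
  have "det_on S (\<lambda>e f. \<Sum>n<N. u n e * w n f)
    = (\<Sum>p | p permutes S. \<Sum>\<nu>\<in>S \<rightarrow>\<^sub>E {..<N}.
        of_int (sign p) * (\<Prod>e\<in>S. u (\<nu> e) e * w (\<nu> e) (p e)))"
    unfolding det_on_def using assms by (subst prod_sum_PiE) (auto simp: sum_distrib_left)
  also have "\<dots> = (\<Sum>\<nu>\<in>S \<rightarrow>\<^sub>E {..<N}. \<Sum>p | p permutes S.
        of_int (sign p) * (\<Prod>e\<in>S. u (\<nu> e) e * w (\<nu> e) (p e)))"
    by (rule sum.swap)
  also have "\<dots> = (\<Sum>\<nu>\<in>S \<rightarrow>\<^sub>E {..<N}. (\<Prod>e\<in>S. u (\<nu> e) e) * det_on S (\<lambda>e. w (\<nu> e)))"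
    unfolding det_on_def sum_distrib_left prod.distrib
    by (intro sum.cong refl) (simp add: mult_ac)
  also have "\<dots> = (\<Sum>\<nu> | \<nu> \<in> S \<rightarrow>\<^sub>E {..<N} \<and> inj_on \<nu> S.
        (\<Prod>e\<in>S. u (\<nu> e) e) * det_on S (\<lambda>e. w (\<nu> e)))"
  proof (rule sum.mono_neutral_right)
    show "finite (S \<rightarrow>\<^sub>E {..<N})" using assms by (intro finite_PiE) auto
    show "\<forall>\<nu>\<in>(S \<rightarrow>\<^sub>E {..<N}) - {\<nu>. \<nu> \<in> S \<rightarrow>\<^sub>E {..<N} \<and> inj_on \<nu> S}.
        (\<Prod>e\<in>S. u (\<nu> e) e) * det_on S (\<lambda>e. w (\<nu> e)) = 0"
    proof
      fix \<nu> assume "\<nu> \<in> (S \<rightarrow>\<^sub>E {..<N}) - {\<nu>. \<nu> \<in> S \<rightarrow>\<^sub>E {..<N} \<and> inj_on \<nu> S}"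
      then obtain a b where "a \<in> S" "b \<in> S" "a \<noteq> b" "\<nu> a = \<nu> b"
        unfolding inj_on_def by blast
      then have "det_on S (\<lambda>e. w (\<nu> e)) = 0"
        using assms by (intro det_on_identical_rows[of S a b]) auto
      then show "(\<Prod>e\<in>S. u (\<nu> e) e) * det_on S (\<lambda>e. w (\<nu> e)) = 0" by simp
    qed
  qed auto
  finally show ?thesis .
qed

text \<open>
  By the Cauchy--Schwarz inequality in the sum over \<open>\<mu>\<close> it suffices to treat \<open>u\<close> and \<open>w\<close> separately, and
  the sum over all maps of a product is the product of the sums.
\<close>

lemma sum_over_maps_le:
  fixes u w :: "'j \<Rightarrow> 'i \<Rightarrow> complex" and \<alpha> \<beta> :: "'j \<Rightarrow> real"
  assumes "finite J" "finite F" and \<pi>: "\<pi> permutes J"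
    and u: "\<And>j. j \<in> J \<Longrightarrow> (\<Sum>e\<in>F. (cmod (u j e))\<^sup>2) \<le> (\<alpha> j)\<^sup>2" "\<And>j. j \<in> J \<Longrightarrow> 0 \<le> \<alpha> j"
    and w: "\<And>j. j \<in> J \<Longrightarrow> (\<Sum>e\<in>F. (cmod (w j e))\<^sup>2) \<le> (\<beta> j)\<^sup>2" "\<And>j. j \<in> J \<Longrightarrow> 0 \<le> \<beta> j"
  shows "(\<Sum>\<mu>\<in>J \<rightarrow>\<^sub>E F. \<Prod>j\<in>J. cmod (u j (\<mu> j)) * cmod (w j (\<mu> (\<pi> j)))) \<le> (\<Prod>j\<in>J. \<alpha> j * \<beta> j)"
proof -
  let ?X = "\<lambda>\<mu>. \<Prod>j\<in>J. cmod (u j (\<mu> j))" and ?Y = "\<lambda>\<mu>. \<Prod>j\<in>J. cmod (w j (\<mu> (\<pi> j)))"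
  have X: "(\<Sum>\<mu>\<in>J \<rightarrow>\<^sub>E F. (?X \<mu>)\<^sup>2) \<le> (\<Prod>j\<in>J. (\<alpha> j)\<^sup>2)"
  proof -
    have "(\<Sum>\<mu>\<in>J \<rightarrow>\<^sub>E F. (?X \<mu>)\<^sup>2) = (\<Prod>j\<in>J. \<Sum>e\<in>F. (cmod (u j e))\<^sup>2)"
      using assms(1,2) by (simp add: prod_sum_PiE prod_power_distrib)
    also have "\<dots> \<le> (\<Prod>j\<in>J. (\<alpha> j)\<^sup>2)"
      using u(1) by (intro prod_mono conjI sum_nonneg) simp_all
    finally show ?thesis .
  qed
  have Y: "(\<Sum>\<mu>\<in>J \<rightarrow>\<^sub>E F. (?Y \<mu>)\<^sup>2) \<le> (\<Prod>j\<in>J. (\<beta> j)\<^sup>2)"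
  proof -
    have "?Y \<mu> = (\<Prod>j\<in>J. cmod (w (inv \<pi> j) (\<mu> j)))" for \<mu>
      using \<pi> by (intro prod.reindex_bij_witness[of _ "inv \<pi>" \<pi>])
        (auto simp: permutes_in_image permutes_inv permutes_inverses)
    then have "(\<Sum>\<mu>\<in>J \<rightarrow>\<^sub>E F. (?Y \<mu>)\<^sup>2) = (\<Prod>j\<in>J. \<Sum>e\<in>F. (cmod (w (inv \<pi> j) e))\<^sup>2)"
      using assms(1,2) by (simp add: prod_sum_PiE prod_power_distrib)
    also have "\<dots> \<le> (\<Prod>j\<in>J. (\<beta> (inv \<pi> j))\<^sup>2)"
      using w(1) permutes_in_image[OF permutes_inv[OF \<pi>]]
      by (intro prod_mono conjI sum_nonneg) simp_all
    also have "\<dots> = (\<Prod>j\<in>J. (\<beta> j)\<^sup>2)"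
      using \<pi> by (intro prod.reindex_bij_witness[of _ \<pi> "inv \<pi>"])
        (auto simp: permutes_in_image permutes_inv permutes_inverses)
    finally show ?thesis .
  qed
  have "(\<Sum>\<mu>\<in>J \<rightarrow>\<^sub>E F. ?X \<mu> * ?Y \<mu>)\<^sup>2 \<le> (\<Prod>j\<in>J. (\<alpha> j)\<^sup>2) * (\<Prod>j\<in>J. (\<beta> j)\<^sup>2)"
  proof (rule order_trans[OF Cauchy_Schwarz_ineq_sum mult_mono[OF X Y]])
    show "0 \<le> (\<Prod>j\<in>J. (\<alpha> j)\<^sup>2)" by (rule prod_nonneg) simp
    show "0 \<le> (\<Sum>\<mu>\<in>J \<rightarrow>\<^sub>E F. (?Y \<mu>)\<^sup>2)" by (rule sum_nonneg) simp
  qed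
  also have "\<dots> = (\<Prod>j\<in>J. \<alpha> j * \<beta> j)\<^sup>2"
    by (simp add: prod.distrib prod_power_distrib power_mult_distrib)
  finally have "(\<Sum>\<mu>\<in>J \<rightarrow>\<^sub>E F. ?X \<mu> * ?Y \<mu>) \<le> (\<Prod>j\<in>J. \<alpha> j * \<beta> j)"
  proof (rule power2_le_imp_le)
    show "0 \<le> (\<Prod>j\<in>J. \<alpha> j * \<beta> j)"
      using u(2) w(2) by (intro prod_nonneg) simp
  qed
  then show ?thesis by (simp add: prod.distrib)
qed

text \<open>
  A principal minor on \<open>S\<close> is a sum over injective maps \<open>\<nu>\<close> from \<open>S\<close> to the summation indices and over
  permutations \<open>p\<close> of \<open>S\<close>.  Such a triple is encoded by the image \<open>J\<close> of \<open>\<nu>\<close>, the inverse \<open>\<mu>\<close>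
  of \<open>\<nu>\<close> on \<open>J\<close> and the conjugate \<open>\<pi>\<close> of \<open>p\<close>, from which it can be recovered.  This makes the
  set of indices \<open>J\<close> the outer summation variable; dropping the injectivity of \<open>\<mu>\<close> only adds nonnegative terms.
\<close>

lemma sum_minors_le_sum_over_maps:
  fixes u w :: "nat \<Rightarrow> 'i \<Rightarrow> complex"
  assumes "finite F"
  shows "(\<Sum>S\<in>Pow F. cmod (det_on S (\<lambda>e f. \<Sum>n<N. u n e * w n f)))
    \<le> (\<Sum>J\<in>Pow {..<N}. \<Sum>\<pi> | \<pi> permutes J. \<Sum>\<mu>\<in>J \<rightarrow>\<^sub>E F.
          \<Prod>j\<in>J. cmod (u j (\<mu> j)) * cmod (w j (\<mu> (\<pi> j))))"
proof -
  let ?s = "\<lambda>(S, \<nu>, p). \<Prod>e\<in>S. cmod (u (\<nu> e) e) * cmod (w (\<nu> e) (p e))"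
  let ?t = "\<lambda>(J, \<pi>, \<mu>). \<Prod>j\<in>J. cmod (u j (\<mu> j)) * cmod (w j (\<mu> (\<pi> j)))"
  let ?I = "\<lambda>S. {\<nu>. \<nu> \<in> S \<rightarrow>\<^sub>E {..<N} \<and> inj_on \<nu> S}"
  let ?X = "SIGMA S:Pow F. ?I S \<times> {p. p permutes S}"
  let ?Y = "SIGMA J:Pow {..<N}. {\<pi>. \<pi> permutes J} \<times> (J \<rightarrow>\<^sub>E F)"
  have finI: "finite (?I S)" if "S \<subseteq> F" for S
    by (rule finite_subset[of _ "S \<rightarrow>\<^sub>E {..<N}"])
       (use that assms finite_subset in \<open>auto intro!: finite_PiE\<close>)
  have finS: "finite S" if "S \<subseteq> F" for S using that assms finite_subset by blast
  have finJ: "finite J" if "J \<subseteq> {..<N}" for J using that finite_subset by blast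
  have finX: "finite ?X" using assms finS finI by (intro finite_SigmaI finite_cartesian_product finite_permutations) auto
  have finY: "finite ?Y" using assms finJ by (intro finite_SigmaI finite_cartesian_product finite_permutations finite_PiE) auto
  have "cmod (det_on S (\<lambda>e f. \<Sum>n<N. u n e * w n f)) \<le> (\<Sum>\<nu>\<in>?I S. \<Sum>p | p permutes S. ?s (S, \<nu>, p))"
    if "S \<subseteq> F" for S
  proof -
    have "cmod (det_on S (\<lambda>e f. \<Sum>n<N. u n e * w n f))
        \<le> (\<Sum>\<nu>\<in>?I S. cmod ((\<Prod>e\<in>S. u (\<nu> e) e) * det_on S (\<lambda>e. w (\<nu> e))))"
      unfolding det_on_sum_of_rank_ones[OF finS[OF that]] by (rule norm_sum)
    also have "\<dots> \<le> (\<Sum>\<nu>\<in>?I S. \<Sum>p | p permutes S. ?s (S, \<nu>, p))"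
    proof (rule sum_mono)
      fix \<nu> assume "\<nu> \<in> ?I S"
      have "cmod (det_on S (\<lambda>e. w (\<nu> e))) \<le> (\<Sum>p | p permutes S. \<Prod>e\<in>S. cmod (w (\<nu> e) (p e)))"
        unfolding det_on_def
        by (rule order_trans[OF norm_sum]) (auto intro!: sum_mono simp: norm_mult prod_norm sign_def)
      then have "cmod (\<Prod>e\<in>S. u (\<nu> e) e) * cmod (det_on S (\<lambda>e. w (\<nu> e)))
          \<le> cmod (\<Prod>e\<in>S. u (\<nu> e) e) * (\<Sum>p | p permutes S. \<Prod>e\<in>S. cmod (w (\<nu> e) (p e)))"
        by (rule mult_left_mono) simp
      then show "cmod ((\<Prod>e\<in>S. u (\<nu> e) e) * det_on S (\<lambda>e. w (\<nu> e))) \<le> (\<Sum>p | p permutes S. ?s (S, \<nu>, p))"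
        by (simp add: norm_mult prod.distrib sum_distrib_left prod_norm)
    qed
    finally show ?thesis .
  qed
  then have "(\<Sum>S\<in>Pow F. cmod (det_on S (\<lambda>e f. \<Sum>n<N. u n e * w n f)))
      \<le> (\<Sum>S\<in>Pow F. \<Sum>\<nu>\<in>?I S. \<Sum>p | p permutes S. ?s (S, \<nu>, p))"
    by (intro sum_mono) auto
  also have "\<dots> = (\<Sum>S\<in>Pow F. \<Sum>q\<in>?I S \<times> {p. p permutes S}. ?s (S, q))"
    unfolding sum.cartesian_product[symmetric] by (simp add: sum.cartesian_product case_prod_unfold)
  also have "\<dots> = sum ?s ?X"
    using assms finI finS
    by (subst sum.Sigma) (auto simp: case_prod_unfold intro!: finite_cartesian_product finite_permutations)
  also have "\<dots> \<le> sum ?t ?Y"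
  proof (rule sum_le_included[OF finX finY, where i = "\<lambda>(J, \<pi>, \<mu>). (\<mu> ` J,
      restrict (inv_into J \<mu>) (\<mu> ` J), \<lambda>e. if e \<in> \<mu> ` J then \<mu> (\<pi> (inv_into J \<mu> e)) else e)"])
    show "\<forall>y\<in>?Y. 0 \<le> ?t y" by (auto intro!: prod_nonneg)
    show "\<forall>x\<in>?X. \<exists>y\<in>?Y. (\<lambda>(J, \<pi>, \<mu>). (\<mu> ` J, restrict (inv_into J \<mu>) (\<mu> ` J),
        \<lambda>e. if e \<in> \<mu> ` J then \<mu> (\<pi> (inv_into J \<mu> e)) else e)) y = x \<and> ?s x \<le> ?t y"
    proof
      fix x assume "x \<in> ?X"
      then obtain S \<nu> p where x: "x = (S, \<nu>, p)" and S: "S \<subseteq> F" and \<nu>: "\<nu> \<in> S \<rightarrow>\<^sub>E {..<N}" "inj_on \<nu> S"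
        and p: "p permutes S" by auto
      define J where "J = \<nu> ` S"
      define \<mu> where "\<mu> = restrict (inv_into S \<nu>) J"
      define \<pi> where "\<pi> = (\<lambda>j. if j \<in> J then \<nu> (p (\<mu> j)) else j)"
      have \<mu>\<nu>: "\<mu> (\<nu> e) = e" if "e \<in> S" for e using that \<nu> by (simp add: \<mu>_def J_def)
      have \<nu>J: "\<nu> e \<in> J" if "e \<in> S" for e using that by (simp add: J_def)
      have pS: "p e \<in> S \<longleftrightarrow> e \<in> S" for e by (rule permutes_in_image[OF p])
      have \<mu>J: "\<mu> ` J = S" using \<mu>\<nu> by (force simp: J_def)
      have \<mu>_inj: "inj_on \<mu> J" using \<mu>\<nu> by (auto simp: J_def inj_on_def)
      have inv\<mu>: "inv_into J \<mu> e = \<nu> e" if "e \<in> S" for e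
        using inv_into_f_f[OF \<mu>_inj \<nu>J[OF that]] \<mu>\<nu>[OF that] by simp
      have "bij_betw \<pi> J J"
      proof (rule bij_betwI[where g = "\<lambda>j. \<nu> (inv p (\<mu> j))"])
        show "\<pi> \<in> J \<rightarrow> J" using \<nu>J pS \<mu>\<nu> by (auto simp: \<pi>_def J_def)
        show "(\<lambda>j. \<nu> (inv p (\<mu> j))) \<in> J \<rightarrow> J"
          using \<nu>J \<mu>\<nu> permutes_in_image[OF permutes_inv[OF p]] by (auto simp: J_def)
        show "\<nu> (inv p (\<mu> (\<pi> j))) = j" if "j \<in> J" for j
          using that pS \<mu>\<nu> permutes_inverses[OF p] by (auto simp: \<pi>_def J_def)
        show "\<pi> (\<nu> (inv p (\<mu> j))) = j" if "j \<in> J" for j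
        proof -
          obtain e where e: "e \<in> S" "j = \<nu> e" using \<open>j \<in> J\<close> by (auto simp: J_def)
          then have "inv p e \<in> S" using permutes_in_image[OF permutes_inv[OF p]] by simp
          then show ?thesis using e by (simp add: \<pi>_def \<nu>J \<mu>\<nu> permutes_inverses[OF p])
        qed
      qed
      then have \<pi>: "\<pi> permutes J"
        by (rule bij_imp_permutes) (simp add: \<pi>_def)
      have "(J, \<pi>, \<mu>) \<in> ?Y"
        using \<nu> \<pi> S \<mu>J by (auto simp: J_def \<mu>_def)
      moreover have "restrict (inv_into J \<mu>) (\<mu> ` J) = \<nu>"
        using \<nu>(1) inv\<mu> \<mu>J by (auto simp: fun_eq_iff restrict_def PiE_def extensional_def)
      moreover have "(\<lambda>e. if e \<in> \<mu> ` J then \<mu> (\<pi> (inv_into J \<mu> e)) else e) = p"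
        using \<mu>J inv\<mu> \<nu>J pS \<mu>\<nu> permutes_not_in[OF p] by (auto simp: fun_eq_iff \<pi>_def)
      moreover have "?s (S, \<nu>, p) = ?t (J, \<pi>, \<mu>)"
      proof -
        have "?t (J, \<pi>, \<mu>) = (\<Prod>e\<in>S. cmod (u (\<nu> e) (\<mu> (\<nu> e))) * cmod (w (\<nu> e) (\<mu> (\<pi> (\<nu> e)))))"
          unfolding J_def using \<nu>(2) by (simp add: prod.reindex)
        also have "\<dots> = ?s (S, \<nu>, p)"
          unfolding prod.case by (rule prod.cong) (auto simp: \<mu>\<nu> \<pi>_def \<nu>J pS)
        finally show ?thesis ..
      qed
      ultimately show "\<exists>y\<in>?Y. (\<lambda>(J, \<pi>, \<mu>). (\<mu> ` J, restrict (inv_into J \<mu>) (\<mu> ` J),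
        \<lambda>e. if e \<in> \<mu> ` J then \<mu> (\<pi> (inv_into J \<mu> e)) else e)) y = x \<and> ?s x \<le> ?t y"
        unfolding x using \<mu>J by (intro bexI[of _ "(J, \<pi>, \<mu>)"]) (simp_all only: prod.case, simp)
    qed
  qed
  also have "\<dots> = (\<Sum>J\<in>Pow {..<N}. \<Sum>q\<in>{\<pi>. \<pi> permutes J} \<times> (J \<rightarrow>\<^sub>E F). ?t (J, q))"
    using assms finJ finite_permutations by (subst sum.Sigma) (auto simp: case_prod_unfold intro!: finite_PiE)
  also have "\<dots> = (\<Sum>J\<in>Pow {..<N}. \<Sum>\<pi> | \<pi> permutes J. \<Sum>\<mu>\<in>J \<rightarrow>\<^sub>E F. ?t (J, \<pi>, \<mu>))"
    by (simp add: sum.cartesian_product case_prod_unfold)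
  finally show ?thesis by simp
qed

text \<open>
  For each \<open>J\<close> there are $|J|!$ permutations, and $|J|! \le \prod_{n\in J}(n+1)$; the remaining sum
  over all sets \<open>J\<close> is an expanded product.
\<close>

lemma sum_minors_le_prod:
  fixes u w :: "nat \<Rightarrow> 'i \<Rightarrow> complex"
  assumes "finite F"
    and u: "\<And>n. (\<Sum>e\<in>F. (cmod (u n e))\<^sup>2) \<le> (\<alpha> n)\<^sup>2" "\<And>n. 0 \<le> \<alpha> n"
    and w: "\<And>n. (\<Sum>e\<in>F. (cmod (w n e))\<^sup>2) \<le> (\<beta> n)\<^sup>2" "\<And>n. 0 \<le> \<beta> n"
  shows "(\<Sum>S\<in>Pow F. cmod (det_on S (\<lambda>e f. \<Sum>n<N. u n e * w n f)))
    \<le> (\<Prod>n<N. 1 + (real n + 1) * (\<alpha> n * \<beta> n))"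
proof -
  have "(\<Sum>S\<in>Pow F. cmod (det_on S (\<lambda>e f. \<Sum>n<N. u n e * w n f)))
    \<le> (\<Sum>J\<in>Pow {..<N}. \<Sum>\<pi> | \<pi> permutes J. \<Sum>\<mu>\<in>J \<rightarrow>\<^sub>E F.
          \<Prod>j\<in>J. cmod (u j (\<mu> j)) * cmod (w j (\<mu> (\<pi> j))))"
    by (rule sum_minors_le_sum_over_maps[OF assms(1)])
  also have "\<dots> \<le> (\<Sum>J\<in>Pow {..<N}. \<Sum>\<pi> | \<pi> permutes J. \<Prod>j\<in>J. \<alpha> j * \<beta> j)"
    using assms finite_subset[of _ "{..<N}"] by (intro sum_mono sum_over_maps_le) auto
  also have "\<dots> = (\<Sum>J\<in>Pow {..<N}. fact (card J) * (\<Prod>j\<in>J. \<alpha> j * \<beta> j))"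
    using finite_subset[of _ "{..<N}"] by (intro sum.cong refl) (auto simp: card_permutations)
  also have "\<dots> \<le> (\<Sum>J\<in>Pow {..<N}. (\<Prod>n\<in>J. real n + 1) * (\<Prod>j\<in>J. \<alpha> j * \<beta> j))"
    using u w finite_subset[of _ "{..<N}"]
    by (intro sum_mono mult_right_mono fact_card_le_prod prod_nonneg) auto
  also have "\<dots> = (\<Prod>n<N. (real n + 1) * (\<alpha> n * \<beta> n) + 1)"
    by (subst prod_add) (auto simp: prod.distrib)
  finally show ?thesis by (simp add: add.commute)
qed

section \<open>Complex-linear bounded operators\<close>

lemma sums_eq_rhs: "f sums a \<Longrightarrow> a = b \<Longrightarrow> f sums b"
  by simp

lemma scaleC_one [simp]: "1 *\<^sub>C x = (x :: 'a::complex_normed_vector)"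
  using scaleC_of_real[of 1 x] by simp

lemma bounded_bilinear_scaleC: "bounded_bilinear ((*\<^sub>C) :: complex \<Rightarrow> 'a::complex_normed_vector \<Rightarrow> 'a)"
proof
  fix a b :: complex and x y :: 'a and r :: real
  show "(a + b) *\<^sub>C x = a *\<^sub>C x + b *\<^sub>C x" by (rule scaleC_add_left)
  show "a *\<^sub>C (x + y) = a *\<^sub>C x + a *\<^sub>C y" by (rule scaleC_add_right)
  show "(r *\<^sub>R a) *\<^sub>C x = r *\<^sub>R (a *\<^sub>C x)"
    by (simp add: scaleR_conv_of_real scaleC_scaleC[symmetric] scaleC_of_real)
  show "a *\<^sub>C (r *\<^sub>R x) = r *\<^sub>R (a *\<^sub>C x)"
    by (simp add: scaleC_scaleC scaleC_of_real[symmetric] mult.commute)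
  show "\<exists>K. \<forall>a (x::'a). norm (a *\<^sub>C x) \<le> norm a * norm x * K"
    by (rule exI[of _ 1]) (simp add: norm_scaleC)
qed

interpretation scaleC: bounded_bilinear "(*\<^sub>C) :: complex \<Rightarrow> 'a::complex_normed_vector \<Rightarrow> 'a"
  by (rule bounded_bilinear_scaleC)

lemma blinfun_apply_scaleC [simp]: "blinfun_apply (c *\<^sub>C T) x = c *\<^sub>C blinfun_apply T x"
  by transfer simp

lemma cboundedD: "cbounded T \<Longrightarrow> blinfun_apply T (c *\<^sub>C x) = c *\<^sub>C blinfun_apply T x"
  by (simp add: cbounded_def)

lemma scaleC_compose: "(c *\<^sub>C S) o\<^sub>L T = c *\<^sub>C (S o\<^sub>L T)"
  by (rule blinfun_eqI) simp

lemma compose_scaleC: "cbounded S \<Longrightarrow> S o\<^sub>L (c *\<^sub>C T) = c *\<^sub>C (S o\<^sub>L T)"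
  by (rule blinfun_eqI) (simp add: cboundedD)

lemma compose_assoc: "(R o\<^sub>L S) o\<^sub>L T = R o\<^sub>L (S o\<^sub>L T)"
  by (rule blinfun_eqI) simp

lemma cbounded_id: "cbounded id_blinfun"
  by (simp add: cbounded_def)

lemma cbounded_compose: "cbounded S \<Longrightarrow> cbounded T \<Longrightarrow> cbounded (S o\<^sub>L T)"
  by (simp add: cbounded_def)

lemma cbounded_uminus: "cbounded S \<Longrightarrow> cbounded (- S)"
  by (simp add: cbounded_def blinfun.minus_left scaleC.minus_right)

lemma cbounded_scaleC: "cbounded S \<Longrightarrow> cbounded (c *\<^sub>C S)"
  by (simp add: cbounded_def scaleC_scaleC mult.commute)

lemma cbounded_op_pow: "cbounded A \<Longrightarrow> cbounded (op_pow A n)"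
  by (induction n) (simp_all add: cbounded_id cbounded_compose)

lemma cbounded_sums:
  assumes "f sums T" "\<And>n. cbounded (f n)"
  shows "cbounded T"
  unfolding cbounded_def
proof (intro allI)
  fix c x
  have apply_sums: "(\<lambda>n. blinfun_apply (f n) y) sums blinfun_apply T y" for y
    using assms(1) bounded_linear.sums[OF blinfun.bounded_linear_left] by blast
  have "(\<lambda>n. blinfun_apply (f n) (c *\<^sub>C x)) sums (c *\<^sub>C blinfun_apply T x)"
    unfolding cboundedD[OF assms(2)] by (rule bounded_linear.sums[OF bounded_linear_scaleC apply_sums])
  then show "blinfun_apply T (c *\<^sub>C x) = c *\<^sub>C blinfun_apply T x"
    using apply_sums sums_unique2 by blast
qed

lemma norm_op_pow_le: "norm (op_pow A n) \<le> norm A ^ n"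
proof (induction n)
  case 0
  show ?case by (simp add: norm_blinfun_id_le)
next
  case (Suc n)
  have "norm (op_pow A (Suc n)) \<le> norm A * norm (op_pow A n)"
    by (simp add: norm_blinfun_compose)
  also have "\<dots> \<le> norm A * norm A ^ n" using Suc by (intro mult_left_mono) auto
  finally show ?case by simp
qed

section \<open>Holomorphic functions of a bounded operator\<close>

definition taylor_coeff :: "(complex \<Rightarrow> complex) \<Rightarrow> nat \<Rightarrow> complex"
  where "taylor_coeff f n = (deriv ^^ n) f 0 / fact n"

text \<open>
  The value of a function at an operator, given by the Taylor series of the function at the
  origin.  The series converges if the function is holomorphic on a disc about the origin whose
  radius exceeds the norm of the operator.
\<close>

definition fcalc :: "(complex \<Rightarrow> complex) \<Rightarrow> 'a::complex_hilbert \<Rightarrow>\<^sub>L 'a \<Rightarrow> 'a \<Rightarrow>\<^sub>L 'a"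
  where "fcalc f A = (\<Sum>n. taylor_coeff f n *\<^sub>C op_pow A n)"

lemma taylor_coeff_sums:
  assumes "f holomorphic_on ball 0 r" "cmod z < r"
  shows "(\<lambda>n. taylor_coeff f n * z ^ n) sums f z"
  using holomorphic_power_series[OF assms(1), of z] assms(2) by (simp add: taylor_coeff_def)

lemma taylor_coeff_unique:
  assumes "0 < r" and "\<And>z. cmod z < r \<Longrightarrow> (\<lambda>n. a n * z ^ n) sums f z"
  shows "taylor_coeff f n = a n"
proof -
  have "f has_fps_expansion Abs_fps a"
    by (rule has_fps_expansionI, rule eventually_nhds_in_open[of "ball 0 r", THEN eventually_mono])
       (use assms in auto)
  from fps_nth_fps_expansion[OF this, of n] show ?thesis by (simp add: taylor_coeff_def)
qed

lemma holomorphic_on_power_series: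
  assumes "\<And>z. cmod z < r \<Longrightarrow> (\<lambda>n. a n * z ^ n) sums f z"
  shows "f holomorphic_on ball 0 r"
  using assms by (intro power_series_holomorphic[of 0 r a]) auto

lemma taylor_coeff_bound:
  assumes "f holomorphic_on ball 0 r" "0 < s" "s < r" "\<And>z. cmod z = s \<Longrightarrow> cmod (f z) \<le> K"
  shows "cmod (taylor_coeff f n) \<le> K / s ^ n"
proof -
  have "cball (0::complex) s \<subseteq> ball 0 r" using assms by auto
  then have "continuous_on (cball 0 s) f" "f holomorphic_on ball 0 s"
    using assms(1) holomorphic_on_subset holomorphic_on_imp_continuous_on
    by (blast, meson ball_subset_cball holomorphic_on_subset subset_trans)
  then have "cmod ((deriv ^^ n) f 0) \<le> fact n * K / s ^ n"
    using assms by (intro Cauchy_inequality) auto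
  then show ?thesis by (simp add: taylor_coeff_def norm_divide field_simps)
qed

text \<open>
  The calculus is applied to all functions holomorphic on the disc of radius \<open>r\<close>; the auxiliary radius
  \<open>s\<close> below lies strictly between the norm of the operator and \<open>r\<close>, so that Cauchy's estimates on the
  circle of radius \<open>s\<close> dominate the series by a geometric one.
\<close>

locale disc_operator =
  fixes A :: "'a::complex_hilbert \<Rightarrow>\<^sub>L 'a" and r :: real
  assumes cbounded_A: "cbounded A" and norm_A: "norm A < r"
begin

definition s where "s = (norm A + r) / 2"

lemma s: "norm A < s" "s < r" "0 < s" and r_pos: "0 < r"
proof -
  have "0 \<le> norm A" by simp
  then show "norm A < s" "s < r" "0 < s" "0 < r" 
    using norm_A unfolding s_def by (simp_all, linarith+)
qed

text \<open>
  The estimate of the norm by the maximum on a circle is what makes the calculus continuous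
  for uniform convergence on that circle.
\<close>

lemma fcalc_sums_bound:
  assumes "f holomorphic_on ball 0 r" "\<And>z. cmod z = s \<Longrightarrow> cmod (f z) \<le> K"
  shows "(\<lambda>n. taylor_coeff f n *\<^sub>C op_pow A n) sums fcalc f A"
    and "norm (fcalc f A) \<le> K / (1 - norm A / s)"
proof -
  have q: "0 \<le> norm A / s" "norm A / s < 1" using s by auto
  have le: "norm (taylor_coeff f n *\<^sub>C op_pow A n) \<le> K * (norm A / s) ^ n" for n
  proof -
    have "cmod (taylor_coeff f n) * norm (op_pow A n) \<le> K / s ^ n * norm A ^ n"
    proof (intro mult_mono norm_op_pow_le norm_ge_zero)
      show le: "cmod (taylor_coeff f n) \<le> K / s ^ n"
        by (rule taylor_coeff_bound[OF assms(1) s(3) s(2) assms(2)])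
      show "0 \<le> K / s ^ n" by (rule order_trans[OF norm_ge_zero le])
    qed
    then show ?thesis by (simp add: norm_scaleC power_divide)
  qed
  have geo: "(\<lambda>n. K * (norm A / s) ^ n) sums (K * (1 / (1 - norm A / s)))"
    using q by (intro sums_mult geometric_sums) simp
  have summ: "summable (\<lambda>n. norm (taylor_coeff f n *\<^sub>C op_pow A n))"
    by (rule summable_comparison_test'[OF sums_summable[OF geo], of 0]) (simp add: le)
  then show "(\<lambda>n. taylor_coeff f n *\<^sub>C op_pow A n) sums fcalc f A"
    unfolding fcalc_def by (rule summable_sums[OF summable_norm_cancel])
  have "norm (fcalc f A) \<le> (\<Sum>n. norm (taylor_coeff f n *\<^sub>C op_pow A n))"
    unfolding fcalc_def by (rule summable_norm[OF summ])
  also have "\<dots> \<le> (\<Sum>n. K * (norm A / s) ^ n)"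
    by (rule suminf_le[OF le summ sums_summable[OF geo]])
  also have "\<dots> = K / (1 - norm A / s)" using sums_unique[OF geo] by simp
  finally show "norm (fcalc f A) \<le> K / (1 - norm A / s)" .
qed

lemma bounded_on_circle:
  assumes "f holomorphic_on ball 0 r"
  obtains K where "\<And>z. cmod z = s \<Longrightarrow> cmod (f z) \<le> K"
proof -
  have "continuous_on (sphere 0 s) f"
    using assms s by (intro holomorphic_on_imp_continuous_on holomorphic_on_subset[OF assms]) auto
  then have "bounded (f ` sphere 0 s)"
    by (intro compact_imp_bounded compact_continuous_image) auto
  then obtain K where "\<forall>x\<in>sphere 0 s. cmod (f x) \<le> K" unfolding bounded_iff by auto
  then show thesis by (intro that[of K]) simp
qed

lemma fcalc_sums:
  assumes "f holomorphic_on ball 0 r"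
  shows "(\<lambda>n. taylor_coeff f n *\<^sub>C op_pow A n) sums fcalc f A"
proof -
  obtain K where "\<And>z. cmod z = s \<Longrightarrow> cmod (f z) \<le> K"
    using bounded_on_circle[OF assms] by blast
  then show ?thesis by (rule fcalc_sums_bound(1)[OF assms])
qed

lemma cbounded_fcalc:
  assumes "f holomorphic_on ball 0 r"
  shows "cbounded (fcalc f A)"
  by (rule cbounded_sums[OF fcalc_sums[OF assms]]) (intro cbounded_scaleC cbounded_op_pow cbounded_A)

lemma fcalc_add:
  assumes "f holomorphic_on ball 0 r" "g holomorphic_on ball 0 r"
  shows "fcalc (\<lambda>z. f z + g z) A = fcalc f A + fcalc g A"
proof -
  have "taylor_coeff (\<lambda>z. f z + g z) n = taylor_coeff f n + taylor_coeff g n" for n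
    using assms r_pos unfolding taylor_coeff_def
    by (subst higher_deriv_add[where S = "ball 0 r"]) (auto simp: add_divide_distrib)
  then show ?thesis
    using sums_add[OF fcalc_sums[OF assms(1)] fcalc_sums[OF assms(2)]]
    by (simp add: fcalc_def scaleC_add_left sums_iff)
qed

lemma fcalc_cmult:
  assumes "f holomorphic_on ball 0 r"
  shows "fcalc (\<lambda>z. c * f z) A = c *\<^sub>C fcalc f A"
proof -
  have "taylor_coeff (\<lambda>z. c * f z) n = c * taylor_coeff f n" for n
    using assms r_pos unfolding taylor_coeff_def
    by (subst higher_deriv_cmult[where A = "ball 0 r"]) auto
  then show ?thesis
    using bounded_linear.sums[OF bounded_linear_scaleC fcalc_sums[OF assms(1)], of c]
    by (simp add: fcalc_def scaleC_scaleC sums_iff)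
qed

lemma fcalc_diff:
  assumes "f holomorphic_on ball 0 r" "g holomorphic_on ball 0 r"
  shows "fcalc (\<lambda>z. f z - g z) A = fcalc f A - fcalc g A"
proof -
  have "fcalc (\<lambda>z. f z + (-1) * g z) A = fcalc f A + (-1) *\<^sub>C fcalc g A"
    using fcalc_add[OF assms(1), of "\<lambda>z. (-1) * g z"] fcalc_cmult[OF assms(2), of "-1"] assms(2)
    by (simp add: holomorphic_on_minus)
  then show ?thesis by (simp add: scaleC.minus_left)
qed

lemma fcalc_one: "fcalc (\<lambda>z. 1) A = id_blinfun"
proof -
  have "taylor_coeff (\<lambda>z. 1) n = (if n = 0 then 1 else 0)" for n
    using powser_sums_if[of 0] by (intro taylor_coeff_unique[of 1]) auto
  then have "(\<lambda>n. taylor_coeff (\<lambda>z. 1) n *\<^sub>C op_pow A n) = (\<lambda>n. if n = 0 then id_blinfun else 0)"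
    by (auto simp: fun_eq_iff scaleC.zero_left)
  moreover have "(\<lambda>n. if n = 0 then id_blinfun else 0) sums (id_blinfun :: 'a \<Rightarrow>\<^sub>L 'a)"
    by (rule sums_single)
  ultimately show ?thesis unfolding fcalc_def by (simp only: sums_unique[symmetric])
qed

lemma fcalc_zero: "fcalc (\<lambda>z. 0) A = 0"
  using fcalc_diff[of "\<lambda>z. 1" "\<lambda>z. 1"] by simp

lemma fcalc_sum:
  assumes "finite I" "\<And>i. i \<in> I \<Longrightarrow> f i holomorphic_on ball 0 r"
  shows "fcalc (\<lambda>z. \<Sum>i\<in>I. f i z) A = (\<Sum>i\<in>I. fcalc (f i) A)"
  using assms
proof (induction I rule: finite_induct)
  case empty
  show ?case by (simp add: fcalc_zero)
next
  case (insert i I)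
  then show ?case by (simp add: fcalc_add holomorphic_on_sum)
qed

lemma fcalc_limit:
  assumes f: "\<And>k. f k holomorphic_on ball 0 r" and g: "g holomorphic_on ball 0 r"
    and lim: "uniform_limit (sphere 0 s) f g sequentially"
  shows "(\<lambda>k. fcalc (f k) A) \<longlonglongrightarrow> fcalc g A"
proof (rule LIMSEQ_I)
  fix e :: real assume e: "0 < e"
  define d where "d = e / 2 * (1 - norm A / s)"
  have q: "norm A / s < 1" using s by simp
  then have d: "0 < d" using e by (simp add: d_def)
  obtain n0 where n0: "\<And>k z. k \<ge> n0 \<Longrightarrow> z \<in> sphere 0 s \<Longrightarrow> dist (f k z) (g z) < d"
    using uniform_limitD[OF lim d] unfolding eventually_sequentially by blast
  have "norm (fcalc (f k) A - fcalc g A) < e" if "k \<ge> n0" for k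
  proof -
    have "norm (fcalc (\<lambda>z. f k z - g z) A) \<le> d / (1 - norm A / s)"
      using n0[OF that] f g
      by (intro fcalc_sums_bound(2) holomorphic_intros) (auto simp: dist_norm less_imp_le)
    also have "\<dots> = e / 2" using q unfolding d_def by (subst nonzero_mult_div_cancel_right) auto
    also have "\<dots> < e" using e by simp
    finally show ?thesis using f g by (simp add: fcalc_diff)
  qed
  then show "\<exists>n0. \<forall>k\<ge>n0. norm (fcalc (f k) A - fcalc g A) < e" by blast
qed

lemma fcalc_times_ident:
  assumes "g holomorphic_on ball 0 r"
  shows "fcalc (\<lambda>z. z * g z) A = A o\<^sub>L fcalc g A"
proof -
  have coeff: "taylor_coeff (\<lambda>z. z * g z) n = (case n of 0 \<Rightarrow> 0 | Suc m \<Rightarrow> taylor_coeff g m)" for n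
  proof (rule taylor_coeff_unique[OF r_pos])
    fix z :: complex assume z: "cmod z < r"
    have "(\<lambda>n. (case Suc n of 0 \<Rightarrow> 0 | Suc m \<Rightarrow> taylor_coeff g m) * z ^ Suc n) sums (z * g z)"
      using sums_mult[OF taylor_coeff_sums[OF assms z], of z] by (simp add: mult_ac)
    then show "(\<lambda>n. (case n of 0 \<Rightarrow> 0 | Suc m \<Rightarrow> taylor_coeff g m) * z ^ n) sums (z * g z)"
      by (rule sums_Suc[THEN sums_eq_rhs]) simp
  qed
  have "(\<lambda>n. A o\<^sub>L (taylor_coeff g n *\<^sub>C op_pow A n)) sums (A o\<^sub>L fcalc g A)"
    by (rule bounded_linear.sums[OF bounded_bilinear.bounded_linear_right[OF bounded_bilinear_blinfun_compose]
        fcalc_sums[OF assms]])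
  then have "(\<lambda>n. taylor_coeff (\<lambda>z. z * g z) (Suc n) *\<^sub>C op_pow A (Suc n)) sums (A o\<^sub>L fcalc g A)"
    by (simp add: coeff compose_scaleC[OF cbounded_A])
  then have "(\<lambda>n. taylor_coeff (\<lambda>z. z * g z) n *\<^sub>C op_pow A n) sums (A o\<^sub>L fcalc g A)"
    by (rule sums_Suc[THEN sums_eq_rhs]) (simp add: coeff scaleC.zero_left)
  then show ?thesis by (simp add: fcalc_def sums_iff)
qed

lemma fcalc_power_times:
  assumes "g holomorphic_on ball 0 r"
  shows "fcalc (\<lambda>z. z ^ n * g z) A = op_pow A n o\<^sub>L fcalc g A"
proof (induction n)
  case 0
  show ?case by (simp add: blinfun_eqI)
next
  case (Suc n)
  have "fcalc (\<lambda>z. z * (z ^ n * g z)) A = A o\<^sub>L fcalc (\<lambda>z. z ^ n * g z) A"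
    by (intro fcalc_times_ident holomorphic_intros assms)
  with Suc show ?case by (simp add: compose_assoc mult.assoc)
qed

lemma fcalc_ident: "fcalc (\<lambda>z. z) A = A"
  using fcalc_times_ident[of "\<lambda>_. 1"] by (simp add: fcalc_one blinfun_eqI)

text \<open>
  For a monomial \<open>f\<close> the claim is a shift of Taylor coefficients, hence it holds for polynomials;
  the Taylor polynomials of \<open>f\<close> converge uniformly on the circle of radius \<open>s\<close>.
\<close>

lemma fcalc_mult:
  assumes f: "f holomorphic_on ball 0 r" and g: "g holomorphic_on ball 0 r"
  shows "fcalc (\<lambda>z. f z * g z) A = fcalc f A o\<^sub>L fcalc g A"
proof -
  let ?p = "\<lambda>N z. \<Sum>n<N. taylor_coeff f n * z ^ n"
  have p: "fcalc (\<lambda>z. ?p N z * g z) A = (\<Sum>n<N. taylor_coeff f n *\<^sub>C op_pow A n) o\<^sub>L fcalc g A" for N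
  proof -
    have "fcalc (\<lambda>z. ?p N z * g z) A = fcalc (\<lambda>z. \<Sum>n<N. taylor_coeff f n * (z ^ n * g z)) A"
      by (simp add: sum_distrib_right mult.assoc)
    also have "\<dots> = (\<Sum>n<N. taylor_coeff f n *\<^sub>C (op_pow A n o\<^sub>L fcalc g A))"
    proof (subst fcalc_sum)
      have zg: "(\<lambda>z. z ^ n * g z) holomorphic_on ball 0 r" for n
        by (intro holomorphic_intros g)
      show "(\<Sum>n<N. fcalc (\<lambda>z. taylor_coeff f n * (z ^ n * g z)) A)
          = (\<Sum>n<N. taylor_coeff f n *\<^sub>C (op_pow A n o\<^sub>L fcalc g A))"
        by (simp only: fcalc_cmult[OF zg] fcalc_power_times[OF g])
      show "(\<lambda>z. taylor_coeff f n * (z ^ n * g z)) holomorphic_on ball 0 r" for n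
        by (intro holomorphic_intros g)
    qed simp
    also have "\<dots> = (\<Sum>n<N. taylor_coeff f n *\<^sub>C op_pow A n) o\<^sub>L fcalc g A"
      by (simp add: bounded_bilinear.sum_left[OF bounded_bilinear_blinfun_compose] scaleC_compose)
    finally show ?thesis .
  qed
  have "uniform_limit (sphere 0 s) (\<lambda>N z. ?p N z * g z) (\<lambda>z. f z * g z) sequentially"
  proof (rule uniform_lim_mult)
    \<comment> \<open>A second circle, larger than the first, on which Cauchy's estimates give geometric decay.\<close>
  define s' where "s' = (s + r) / 2"
    have s': "s < s'" "s' < r" "0 < s'" using s by (auto simp: s'_def)
    have "continuous_on (sphere 0 s') f"
      using s' by (intro holomorphic_on_imp_continuous_on holomorphic_on_subset[OF f]) auto
    then have "bounded (f ` sphere 0 s')"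
      by (intro compact_imp_bounded compact_continuous_image) auto
    then obtain K where "\<forall>z\<in>sphere 0 s'. cmod (f z) \<le> K"
      unfolding bounded_iff by auto
    then have K: "\<And>z. cmod z = s' \<Longrightarrow> cmod (f z) \<le> K" by simp
    have "uniform_limit (sphere 0 s) ?p (\<lambda>z. \<Sum>n. taylor_coeff f n * z ^ n) sequentially"
    proof (rule Weierstrass_m_test)
      fix n z assume "z \<in> sphere (0::complex) s"
      then have "cmod (taylor_coeff f n) * s ^ n \<le> K / s' ^ n * s ^ n"
        using taylor_coeff_bound[OF f s'(3) s'(2) K, of n] s by (intro mult_right_mono) auto
      then show "cmod (taylor_coeff f n * z ^ n) \<le> K * (s / s') ^ n"
        using \<open>z \<in> sphere 0 s\<close> by (simp add: norm_mult norm_power power_divide)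
    next
      show "summable (\<lambda>n. K * (s / s') ^ n)"
        using s s' by (intro summable_mult summable_geometric) auto
    qed
    moreover have "(\<Sum>n. taylor_coeff f n * z ^ n) = f z" if "z \<in> sphere 0 s" for z
      using taylor_coeff_sums[OF f, of z] that s by (simp add: sums_iff)
    ultimately show "uniform_limit (sphere 0 s) ?p f sequentially"
      using uniform_limit_cong'[of "sphere 0 s" ?p ?p "\<lambda>z. \<Sum>n. taylor_coeff f n * z ^ n" f] by blast
    show "uniform_limit (sphere 0 s) (\<lambda>_. g) g sequentially"
      by (rule uniform_limit_const)
    have "continuous_on (sphere 0 s) h" if "h holomorphic_on ball 0 r" for h
      using s by (intro holomorphic_on_imp_continuous_on holomorphic_on_subset[OF that]) auto
    then have "bounded (h ` sphere 0 s)" if "h holomorphic_on ball 0 r" for h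
      using that by (intro compact_imp_bounded compact_continuous_image) auto
    then show "bounded (f ` sphere 0 s)" "bounded (g ` sphere 0 s)" using f g by auto
  qed
  then have "(\<lambda>N. fcalc (\<lambda>z. ?p N z * g z) A) \<longlonglongrightarrow> fcalc (\<lambda>z. f z * g z) A"
    by (intro fcalc_limit holomorphic_intros f g)
  moreover have "(\<lambda>N. fcalc (\<lambda>z. ?p N z * g z) A) \<longlonglongrightarrow> (fcalc f A o\<^sub>L fcalc g A)"
    unfolding p using fcalc_sums[OF f] unfolding sums_def
    by (intro bounded_bilinear.tendsto[OF bounded_bilinear_blinfun_compose] tendsto_const)
  ultimately show ?thesis using LIMSEQ_unique by blast
qed

lemma fcalc_commute:
  assumes "f holomorphic_on ball 0 r" "g holomorphic_on ball 0 r"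
  shows "fcalc f A o\<^sub>L fcalc g A = fcalc g A o\<^sub>L fcalc f A"
  using fcalc_mult[OF assms] fcalc_mult[OF assms(2,1)] by (simp add: mult.commute)

text \<open>
  The partial sums of the exponential series of \<open>f\<close> converge uniformly on the circle of radius \<open>s\<close>,
  and the powers of \<open>f\<close> correspond to powers of the operator.
\<close>

lemma op_exp_fcalc:
  assumes f: "f holomorphic_on ball 0 r"
  shows "op_exp (fcalc f A) = fcalc (\<lambda>z. exp (f z)) A"
proof -
  let ?p = "\<lambda>N z. \<Sum>n<N. (f z) ^ n / fact n"
  have pow: "fcalc (\<lambda>z. f z ^ n) A = op_pow (fcalc f A) n" for n
  proof (induction n)
    case 0
    show ?case by (simp add: fcalc_one)
  next
    case (Suc n)
    have "fcalc (\<lambda>z. f z * f z ^ n) A = fcalc f A o\<^sub>L fcalc (\<lambda>z. f z ^ n) A"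
      by (intro fcalc_mult holomorphic_intros f)
    with Suc show ?case by simp
  qed
  have p: "fcalc (?p N) A = (\<Sum>n<N. (1 / fact n) *\<^sub>R op_pow (fcalc f A) n)" for N
  proof -
    have "fcalc (?p N) A = (\<Sum>n<N. fcalc (\<lambda>z. complex_of_real (1 / fact n) * f z ^ n) A)"
      using f by (subst fcalc_sum[symmetric]) (auto intro!: holomorphic_intros)
    also have "\<dots> = (\<Sum>n<N. (1 / fact n) *\<^sub>R op_pow (fcalc f A) n)"
    proof (rule sum.cong[OF refl])
      fix n
      have "fcalc (\<lambda>z. complex_of_real (1 / fact n) * f z ^ n) A = complex_of_real (1 / fact n) *\<^sub>C fcalc (\<lambda>z. f z ^ n) A"
        by (intro fcalc_cmult holomorphic_intros f)
      then show "fcalc (\<lambda>z. complex_of_real (1 / fact n) * f z ^ n) A = (1 / fact n) *\<^sub>R op_pow (fcalc f A) n"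
        by (simp only: pow scaleC_of_real)
    qed
    finally show ?thesis .
  qed
  obtain K where K: "\<And>z. cmod z = s \<Longrightarrow> cmod (f z) \<le> K"
    using bounded_on_circle[OF f] by blast
  have "uniform_limit (sphere 0 s) ?p (\<lambda>z. \<Sum>n. (f z) ^ n / fact n) sequentially"
  proof (rule Weierstrass_m_test)
    fix n z assume "z \<in> sphere (0::complex) s"
    then show "cmod (f z ^ n / fact n) \<le> inverse (fact n) * K ^ n"
      using K[of z] by (simp add: norm_mult norm_inverse norm_power divide_inverse power_mono mult.commute)
  next
    show "summable (\<lambda>n. inverse (fact n) * K ^ n)" by (rule summable_exp)
  qed
  moreover have "(\<Sum>n. (f z) ^ n / fact n) = exp (f z)" for z
    by (simp add: exp_def scaleR_conv_of_real divide_inverse mult.commute)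
  ultimately have "uniform_limit (sphere 0 s) ?p (\<lambda>z. exp (f z)) sequentially" by simp
  then have "(\<lambda>N. fcalc (?p N) A) \<longlonglongrightarrow> fcalc (\<lambda>z. exp (f z)) A"
    by (intro fcalc_limit holomorphic_intros f) auto
  then have "(\<lambda>n. (1 / fact n) *\<^sub>R op_pow (fcalc f A) n) sums fcalc (\<lambda>z. exp (f z)) A"
    unfolding p sums_def .
  then show ?thesis by (simp add: op_exp_def sums_iff)
qed

lemma fcalc_power_series:
  assumes "\<And>z. cmod z < r \<Longrightarrow> (\<lambda>j. a j * z ^ Suc j) sums f z"
  shows "f holomorphic_on ball 0 r" and "fcalc f A = (\<Sum>j. a j *\<^sub>C op_pow A (Suc j))"
proof -
  let ?b = "\<lambda>n. case n of 0 \<Rightarrow> 0 | Suc j \<Rightarrow> a j"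
  have b: "(\<lambda>n. ?b n * z ^ n) sums f z" if "cmod z < r" for z
  proof -
    have "(\<lambda>n. ?b (Suc n) * z ^ Suc n) sums f z" using assms[OF that] by simp
    then show ?thesis by (rule sums_Suc[THEN sums_eq_rhs]) simp
  qed
  show f: "f holomorphic_on ball 0 r" by (rule holomorphic_on_power_series[OF b])
  have coeff: "taylor_coeff f n = ?b n" for n by (rule taylor_coeff_unique[OF r_pos b])
  have "(\<lambda>n. taylor_coeff f (Suc n) *\<^sub>C op_pow A (Suc n)) sums fcalc f A"
  proof (rule sums_Suc_iff[THEN iffD2])
    show "(\<lambda>n. taylor_coeff f n *\<^sub>C op_pow A n) sums (fcalc f A + taylor_coeff f 0 *\<^sub>C op_pow A 0)"
      using fcalc_sums[OF f] by (simp add: coeff[of 0] scaleC.zero_left)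
  qed
  then show "fcalc f A = (\<Sum>j. a j *\<^sub>C op_pow A (Suc j))"
    by (simp add: coeff sums_iff)
qed

end

section \<open>The resolvent and Cauchy's formula\<close>

context disc_operator
begin

lemma fcalc_cong:
  assumes "f holomorphic_on ball 0 r" "\<And>z. cmod z < r \<Longrightarrow> f z = g z"
  shows "fcalc f A = fcalc g A"
proof -
  have "taylor_coeff g n = taylor_coeff f n" for n
    using taylor_coeff_sums[OF assms(1)] assms(2) by (intro taylor_coeff_unique[OF r_pos]) simp
  then show ?thesis by (simp add: fcalc_def)
qed

text \<open>
  On the circle of radius \<open>r\<close> this is the resolvent $(\zeta - A)^{-1}$; the function has its pole on the
  boundary of the disc, so the calculus still applies.
\<close>

definition res :: "complex \<Rightarrow> 'a \<Rightarrow>\<^sub>L 'a"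
  where "res \<zeta> = fcalc (\<lambda>z. 1 / (\<zeta> - z)) A"

lemma holomorphic_res: "cmod \<zeta> = r \<Longrightarrow> (\<lambda>z. 1 / (\<zeta> - z)) holomorphic_on ball 0 r"
  by (intro holomorphic_intros) auto

lemma cbounded_res: "cmod \<zeta> = r \<Longrightarrow> cbounded (res \<zeta>)"
  unfolding res_def by (intro cbounded_fcalc holomorphic_res)

lemma fcalc_linear: "fcalc (\<lambda>z. \<zeta> - z) A = \<zeta> *\<^sub>C id_blinfun - A"
proof -
  have "fcalc (\<lambda>z. \<zeta> * 1 - z) A = \<zeta> *\<^sub>C fcalc (\<lambda>z. 1) A - fcalc (\<lambda>z. z) A"
    by (subst fcalc_diff, (intro holomorphic_intros)+, subst fcalc_cmult, (intro holomorphic_intros)+, rule refl)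
  then show ?thesis by (simp add: fcalc_one fcalc_ident)
qed

lemma res_inverse:
  assumes "cmod \<zeta> = r"
  shows "(\<zeta> *\<^sub>C id_blinfun - A) o\<^sub>L res \<zeta> = id_blinfun" "res \<zeta> o\<^sub>L (\<zeta> *\<^sub>C id_blinfun - A) = id_blinfun"
proof -
  have lin: "(\<lambda>z. \<zeta> - z) holomorphic_on ball 0 r" by (intro holomorphic_intros)
  have "fcalc (\<lambda>z. (\<zeta> - z) * (1 / (\<zeta> - z))) A = fcalc (\<lambda>z. 1) A"
    using assms by (intro fcalc_cong[symmetric] holomorphic_intros) auto
  then show left: "(\<zeta> *\<^sub>C id_blinfun - A) o\<^sub>L res \<zeta> = id_blinfun"
    unfolding res_def fcalc_linear[symmetric] fcalc_mult[OF lin holomorphic_res[OF assms]] fcalc_one .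
  show "res \<zeta> o\<^sub>L (\<zeta> *\<^sub>C id_blinfun - A) = id_blinfun"
    using left fcalc_commute[OF lin holomorphic_res[OF assms]]
    unfolding res_def fcalc_linear by simp
qed

lemma norm_res_le:
  assumes "cmod \<zeta> = r"
  shows "norm (res \<zeta>) \<le> 1 / (r - s) / (1 - norm A / s)"
  unfolding res_def
proof (rule fcalc_sums_bound(2)[OF holomorphic_res[OF assms]])
  fix z assume z: "cmod z = s"
  have "r - s \<le> cmod (\<zeta> - z)" using norm_triangle_ineq2[of \<zeta> z] assms z by simp
  then show "cmod (1 / (\<zeta> - z)) \<le> 1 / (r - s)"
    using s by (simp add: norm_divide frac_le)
qed

lemma taylor_coeff_res:
  assumes "cmod \<zeta> = r"
  shows "taylor_coeff (\<lambda>z. 1 / (\<zeta> - z)) n = 1 / \<zeta> ^ Suc n"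
proof (rule taylor_coeff_unique[OF r_pos])
  fix z assume z: "cmod z < r"
  have nz: "\<zeta> \<noteq> 0" "\<zeta> \<noteq> z" using assms r_pos z by auto
  have "(\<lambda>n. 1 / \<zeta> * (z / \<zeta>) ^ n) sums (1 / \<zeta> * (1 / (1 - z / \<zeta>)))"
    using z assms r_pos by (intro sums_mult geometric_sums) (simp add: norm_divide)
  moreover have "1 / \<zeta> * (1 / (1 - z / \<zeta>)) = 1 / (\<zeta> - z)" using nz by (simp add: field_simps)
  moreover have "(\<lambda>n. 1 / \<zeta> * (z / \<zeta>) ^ n) = (\<lambda>n. 1 / \<zeta> ^ Suc n * z ^ n)"
    by (simp add: power_divide field_simps)
  ultimately show "(\<lambda>n. 1 / \<zeta> ^ Suc n * z ^ n) sums (1 / (\<zeta> - z))" by simp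
qed

text \<open>
  Cauchy's formula for the calculus.  The resolvent is a power series in $1/\zeta$ that converges
  uniformly on the circle, and integrating \<open>g\<close> against $\zeta^{-n-1}$ yields its Taylor coefficients.
\<close>

lemma contour_integral_res:
  fixes \<phi> :: "'a \<Rightarrow>\<^sub>L 'a \<Rightarrow> complex"
  assumes g: "g holomorphic_on ball 0 r" "continuous_on (cball 0 r) g"
    and \<phi>: "bounded_linear \<phi>" "\<And>c T. \<phi> (c *\<^sub>C T) = c * \<phi> T"
  shows "((\<lambda>\<zeta>. g \<zeta> * \<phi> (res \<zeta>)) has_contour_integral (2 * pi * \<i> * \<phi> (fcalc g A))) (circlepath 0 r)"
proof -
  let ?f = "\<lambda>N \<zeta>. \<Sum>n<N. \<phi> (op_pow A n) * (g \<zeta> / \<zeta> ^ Suc n)"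
  have f_int: "(?f N has_contour_integral (\<Sum>n<N. \<phi> (op_pow A n) * (2 * pi * \<i> * taylor_coeff g n))) (circlepath 0 r)" for N
  proof (intro has_contour_integral_sum finite_lessThan has_contour_integral_lmul)
    fix n
    show "((\<lambda>\<zeta>. g \<zeta> / \<zeta> ^ Suc n) has_contour_integral 2 * pi * \<i> * taylor_coeff g n) (circlepath 0 r)"
      using Cauchy_has_contour_integral_higher_derivative_circlepath[OF g(2,1), of 0 n] r_pos
      by (simp add: taylor_coeff_def)
  qed
  obtain K where K0: "0 \<le> K" and K: "\<And>T. norm (\<phi> T) \<le> norm T * K"
    using bounded_linear.nonneg_bounded[OF \<phi>(1)] by blast
  have "bounded (g ` cball 0 r)" using g(2) by (intro compact_imp_bounded compact_continuous_image) auto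
  then obtain G where "\<forall>z\<in>cball 0 r. cmod (g z) \<le> G" unfolding bounded_iff by auto
  then have G: "\<And>z. cmod z = r \<Longrightarrow> cmod (g z) \<le> G" by simp
  have f_sums: "(\<lambda>n. \<phi> (op_pow A n) * (g \<zeta> / \<zeta> ^ Suc n)) sums (g \<zeta> * \<phi> (res \<zeta>))" if "cmod \<zeta> = r" for \<zeta>
  proof -
    have "(\<lambda>n. \<phi> (taylor_coeff (\<lambda>z. 1 / (\<zeta> - z)) n *\<^sub>C op_pow A n)) sums \<phi> (res \<zeta>)"
      unfolding res_def by (rule bounded_linear.sums[OF \<phi>(1) fcalc_sums[OF holomorphic_res[OF that]]])
    then have "(\<lambda>n. g \<zeta> * (1 / \<zeta> ^ Suc n * \<phi> (op_pow A n))) sums (g \<zeta> * \<phi> (res \<zeta>))"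
      unfolding \<phi>(2) taylor_coeff_res[OF that] by (rule sums_mult)
    then show ?thesis by (simp add: mult_ac)
  qed
  have "uniform_limit (sphere 0 r) ?f (\<lambda>\<zeta>. \<Sum>n. \<phi> (op_pow A n) * (g \<zeta> / \<zeta> ^ Suc n)) sequentially"
  proof (rule Weierstrass_m_test)
    fix n \<zeta> assume "\<zeta> \<in> sphere (0::complex) r"
    then have \<zeta>: "cmod \<zeta> = r" by simp
    have "cmod (\<phi> (op_pow A n)) * (cmod (g \<zeta>) / r ^ Suc n) \<le> (norm A ^ n * K) * (G / r ^ Suc n)"
    proof (rule mult_mono)
      show "cmod (\<phi> (op_pow A n)) \<le> norm A ^ n * K"
        by (rule order_trans[OF K mult_right_mono[OF norm_op_pow_le K0]])
      show "cmod (g \<zeta>) / r ^ Suc n \<le> G / r ^ Suc n"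
        using G[OF \<zeta>] r_pos by (intro divide_right_mono) auto
    qed (use K0 r_pos in auto)
    also have "\<dots> = K * G / r * (norm A / r) ^ n" by (simp add: power_divide)
    finally show "cmod (\<phi> (op_pow A n) * (g \<zeta> / \<zeta> ^ Suc n)) \<le> K * G / r * (norm A / r) ^ n"
      by (simp only: norm_mult norm_divide norm_power \<zeta>)
  next
    show "summable (\<lambda>n. K * G / r * (norm A / r) ^ n)"
      using norm_A r_pos by (intro summable_mult summable_geometric) simp
  qed
  then have lim: "uniform_limit (sphere 0 r) ?f (\<lambda>\<zeta>. g \<zeta> * \<phi> (res \<zeta>)) sequentially"
    using uniform_limit_cong'[of "sphere 0 r" ?f ?f
        "\<lambda>\<zeta>. \<Sum>n. \<phi> (op_pow A n) * (g \<zeta> / \<zeta> ^ Suc n)" "\<lambda>\<zeta>. g \<zeta> * \<phi> (res \<zeta>)"]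
      sums_unique[OF f_sums] by simp
  have ev: "\<forall>\<^sub>F N in sequentially. ?f N contour_integrable_on circlepath 0 r"
    using f_int has_contour_integral_integrable by (intro always_eventually allI) blast
  note limits = contour_integral_uniform_limit_circlepath[OF ev lim sequentially_bot r_pos]
  have "(\<lambda>n. 2 * pi * \<i> * \<phi> (taylor_coeff g n *\<^sub>C op_pow A n)) sums (2 * pi * \<i> * \<phi> (fcalc g A))"
    by (rule sums_mult[OF bounded_linear.sums[OF \<phi>(1) fcalc_sums[OF g(1)]]])
  then have "(\<lambda>N. contour_integral (circlepath 0 r) (?f N)) \<longlonglongrightarrow> 2 * pi * \<i> * \<phi> (fcalc g A)"
    unfolding contour_integral_unique[OF f_int] sums_def \<phi>(2) by (simp add: mult_ac)
  with limits(2) have "contour_integral (circlepath 0 r) (\<lambda>\<zeta>. g \<zeta> * \<phi> (res \<zeta>)) = 2 * pi * \<i> * \<phi> (fcalc g A)"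
    by (rule LIMSEQ_unique)
  with has_contour_integral_integral[OF limits(1)] show ?thesis by simp
qed

end

section \<open>The semigroup of an operator\<close>

context disc_operator
begin

lemma taylor_coeff_exp: "taylor_coeff (\<lambda>z. exp (c * z)) n = c ^ n / fact n"
proof (rule taylor_coeff_unique[of 1])
  show "(\<lambda>n. c ^ n / fact n * z ^ n) sums exp (c * z)" for z
    using exp_converges[of "c * z"]
    by (simp add: power_mult_distrib scaleR_conv_of_real divide_inverse mult_ac)
qed simp

definition semigroup :: "real \<Rightarrow> 'a \<Rightarrow>\<^sub>L 'a"
  where "semigroup v = op_exp (- (v *\<^sub>R A))"

lemma semigroup_fcalc: "semigroup v = fcalc (\<lambda>z. exp (complex_of_real (- v) * z)) A"
proof -
  have "fcalc (\<lambda>z. complex_of_real (- v) * z) A = complex_of_real (- v) *\<^sub>C A"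
    by (subst fcalc_cmult) (auto intro: holomorphic_intros simp: fcalc_ident)
  then have "- (v *\<^sub>R A) = fcalc (\<lambda>z. complex_of_real (- v) * z) A"
    unfolding scaleC_of_real by simp
  moreover have "op_exp (fcalc (\<lambda>z. complex_of_real (- v) * z) A) = fcalc (\<lambda>z. exp (complex_of_real (- v) * z)) A"
    by (intro op_exp_fcalc holomorphic_intros)
  ultimately show ?thesis by (simp add: semigroup_def)
qed

lemma cbounded_semigroup: "cbounded (semigroup v)"
  unfolding semigroup_fcalc by (intro cbounded_fcalc holomorphic_intros)

lemma semigroup_add: "semigroup (v + w) = semigroup v o\<^sub>L semigroup w"
proof -
  have "semigroup (v + w) = fcalc (\<lambda>z. exp (complex_of_real (- v) * z) * exp (complex_of_real (- w) * z)) A"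
    unfolding semigroup_fcalc exp_add[symmetric] by (simp add: algebra_simps)
  also have "\<dots> = semigroup v o\<^sub>L semigroup w"
    unfolding semigroup_fcalc by (intro fcalc_mult holomorphic_intros)
  finally show ?thesis .
qed

lemma semigroup_zero: "semigroup 0 = id_blinfun"
  by (simp add: semigroup_fcalc fcalc_one)

lemma semigroup_commute: "semigroup v o\<^sub>L A = A o\<^sub>L semigroup v"
proof -
  have "fcalc (\<lambda>z. exp (complex_of_real (- v) * z)) A o\<^sub>L fcalc (\<lambda>z. z) A
      = fcalc (\<lambda>z. z) A o\<^sub>L fcalc (\<lambda>z. exp (complex_of_real (- v) * z)) A"
    by (intro fcalc_commute holomorphic_intros)
  then show ?thesis by (simp add: semigroup_fcalc fcalc_ident)
qed

lemma semigroup_sums: "(\<lambda>n. ((- v) ^ n / fact n) *\<^sub>R op_pow A n) sums semigroup v"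
proof -
  have "(\<lambda>n. taylor_coeff (\<lambda>z. exp (complex_of_real (- v) * z)) n *\<^sub>C op_pow A n) sums semigroup v"
    unfolding semigroup_fcalc by (intro fcalc_sums holomorphic_intros)
  moreover have "taylor_coeff (\<lambda>z. exp (complex_of_real (- v) * z)) n = complex_of_real ((- v) ^ n / fact n)" for n
    by (simp only: taylor_coeff_exp of_real_divide of_real_power of_real_fact)
  ultimately show ?thesis by (simp only: scaleC_of_real)
qed

lemma norm_semigroup_le: "norm (semigroup v) \<le> exp (\<bar>v\<bar> * norm A)"
proof -
  have e: "(\<lambda>n. (\<bar>v\<bar> * norm A) ^ n / fact n) sums exp (\<bar>v\<bar> * norm A)"
    using exp_converges[of "\<bar>v\<bar> * norm A"] by (simp add: divide_inverse mult.commute)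
  have le: "norm (((- v) ^ n / fact n) *\<^sub>R op_pow A n) \<le> (\<bar>v\<bar> * norm A) ^ n / fact n" for n
    using mult_left_mono[OF norm_op_pow_le[of A n], of "\<bar>v\<bar> ^ n / fact n"]
    by (simp add: power_mult_distrib power_abs)
  have summ: "summable (\<lambda>n. norm (((- v) ^ n / fact n) *\<^sub>R op_pow A n))"
    by (rule summable_comparison_test'[OF sums_summable[OF e], of 0]) (use le in simp)
  have "norm (semigroup v) \<le> (\<Sum>n. norm (((- v) ^ n / fact n) *\<^sub>R op_pow A n))"
    unfolding sums_unique[OF semigroup_sums] by (rule summable_norm[OF summ])
  also have "\<dots> \<le> (\<Sum>n. (\<bar>v\<bar> * norm A) ^ n / fact n)"
    by (rule suminf_le[OF le summ sums_summable[OF e]])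
  finally show ?thesis using sums_unique[OF e] by simp
qed

text \<open>
  Powers of the contraction at time \<open>t0\<close> decay geometrically, and the remaining time is less
  than \<open>t0\<close>.
\<close>

lemma semigroup_decay:
  assumes "t0 > 0" "norm (semigroup t0) < 1"
  obtains M \<omega> where "\<omega> > 0" "\<And>v. v \<ge> 0 \<Longrightarrow> norm (semigroup v) \<le> M * exp (- \<omega> * v)"
proof
  \<comment> \<open>The maximum keeps \<open>q\<close> positive, so that its logarithm exists.\<close>
  define q where "q = max (norm (semigroup t0)) (1 / 2)"
  have q: "0 < q" "q < 1" "norm (semigroup t0) \<le> q" using assms by (auto simp: q_def)
  define \<omega> where "\<omega> = - ln q / t0"
  define M where "M = exp (t0 * norm A) / q"
  show "\<omega> > 0" using q assms by (simp add: \<omega>_def divide_neg_pos)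
  fix v :: real assume v: "v \<ge> 0"
  define n where "n = nat \<lfloor>v / t0\<rfloor>"
  define w where "w = v - real n * t0"
  have fl: "real n \<le> v / t0" "v / t0 < real n + 1"
    using v assms(1) by (simp_all add: n_def of_nat_floor)
  have w: "0 \<le> w" "w \<le> t0"
  proof -
    have "real n * t0 \<le> v" using fl(1) assms(1) by (simp add: pos_le_divide_eq)
    moreover have "v < (real n + 1) * t0" using fl(2) assms(1) by (simp add: pos_divide_less_eq)
    ultimately show "0 \<le> w" "w \<le> t0" by (simp_all add: w_def algebra_simps)
  qed
  have pow: "norm (semigroup (real k * t0)) \<le> q ^ k" for k
  proof (induction k)
    case 0
    show ?case by (simp add: semigroup_zero norm_blinfun_id_le)
  next
    case (Suc k)
    have "semigroup (real (Suc k) * t0) = semigroup t0 o\<^sub>L semigroup (real k * t0)"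
      by (simp add: semigroup_add[symmetric] algebra_simps)
    then have "norm (semigroup (real (Suc k) * t0)) \<le> norm (semigroup t0) * norm (semigroup (real k * t0))"
      by (simp add: norm_blinfun_compose)
    also have "\<dots> \<le> q * q ^ k" using Suc q by (intro mult_mono) auto
    finally show ?case by simp
  qed
  have "semigroup v = semigroup (real n * t0) o\<^sub>L semigroup w"
    by (simp add: semigroup_add[symmetric] w_def)
  then have "norm (semigroup v) \<le> norm (semigroup (real n * t0)) * norm (semigroup w)"
    by (simp add: norm_blinfun_compose)
  also have "\<dots> \<le> q ^ n * exp (t0 * norm A)"
  proof (rule mult_mono[OF pow])
    have "\<bar>w\<bar> * norm A \<le> t0 * norm A" using w by (intro mult_right_mono) auto
    then show "norm (semigroup w) \<le> exp (t0 * norm A)"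
      using norm_semigroup_le[of w] by (meson exp_le_cancel_iff order_trans)
  qed (use q in auto)
  also have "q ^ n \<le> exp (- \<omega> * v) / q"
  proof -
    have "q ^ n = exp (real n * ln q)" using q by (simp add: exp_of_nat_mult)
    also have "\<dots> \<le> exp ((v / t0 - 1) * ln q)"
      using fl q by (intro iffD2[OF exp_le_cancel_iff] mult_right_mono_neg) auto
    also have "\<dots> = exp (- \<omega> * v) / q"
      using q by (simp add: \<omega>_def algebra_simps exp_diff)
    finally show ?thesis .
  qed
  finally show "norm (semigroup v) \<le> M * exp (- \<omega> * v)"
    by (simp add: M_def mult.commute)
qed

text \<open>
  The difference quotient is controlled by the estimate for the calculus applied to
  $e^{-hz} - 1 + hz$, which is of order $h^2$ uniformly on a circle.
\<close>

lemma semigroup_has_derivative_zero: "(semigroup has_vector_derivative - A) (at 0)"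
proof -
  define C where "C = exp s * s ^ 2 / (1 - norm A / s)"
  have bound: "norm (semigroup h - id_blinfun + h *\<^sub>R A) \<le> C * h\<^sup>2" if h: "\<bar>h\<bar> \<le> 1" for h
  proof -
    have hol: "(\<lambda>z. exp (complex_of_real (- h) * z)) holomorphic_on ball 0 r"
      "(\<lambda>z. complex_of_real h * z) holomorphic_on ball 0 r" "(\<lambda>z. 1) holomorphic_on ball 0 r"
      "(\<lambda>z. z) holomorphic_on ball 0 r" "(\<lambda>z. exp (complex_of_real (- h) * z) - 1) holomorphic_on ball 0 r"
      by (intro holomorphic_intros)+
    have "fcalc (\<lambda>z. (exp (complex_of_real (- h) * z) - 1) + complex_of_real h * z) A
      = semigroup h - id_blinfun + complex_of_real h *\<^sub>C A"
      unfolding semigroup_fcalc fcalc_add[OF hol(5,2)] fcalc_diff[OF hol(1,3)] fcalc_cmult[OF hol(4)]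
        fcalc_one fcalc_ident ..
    then have "norm (semigroup h - id_blinfun + h *\<^sub>R A)
      = norm (fcalc (\<lambda>z. (exp (complex_of_real (- h) * z) - 1) + complex_of_real h * z) A)"
      by (simp only: scaleC_of_real)
    also have "\<dots> \<le> exp s * (s * \<bar>h\<bar>)\<^sup>2 / (1 - norm A / s)"
    proof (rule fcalc_sums_bound(2))
      show "(\<lambda>z. (exp (complex_of_real (- h) * z) - 1) + complex_of_real h * z) holomorphic_on ball 0 r"
        by (intro holomorphic_intros)
      fix z assume z: "cmod z = s"
      define y where "y = complex_of_real (- h) * z"
      have y: "cmod y = s * \<bar>h\<bar>" by (simp add: y_def norm_mult z)
      have "cmod (exp y - (\<Sum>k\<le>1. y ^ k / fact k)) \<le> exp \<bar>Re y\<bar> * cmod y ^ Suc 1 / fact 1"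
        by (rule Taylor_exp)
      then have "cmod (exp y - 1 - y) \<le> exp \<bar>Re y\<bar> * (cmod y)\<^sup>2"
        by (simp add: numeral_2_eq_2 algebra_simps)
      also have "\<dots> \<le> exp s * (cmod y)\<^sup>2"
      proof (rule mult_right_mono)
        have "\<bar>Re y\<bar> \<le> s * \<bar>h\<bar>" using abs_Re_le_cmod[of y] y by simp
        also have "\<dots> \<le> s" using h s by (simp add: mult_left_le)
        finally show "exp \<bar>Re y\<bar> \<le> exp s" by simp
      qed simp
      finally show "cmod (exp (complex_of_real (- h) * z) - 1 + complex_of_real h * z) \<le> exp s * (s * \<bar>h\<bar>)\<^sup>2"
        unfolding y unfolding y_def by (simp add: algebra_simps)
    qed
    also have "\<dots> = C * h\<^sup>2" by (simp add: C_def power_mult_distrib)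
    finally show ?thesis .
  qed
  have C0: "0 \<le> C" using s by (simp add: C_def)
  have "((\<lambda>h. norm (semigroup (0 + h) - semigroup 0 - h *\<^sub>R (- A)) / norm h) \<longlongrightarrow> 0) (at 0)"
  proof (rule Lim_null_comparison)
    show "\<forall>\<^sub>F h in at 0. norm (norm (semigroup (0 + h) - semigroup 0 - h *\<^sub>R (- A)) / norm h) \<le> C * \<bar>h\<bar>"
      unfolding eventually_at
    proof (intro exI[of _ 1] conjI ballI impI)
      fix h :: real assume h: "h \<noteq> 0 \<and> dist h 0 < 1"
      then have "norm (semigroup h - id_blinfun + h *\<^sub>R A) / \<bar>h\<bar> \<le> C * h\<^sup>2 / \<bar>h\<bar>"
        using bound[of h] by (intro divide_right_mono) auto
      also have "h\<^sup>2 = \<bar>h\<bar> * \<bar>h\<bar>" by (simp add: power2_eq_square)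
      also have "C * (\<bar>h\<bar> * \<bar>h\<bar>) / \<bar>h\<bar> = C * \<bar>h\<bar>" using h by (simp add: divide_eq_eq mult.assoc)
      finally show "norm (norm (semigroup (0 + h) - semigroup 0 - h *\<^sub>R (- A)) / norm h) \<le> C * \<bar>h\<bar>"
        by (simp add: semigroup_zero)
    qed simp
    show "((\<lambda>h. C * \<bar>h\<bar>) \<longlongrightarrow> 0) (at (0::real))"
      by (auto intro!: tendsto_eq_intros)
  qed
  then show ?thesis
    unfolding has_vector_derivative_def has_derivative_at using bounded_linear_scaleR_left[of "- A"] by simp
qed

lemma semigroup_has_derivative: "(semigroup has_vector_derivative - (A o\<^sub>L semigroup v)) (at v)"
proof -
  have "((\<lambda>u. u - v) has_vector_derivative 1) (at v)"
    by (auto intro!: derivative_eq_intros)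
  then have "((semigroup \<circ> (\<lambda>u. u - v)) has_vector_derivative (1 *\<^sub>R - A)) (at v)"
    by (rule vector_diff_chain_at) (simp add: semigroup_has_derivative_zero)
  then have "((\<lambda>u. semigroup v o\<^sub>L semigroup (u - v)) has_vector_derivative (semigroup v o\<^sub>L - A)) (at v)"
    using bounded_linear.has_vector_derivative[OF
        bounded_bilinear.bounded_linear_right[OF bounded_bilinear_blinfun_compose, of "semigroup v"]]
    by (fastforce simp: o_def)
  moreover have "semigroup v o\<^sub>L semigroup (u - v) = semigroup u" for u
    by (simp add: semigroup_add[symmetric])
  moreover have "semigroup v o\<^sub>L - A = - (A o\<^sub>L semigroup v)"
    by (simp add: semigroup_commute[symmetric] bounded_bilinear.minus_right[OF bounded_bilinear_blinfun_compose])
  ultimately show ?thesis by simp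
qed

end

section \<open>The operator $R_x$\<close>

locale linear_system = op1: disc_operator A1 r + op2: disc_operator A2 r
  for A1 A2 :: "'h::{complex_hilbert, second_countable_topology} \<Rightarrow>\<^sub>L 'h" and r +
  fixes B :: "complex \<Rightarrow>\<^sub>L 'h" and C :: "'h \<Rightarrow>\<^sub>L complex" and x M \<omega> :: real
  assumes cbounded_B: "cbounded B" and cbounded_C: "cbounded C" and x_pos: "0 < x" and \<omega>_pos: "0 < \<omega>"
    and decay1: "\<And>v. 0 \<le> v \<Longrightarrow> norm (op1.semigroup v) \<le> M * exp (- \<omega> * v)"
    and decay2: "\<And>v. 0 \<le> v \<Longrightarrow> norm (op2.semigroup v) \<le> M * exp (- \<omega> * v)"
begin

abbreviation "\<mu> \<equiv> lebesgue_on {x<..}"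

text \<open>
  The integrand of $R_x$; its values have rank at most one.
\<close>

definition kernel :: "real \<Rightarrow> 'h \<Rightarrow>\<^sub>L 'h"
  where "kernel v = op2.semigroup v o\<^sub>L (B o\<^sub>L C) o\<^sub>L op1.semigroup v"

lemma M_nonneg: "0 \<le> M"
  using order_trans[OF norm_ge_zero decay1[of 0]] by simp

lemma kernel_apply:
  "blinfun_apply (kernel v) h
    = blinfun_apply C (blinfun_apply (op1.semigroup v) h) *\<^sub>C blinfun_apply (op2.semigroup v) (blinfun_apply B 1)"
proof -
  have "blinfun_apply B c = c *\<^sub>C blinfun_apply B 1" for c
    using cboundedD[OF cbounded_B, of c 1] by (simp add: scaleC_complex_def)
  then show ?thesis
    by (metis cboundedD[OF op2.cbounded_semigroup] blinfun_apply_blinfun_compose kernel_def)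
qed

lemma kernel_has_derivative:
  "(kernel has_vector_derivative - ((A2 o\<^sub>L kernel v) + (kernel v o\<^sub>L A1))) (at v)"
proof -
  note bilin = bounded_bilinear_blinfun_compose
  have 1: "((\<lambda>v. op2.semigroup v o\<^sub>L (B o\<^sub>L C)) has_vector_derivative (- (A2 o\<^sub>L op2.semigroup v)) o\<^sub>L (B o\<^sub>L C)) (at v)"
    by (rule bounded_linear.has_vector_derivative[OF bounded_bilinear.bounded_linear_left[OF bilin]
        op2.semigroup_has_derivative])
  have "((\<lambda>v. (op2.semigroup v o\<^sub>L (B o\<^sub>L C)) o\<^sub>L op1.semigroup v) has_vector_derivative
      ((op2.semigroup v o\<^sub>L (B o\<^sub>L C)) o\<^sub>L (- (A1 o\<^sub>L op1.semigroup v)))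
      + (((- (A2 o\<^sub>L op2.semigroup v)) o\<^sub>L (B o\<^sub>L C)) o\<^sub>L op1.semigroup v)) (at v)"
    by (rule bounded_bilinear.has_vector_derivative[OF bilin 1 op1.semigroup_has_derivative])
  moreover have "((op2.semigroup v o\<^sub>L (B o\<^sub>L C)) o\<^sub>L (- (A1 o\<^sub>L op1.semigroup v)))
      + (((- (A2 o\<^sub>L op2.semigroup v)) o\<^sub>L (B o\<^sub>L C)) o\<^sub>L op1.semigroup v)
    = - ((A2 o\<^sub>L kernel v) + (kernel v o\<^sub>L A1))"
    unfolding kernel_def compose_assoc op1.semigroup_commute
    by (simp add: bounded_bilinear.minus_right[OF bilin] bounded_bilinear.minus_left[OF bilin] compose_assoc)
  ultimately show ?thesis
    unfolding kernel_def[abs_def] by simp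
qed

lemma continuous_kernel: "continuous_on UNIV kernel"
  using kernel_has_derivative has_vector_derivative_continuous
  by (intro continuous_at_imp_continuous_on) blast

lemma continuous_semigroup1: "continuous_on UNIV op1.semigroup"
  using op1.semigroup_has_derivative has_vector_derivative_continuous
  by (intro continuous_at_imp_continuous_on) blast

definition kernel_const where "kernel_const = M * norm (B o\<^sub>L C) * M"

lemma kernel_bound:
  assumes "0 \<le> v"
  shows "norm (kernel v) \<le> kernel_const * exp (- \<omega> * v)"
proof -
  have "norm (kernel v) \<le> norm (op2.semigroup v) * norm (B o\<^sub>L C) * norm (op1.semigroup v)"
    unfolding kernel_def
    by (rule order_trans[OF norm_blinfun_compose mult_right_mono[OF norm_blinfun_compose]]) simp
  also have "\<dots> \<le> (M * exp (- \<omega> * v)) * norm (B o\<^sub>L C) * M"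
  proof (intro mult_mono decay2[OF assms] order_refl)
    have "norm (op1.semigroup v) \<le> M * exp (- \<omega> * v)" by (rule decay1[OF assms])
    also have "\<dots> \<le> M" using M_nonneg \<omega>_pos assms by (simp add: mult_left_le)
    finally show "norm (op1.semigroup v) \<le> M" .
  qed (use M_nonneg in auto)
  finally show ?thesis by (simp add: kernel_const_def mult_ac)
qed

lemma integrable_exp: "integrable \<mu> (\<lambda>v. exp (- \<omega> * v))"
proof -
  have "(\<lambda>v. exp (- \<omega> * v)) absolutely_integrable_on {x..}"
    using has_integral_exp_minus_to_infinity[OF \<omega>_pos, of x]
    by (intro nonnegative_absolutely_integrable_1) auto
  then have "(\<lambda>v. exp (- \<omega> * v)) absolutely_integrable_on {x<..}"
    by (rule set_integrable_subset) auto
  then show ?thesis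
    by (simp add: integrable_restrict_space set_integrable_def)
qed

lemma continuous_measurable:
  fixes f :: "real \<Rightarrow> 'b::{banach, second_countable_topology}"
  assumes "continuous_on UNIV f"
  shows "f \<in> borel_measurable \<mu>"
  using borel_measurable_continuous_onI[OF assms]
  by (intro measurable_restrict_space1 measurable_completion) simp

text \<open>
  The integrands over the half-line below are dominated by multiples of $e^{-\omega v}$.
\<close>

lemma integrable_dominated:
  fixes f :: "real \<Rightarrow> 'b::{banach, second_countable_topology}"
  assumes "f \<in> borel_measurable \<mu>" and bound: "\<And>v. x < v \<Longrightarrow> norm (f v) \<le> c * exp (- \<omega> * v)"
  shows "integrable \<mu> f" and "norm (integral\<^sup>L \<mu> f) \<le> c * (LINT v|\<mu>. exp (- \<omega> * v))"
    and "(LINT v|\<mu>. norm (f v)) \<le> c * (LINT v|\<mu>. exp (- \<omega> * v))"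
proof -
  have dom: "integrable \<mu> (\<lambda>v. c * exp (- \<omega> * v))" using integrable_exp by simp
  have ae: "AE v in \<mu>. norm (f v) \<le> c * exp (- \<omega> * v)"
    using bound by (intro AE_I2) simp
  show int: "integrable \<mu> f"
    by (rule Bochner_Integration.integrable_bound[OF dom assms(1)]) (use ae in force)
  have "(LINT v|\<mu>. norm (f v)) \<le> (LINT v|\<mu>. c * exp (- \<omega> * v))"
    by (rule integral_mono_AE[OF integrable_norm[OF int] dom ae])
  then show "(LINT v|\<mu>. norm (f v)) \<le> c * (LINT v|\<mu>. exp (- \<omega> * v))" by simp
  then show "norm (integral\<^sup>L \<mu> f) \<le> c * (LINT v|\<mu>. exp (- \<omega> * v))"
    by (rule order_trans[OF integral_norm_bound])
qed

lemma continuous_kernel_apply: "continuous_on UNIV (\<lambda>v. blinfun_apply (kernel v) h)"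
  by (intro blinfun.continuous_on continuous_kernel continuous_on_const)

lemma kernel_apply_bound: "0 \<le> v \<Longrightarrow> norm (blinfun_apply (kernel v) h) \<le> kernel_const * norm h * exp (- \<omega> * v)"
  using order_trans[OF norm_blinfun mult_right_mono[OF kernel_bound, of v "norm h"]] by (simp add: mult_ac)

lemma integrable_kernel_apply: "integrable \<mu> (\<lambda>v. blinfun_apply (kernel v) h)"
  by (rule integrable_dominated(1)[OF continuous_measurable[OF continuous_kernel_apply] kernel_apply_bound])
     (use x_pos in simp)

lemma R_op_eq: "R_op A1 A2 B C x h = (LINT v|\<mu>. blinfun_apply (kernel v) h)"
  by (simp add: R_op_def kernel_def op1.semigroup_def op2.semigroup_def)

definition R :: "'h \<Rightarrow>\<^sub>L 'h"
  where "R = Blinfun (R_op A1 A2 B C x)"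

lemma R_apply: "blinfun_apply R h = (LINT v|\<mu>. blinfun_apply (kernel v) h)"
  and R_op_apply: "R_op A1 A2 B C x h = blinfun_apply R h"
proof -
  have "bounded_linear (R_op A1 A2 B C x)"
  proof (rule bounded_linear_intro)
    show "R_op A1 A2 B C x (g + h) = R_op A1 A2 B C x g + R_op A1 A2 B C x h" for g h
      by (simp add: R_op_eq blinfun.add_right integrable_kernel_apply)
    show "R_op A1 A2 B C x (c *\<^sub>R h) = c *\<^sub>R R_op A1 A2 B C x h" for c h
      by (simp add: R_op_eq blinfun.scaleR_right)
    show "norm (R_op A1 A2 B C x h) \<le> norm h * (kernel_const * (LINT v|\<mu>. exp (- \<omega> * v)))" for h
      unfolding R_op_eq
      using integrable_dominated(2)[OF continuous_measurable[OF continuous_kernel_apply] kernel_apply_bound] x_pos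
      by (simp add: mult_ac)
  qed
  then show "R_op A1 A2 B C x h = blinfun_apply R h"
    by (simp add: R_def bounded_linear_Blinfun_apply)
  then show "blinfun_apply R h = (LINT v|\<mu>. blinfun_apply (kernel v) h)"
    by (simp add: R_op_eq)
qed

lemma cbounded_kernel: "cbounded (kernel v)"
  unfolding kernel_def
  by (intro cbounded_compose op1.cbounded_semigroup op2.cbounded_semigroup cbounded_B cbounded_C)

lemma cbounded_R: "cbounded R"
  unfolding cbounded_def
proof (intro allI)
  fix c h
  have "blinfun_apply R (c *\<^sub>C h) = (LINT v|\<mu>. c *\<^sub>C blinfun_apply (kernel v) h)"
    by (simp add: R_apply cboundedD[OF cbounded_kernel])
  also have "\<dots> = c *\<^sub>C blinfun_apply R h"
    unfolding R_apply by (rule integral_bounded_linear[OF bounded_linear_scaleC integrable_kernel_apply])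
  finally show "blinfun_apply R (c *\<^sub>C h) = c *\<^sub>C blinfun_apply R h" .
qed

text \<open>
  The fundamental theorem of calculus on $(x,\infty)$, for an antiderivative that vanishes
  at infinity.
\<close>

lemma integral_half_line_derivative:
  fixes F f :: "real \<Rightarrow> real"
  assumes F: "\<And>v. (F has_vector_derivative f v) (at v)" and f: "continuous_on UNIV f"
    and bound: "\<And>v. x < v \<Longrightarrow> norm (f v) \<le> c * exp (- \<omega> * v)" and lim: "(F \<longlongrightarrow> 0) at_top"
  shows "(LINT v|\<mu>. f v) = - F x"
proof -
  have meas: "f \<in> borel_measurable borel" by (rule borel_measurable_continuous_onI[OF f])
  then have meas': "(\<lambda>v. indicator {x<..} v *\<^sub>R f v) \<in> borel_measurable lborel" by measurable
  have "integrable \<mu> f" by (rule integrable_dominated(1)[OF continuous_measurable[OF f] bound])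
  then have "integrable lebesgue (\<lambda>v. indicator {x<..} v *\<^sub>R f v)"
    by (simp add: integrable_restrict_space)
  then have int: "set_integrable lborel (einterval (ereal x) \<infinity>) f"
    unfolding set_integrable_def using integrable_completion[OF meas'] by simp
  have "(LBINT v=ereal x..\<infinity>. f v) = 0 - F x"
  proof (rule interval_integral_FTC_integrable[OF _ F _ int])
    show "isCont f v" for v using f by (simp add: continuous_on_eq_continuous_at)
    have "isCont F x" using F has_vector_derivative_continuous by blast
    then show "((F \<circ> real_of_ereal) \<longlongrightarrow> F x) (at_right (ereal x))"
      unfolding ereal_tendsto_simps by (simp add: isCont_def filterlim_at_split)
    show "((F \<circ> real_of_ereal) \<longlongrightarrow> 0) (at_left \<infinity>)"
      unfolding ereal_tendsto_simps by (rule lim)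
  qed simp
  moreover have "(LBINT v=ereal x..\<infinity>. f v) = (LINT v|\<mu>. f v)"
    by (simp add: interval_lebesgue_integral_def set_lebesgue_integral_def integral_restrict_space
        integral_completion[OF meas', simplified])
  ultimately show ?thesis by simp
qed

text \<open>
  The operator on the left is minus the integral of the derivative of the kernel.  Pairing with a
  fixed vector reduces the integration to real-valued functions.
\<close>

lemma Sylvester: "(A2 o\<^sub>L R) + (R o\<^sub>L A1) = kernel x"
proof (rule blinfun_eqI)
  fix h
  have "inner (blinfun_apply ((A2 o\<^sub>L R) + (R o\<^sub>L A1)) h) y = inner (blinfun_apply (kernel x) h) y" for y
  proof -
    define F where "F v = inner (blinfun_apply (kernel v) h) y" for v
    define f where "f v = inner (blinfun_apply (- ((A2 o\<^sub>L kernel v) + (kernel v o\<^sub>L A1))) h) y" for v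
    have bl: "bounded_linear (\<lambda>T :: 'h \<Rightarrow>\<^sub>L 'h. inner (blinfun_apply T h) y)"
      by (rule bounded_linear_compose[OF bounded_linear_inner_left blinfun.bounded_linear_left])
    have F: "(F has_vector_derivative f v) (at v)" for v
      unfolding F_def f_def by (rule bounded_linear.has_vector_derivative[OF bl kernel_has_derivative])
    have cont: "continuous_on UNIV f"
      unfolding f_def
      by (intro continuous_intros blinfun.continuous_on continuous_kernel
          bounded_bilinear.continuous_on[OF bounded_bilinear_blinfun_compose])
    have bound: "norm (f v) \<le> (norm y * (norm A2 * (kernel_const * norm h) + kernel_const * norm (blinfun_apply A1 h))) * exp (- \<omega> * v)"
      if "x < v" for v
    proof -
      have v: "0 \<le> v" using that x_pos by simp
      have "norm (f v) \<le> norm (blinfun_apply (- ((A2 o\<^sub>L kernel v) + (kernel v o\<^sub>L A1))) h) * norm y"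
        unfolding f_def by (simp add: Cauchy_Schwarz_ineq2)
      also have "norm (blinfun_apply (- ((A2 o\<^sub>L kernel v) + (kernel v o\<^sub>L A1))) h)
          \<le> norm (blinfun_apply A2 (blinfun_apply (kernel v) h)) + norm (blinfun_apply (kernel v) (blinfun_apply A1 h))"
        unfolding blinfun.minus_left norm_minus_cancel blinfun.add_left blinfun_apply_blinfun_compose
        by (rule norm_triangle_ineq)
      also have "\<dots> \<le> norm A2 * (kernel_const * norm h * exp (- \<omega> * v)) + kernel_const * norm (blinfun_apply A1 h) * exp (- \<omega> * v)"
        by (intro add_mono order_trans[OF norm_blinfun] mult_left_mono kernel_apply_bound v) simp
      finally show ?thesis by (simp add: algebra_simps mult_right_mono)
    qed
    have lim: "(F \<longlongrightarrow> 0) at_top"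
    proof (rule Lim_null_comparison)
      show "\<forall>\<^sub>F v in at_top. norm (F v) \<le> (kernel_const * norm h * norm y) * exp (- \<omega> * v)"
        using eventually_ge_at_top[of 0]
      proof eventually_elim
        case (elim v)
        have "norm (F v) \<le> norm (blinfun_apply (kernel v) h) * norm y"
          unfolding F_def by (simp add: Cauchy_Schwarz_ineq2)
        also have "\<dots> \<le> kernel_const * norm h * exp (- \<omega> * v) * norm y"
          by (intro mult_right_mono kernel_apply_bound elim) simp
        finally show ?case by (simp add: mult_ac)
      qed
      have "filterlim (\<lambda>v. - \<omega> * v) at_bot at_top"
        using \<omega>_pos by (intro filterlim_tendsto_neg_mult_at_bot[OF tendsto_const _ filterlim_ident]) simp
      then have "((\<lambda>v. exp (- \<omega> * v)) \<longlongrightarrow> 0) at_top"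
        by (rule filterlim_compose[OF exp_at_bot])
      then show "((\<lambda>v. (kernel_const * norm h * norm y) * exp (- \<omega> * v)) \<longlongrightarrow> 0) at_top"
        by (rule tendsto_mult_right_zero)
    qed
    have "(LINT v|\<mu>. f v) = - F x"
      by (rule integral_half_line_derivative[OF F cont bound lim])
    moreover have "(LINT v|\<mu>. f v) = - inner (blinfun_apply ((A2 o\<^sub>L R) + (R o\<^sub>L A1)) h) y"
    proof -
      have 1: "(LINT v|\<mu>. inner (blinfun_apply A2 (blinfun_apply (kernel v) h)) y) = inner (blinfun_apply A2 (blinfun_apply R h)) y"
        unfolding R_apply
        by (rule integral_bounded_linear[OF bounded_linear_compose[OF bounded_linear_inner_left blinfun.bounded_linear_right]
            integrable_kernel_apply])
      have 2: "(LINT v|\<mu>. inner (blinfun_apply (kernel v) (blinfun_apply A1 h)) y) = inner (blinfun_apply R (blinfun_apply A1 h)) y"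
        unfolding R_apply by (rule integral_bounded_linear[OF bounded_linear_inner_left integrable_kernel_apply])
      have "integrable \<mu> (\<lambda>v. inner (blinfun_apply A2 (blinfun_apply (kernel v) h)) y)"
        by (rule integrable_bounded_linear[OF bounded_linear_compose[OF bounded_linear_inner_left blinfun.bounded_linear_right]
            integrable_kernel_apply])
      moreover have "integrable \<mu> (\<lambda>v. inner (blinfun_apply (kernel v) (blinfun_apply A1 h)) y)"
        by (rule integrable_bounded_linear[OF bounded_linear_inner_left integrable_kernel_apply])
      ultimately show ?thesis
        by (simp add: f_def blinfun.minus_left blinfun.add_left blinfun.diff_left inner_add_left inner_diff_left 1 2)
    qed
    ultimately show ?thesis by (simp add: F_def)
  qed
  then show "blinfun_apply ((A2 o\<^sub>L R) + (R o\<^sub>L A1)) h = blinfun_apply (kernel x) h"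
    by (metis vector_eq_rdot)
qed

end

section \<open>A nuclear decomposition of $R_x$\<close>

text \<open>
  The code of a pair is at least each of its components, so an initial segment of codes lies in
  a square, over which the sum factorizes.
\<close>

lemma summable_prod_decode:
  fixes \<alpha> \<beta> :: "nat \<Rightarrow> real"
  assumes "summable \<alpha>" "summable \<beta>" and nonneg: "\<And>n. 0 \<le> \<alpha> n" "\<And>n. 0 \<le> \<beta> n"
  shows "summable (\<lambda>n. \<alpha> (fst (prod_decode n)) * \<beta> (snd (prod_decode n)))"
proof (rule bounded_imp_summable)
  show "0 \<le> \<alpha> (fst (prod_decode n)) * \<beta> (snd (prod_decode n))" for n
    using nonneg by simp
  fix N
  let ?g = "\<lambda>p. \<alpha> (fst p) * \<beta> (snd p)"
  have sub: "prod_decode ` {..N} \<subseteq> {..N} \<times> {..N}"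
  proof
    fix p assume "p \<in> prod_decode ` {..N}"
    then obtain n where n: "n \<le> N" "p = prod_decode n" by auto
    then have "prod_encode (fst p, snd p) \<le> N" by simp
    then show "p \<in> {..N} \<times> {..N}"
      using le_prod_encode_1[of "fst p" "snd p"] le_prod_encode_2[of "snd p" "fst p"]
      by (auto simp: mem_Times_iff)
  qed
  have "(\<Sum>n\<le>N. \<alpha> (fst (prod_decode n)) * \<beta> (snd (prod_decode n))) = sum ?g (prod_decode ` {..N})"
    by (subst sum.reindex) (auto intro: inj_on_subset[OF inj_prod_decode])
  also have "\<dots> \<le> sum ?g ({..N} \<times> {..N})"
    by (rule sum_mono2) (use sub nonneg in auto)
  also have "\<dots> = (\<Sum>m\<le>N. \<alpha> m) * (\<Sum>i\<le>N. \<beta> i)"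
    by (simp add: sum_product sum.cartesian_product case_prod_unfold)
  also have "\<dots> \<le> suminf \<alpha> * suminf \<beta>"
    using assms by (intro mult_mono sum_le_suminf suminf_nonneg sum_nonneg) auto
  finally show "(\<Sum>n\<le>N. \<alpha> (fst (prod_decode n)) * \<beta> (snd (prod_decode n))) \<le> suminf \<alpha> * suminf \<beta>" .
qed

lemma sums_prod_decode_row:
  fixes f :: "nat \<Rightarrow> 'b::banach"
  assumes "summable (\<lambda>i. norm (f i))" "f sums a"
  shows "(\<lambda>n. if fst (prod_decode n) = m then f (snd (prod_decode n)) else 0) sums a"
proof (rule has_sum_imp_sums)
  have "(f has_sum a) UNIV" by (rule norm_summable_imp_has_sum[OF assms])
  moreover have "bij_betw (\<lambda>n. snd (prod_decode n)) {n. fst (prod_decode n) = m} UNIV"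
  proof (rule bij_betwI[where g = "\<lambda>i. prod_encode (m, i)"])
    fix n assume "n \<in> {n. fst (prod_decode n) = m}"
    then have "(m, snd (prod_decode n)) = prod_decode n" by auto
    then show "prod_encode (m, snd (prod_decode n)) = n" by simp
  qed auto
  ultimately have "((\<lambda>n. f (snd (prod_decode n))) has_sum a) {n. fst (prod_decode n) = m}"
    by (subst has_sum_reindex_bij_betw)
  then show "((\<lambda>n. if fst (prod_decode n) = m then f (snd (prod_decode n)) else 0) has_sum a) UNIV"
    by (rule has_sum_cong_neutral[THEN iffD1, rotated -1]) auto
qed

lemma Suc_prod_encode_le: "Suc (prod_encode (m, i)) \<le> (m + 1)\<^sup>2 * (i + 1)\<^sup>2"
proof -
  have "2 * triangle (m + i) = (m + i) * Suc (m + i)"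
    unfolding triangle_def by (rule dvd_mult_div_cancel) simp
  then have "2 * Suc (prod_encode (m, i)) = (m + i) * Suc (m + i) + 2 * m + 2"
    by (simp add: prod_encode_def)
  also have "\<dots> \<le> 2 * ((m + 1) * (i + 1))\<^sup>2"
    by (simp add: power2_eq_square algebra_simps)
  finally have "Suc (prod_encode (m, i)) \<le> ((m + 1) * (i + 1))\<^sup>2"
    by (rule mult_left_le_imp_le) simp
  then show ?thesis by (simp only: power_mult_distrib)
qed

text \<open>
  Half of the exponential decay absorbs the polynomial factor, since
  $m + 1 \le (1 + 4/\omega)(1 + \omega m/4)$.
\<close>

lemma summable_square_times_exp:
  assumes "0 < (\<omega>::real)"
  shows "summable (\<lambda>m. (real m + 1)\<^sup>2 * exp (- \<omega> * real m))"
proof (rule summable_comparison_test'[of "\<lambda>m. (1 + 4 / \<omega>)\<^sup>2 * exp (- \<omega> / 2) ^ m" 0])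
  show "summable (\<lambda>m. (1 + 4 / \<omega>)\<^sup>2 * exp (- \<omega> / 2) ^ m)"
    using assms by (intro summable_mult summable_geometric) simp
  fix m :: nat
  have "real m + 1 \<le> (1 + 4 / \<omega>) * (1 + \<omega> / 4 * real m)"
    using assms by (simp add: field_simps)
  also have "\<dots> \<le> (1 + 4 / \<omega>) * exp (\<omega> / 4 * real m)"
    using assms by (intro mult_left_mono exp_ge_add_one_self) auto
  finally have "(real m + 1)\<^sup>2 \<le> ((1 + 4 / \<omega>) * exp (\<omega> / 4 * real m))\<^sup>2"
    by (rule power_mono) simp
  also have "\<dots> = (1 + 4 / \<omega>)\<^sup>2 * exp (\<omega> / 2 * real m)"
    by (simp add: power_mult_distrib exp_double[symmetric])
  finally have "(real m + 1)\<^sup>2 * exp (- \<omega> * real m) \<le> (1 + 4 / \<omega>)\<^sup>2 * exp (\<omega> / 2 * real m) * exp (- \<omega> * real m)"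
    by (rule mult_right_mono) simp
  also have "\<dots> = (1 + 4 / \<omega>)\<^sup>2 * exp (- \<omega> / 2) ^ m"
    by (simp add: exp_add[symmetric] exp_of_nat_mult[symmetric] mult.assoc)
  finally show "norm ((real m + 1)\<^sup>2 * exp (- \<omega> * real m)) \<le> (1 + 4 / \<omega>)\<^sup>2 * exp (- \<omega> / 2) ^ m" by simp
qed

lemma summable_square_times_exp_series:
  assumes "0 \<le> (\<kappa>::real)"
  shows "summable (\<lambda>i. (real i + 1)\<^sup>2 * (\<kappa> ^ i / fact i))"
proof (rule summable_comparison_test'[of "\<lambda>i. inverse (fact i) * (4 * \<kappa>) ^ i" 0])
  show "summable (\<lambda>i. inverse (fact i) * (4 * \<kappa>) ^ i)" by (rule summable_exp)
  fix i :: nat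
  have "real i + 1 \<le> 2 ^ i"
    using of_nat_mono[OF Suc_leI[OF less_exp[of i]], where ?'a = real] by simp
  then have "(real i + 1)\<^sup>2 \<le> (2 ^ i)\<^sup>2" by (rule power_mono) simp
  also have "\<dots> = 4 ^ i" by (simp add: power_mult[symmetric] mult.commute[of i]) (simp add: power_mult)
  finally have "(real i + 1)\<^sup>2 * (\<kappa> ^ i / fact i) \<le> 4 ^ i * (\<kappa> ^ i / fact i)"
    using assms by (intro mult_right_mono) auto
  then show "norm ((real i + 1)\<^sup>2 * (\<kappa> ^ i / fact i)) \<le> inverse (fact i) * (4 * \<kappa>) ^ i"
    using assms by (simp add: power_mult_distrib divide_inverse mult_ac)
qed

context linear_system
begin

text \<open>
  The left end point of the unit interval with number \<open>m\<close>, where \<open>n\<close> is the code of the pair \<open>(m, i)\<close>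
  and \<open>i\<close> is the order of the Taylor term.
\<close>

definition node :: "nat \<Rightarrow> real"
  where "node n = x + real (fst (prod_decode n))"

text \<open>
  The power of $v$ in the Taylor term of order \<open>i\<close> about the left end point, restricted to the interval.
\<close>

definition weight :: "nat \<Rightarrow> real \<Rightarrow> real"
  where "weight n v = indicator {node n<..node n + 1} v * (v - node n) ^ snd (prod_decode n)"

text \<open>
  The Taylor coefficient of $e^{-vA_2}B$ of order \<open>i\<close> at the left end point of the interval.
\<close>

definition nuclear_vector :: "nat \<Rightarrow> 'h"
  where "nuclear_vector n = ((- 1) ^ snd (prod_decode n) / fact (snd (prod_decode n))) *\<^sub>R
    blinfun_apply (op_pow A2 (snd (prod_decode n))) (blinfun_apply (op2.semigroup (node n)) (blinfun_apply B 1))"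

text \<open>
  Integrating the weighted row vector $Ce^{-vA_1}$ over the interval gives the functional that
  belongs to the Taylor coefficient.
\<close>

definition nuclear_functional :: "nat \<Rightarrow> 'h \<Rightarrow>\<^sub>L complex"
  where "nuclear_functional n =
    Blinfun (\<lambda>h. LINT v|\<mu>. weight n v *\<^sub>R blinfun_apply C (blinfun_apply (op1.semigroup v) h))"

definition functional_const where "functional_const = norm C * M * (LINT v|\<mu>. exp (- \<omega> * v))"

lemma weight_bound: "norm (weight n v) \<le> 1"
  by (auto simp: weight_def indicator_def power_le_one abs_mult power_abs)

lemma functional_integrand:
  shows "(\<lambda>v. weight n v *\<^sub>R blinfun_apply C (blinfun_apply (op1.semigroup v) h)) \<in> borel_measurable \<mu>"
    and "x < v \<Longrightarrow> norm (weight n v *\<^sub>R blinfun_apply C (blinfun_apply (op1.semigroup v) h))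
      \<le> (norm C * M * norm h) * exp (- \<omega> * v)"
proof -
  have "continuous_on UNIV (\<lambda>v. blinfun_apply C (blinfun_apply (op1.semigroup v) h))"
    by (intro blinfun.continuous_on continuous_on_const continuous_semigroup1)
  then have "(\<lambda>v. blinfun_apply C (blinfun_apply (op1.semigroup v) h)) \<in> borel_measurable borel"
    by (rule borel_measurable_continuous_onI)
  then have "(\<lambda>v. weight n v *\<^sub>R blinfun_apply C (blinfun_apply (op1.semigroup v) h)) \<in> borel_measurable borel"
    unfolding weight_def by measurable
  then show "(\<lambda>v. weight n v *\<^sub>R blinfun_apply C (blinfun_apply (op1.semigroup v) h)) \<in> borel_measurable \<mu>"
    by (intro measurable_restrict_space1 measurable_completion) simp
  assume "x < v"
  then have v: "0 \<le> v" using x_pos by simp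
  have "norm (weight n v *\<^sub>R blinfun_apply C (blinfun_apply (op1.semigroup v) h))
      \<le> 1 * norm (blinfun_apply C (blinfun_apply (op1.semigroup v) h))"
    unfolding norm_scaleR using weight_bound[of n v] by (intro mult_right_mono) auto
  also have "\<dots> \<le> norm C * ((M * exp (- \<omega> * v)) * norm h)"
    using order_trans[OF norm_blinfun mult_left_mono[OF order_trans[OF norm_blinfun mult_right_mono[OF decay1[OF v]]]]]
    by simp
  finally show "norm (weight n v *\<^sub>R blinfun_apply C (blinfun_apply (op1.semigroup v) h))
      \<le> (norm C * M * norm h) * exp (- \<omega> * v)" by (simp add: mult_ac)
qed

lemmas functional_integrable = integrable_dominated(1)[OF functional_integrand]

lemma nuclear_functional:
  shows "blinfun_apply (nuclear_functional n) h
      = (LINT v|\<mu>. weight n v *\<^sub>R blinfun_apply C (blinfun_apply (op1.semigroup v) h))"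
    and "cbounded (nuclear_functional n)" and "norm (nuclear_functional n) \<le> functional_const"
proof -
  let ?w = "\<lambda>h. LINT v|\<mu>. weight n v *\<^sub>R blinfun_apply C (blinfun_apply (op1.semigroup v) h)"
  have bound: "norm (?w h) \<le> functional_const * norm h" for h
    using integrable_dominated(2)[OF functional_integrand, of n h] by (simp add: functional_const_def mult_ac)
  have "bounded_linear ?w"
  proof (rule bounded_linear_intro)
    show "?w (g + h) = ?w g + ?w h" for g h
      by (simp add: blinfun.add_right scaleR_add_right functional_integrable)
    show "?w (c *\<^sub>R h) = c *\<^sub>R ?w h" for c h
    proof -
      have "?w (c *\<^sub>R h) = (LINT v|\<mu>. c *\<^sub>R (weight n v *\<^sub>R blinfun_apply C (blinfun_apply (op1.semigroup v) h)))"
        by (simp only: blinfun.scaleR_right scaleR_left_commute)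
      then show ?thesis by (simp only: integral_scaleR_right)
    qed
    show "norm (?w h) \<le> norm h * functional_const" for h using bound[of h] by (simp add: mult.commute)
  qed
  then show eq: "blinfun_apply (nuclear_functional n) h = ?w h" for h
    by (simp add: nuclear_functional_def bounded_linear_Blinfun_apply)
  show "norm (nuclear_functional n) \<le> functional_const"
    using bound M_nonneg by (intro norm_blinfun_bound) (auto simp: eq functional_const_def intro!: mult_nonneg_nonneg integral_nonneg)
  show "cbounded (nuclear_functional n)"
    unfolding cbounded_def
  proof (intro allI)
    fix c h
    have "blinfun_apply (nuclear_functional n) (c *\<^sub>C h)
      = (LINT v|\<mu>. c *\<^sub>C (weight n v *\<^sub>R blinfun_apply C (blinfun_apply (op1.semigroup v) h)))"
      by (simp add: eq cboundedD[OF op1.cbounded_semigroup] cboundedD[OF cbounded_C] scaleC.scaleR_right)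
    also have "\<dots> = c *\<^sub>C blinfun_apply (nuclear_functional n) h"
      unfolding eq by (rule integral_bounded_linear[OF bounded_linear_scaleC functional_integrable])
    finally show "blinfun_apply (nuclear_functional n) (c *\<^sub>C h) = c *\<^sub>C blinfun_apply (nuclear_functional n) h" .
  qed
qed

text \<open>
  The weight \<open>n + 1\<close> is the one that \<open>sum_minors_le_prod\<close> requires.  The code of \<open>(m, i)\<close> grows only
  polynomially, while the vectors decay exponentially in \<open>m\<close> and factorially in \<open>i\<close>.
\<close>

lemma summable_nuclear_vector: "summable (\<lambda>n. (real n + 1) * norm (nuclear_vector n))"
proof (rule summable_comparison_test'[of "\<lambda>n. M * norm (blinfun_apply B 1) *
    (((real (fst (prod_decode n)) + 1)\<^sup>2 * exp (- \<omega> * real (fst (prod_decode n)))) *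
     ((real (snd (prod_decode n)) + 1)\<^sup>2 * (norm A2 ^ snd (prod_decode n) / fact (snd (prod_decode n)))))" 0])
  show "summable (\<lambda>n. M * norm (blinfun_apply B 1) *
    (((real (fst (prod_decode n)) + 1)\<^sup>2 * exp (- \<omega> * real (fst (prod_decode n)))) *
     ((real (snd (prod_decode n)) + 1)\<^sup>2 * (norm A2 ^ snd (prod_decode n) / fact (snd (prod_decode n))))))"
    by (intro summable_mult summable_prod_decode[of "\<lambda>m. (real m + 1)\<^sup>2 * exp (- \<omega> * real m)"
          "\<lambda>i. (real i + 1)\<^sup>2 * (norm A2 ^ i / fact i)"]
        summable_square_times_exp[OF \<omega>_pos] summable_square_times_exp_series norm_ge_zero) auto
  fix n
  obtain m i where mi: "prod_decode n = (m, i)" by fastforce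
  then have n: "n = prod_encode (m, i)" by (metis prod_decode_inverse)
  have node: "0 \<le> node n" "real m \<le> node n" using x_pos by (simp_all add: node_def mi)
  have 1: "norm (nuclear_vector n) \<le> norm A2 ^ i / fact i * (M * exp (- \<omega> * real m) * norm (blinfun_apply B 1))"
  proof -
    have "norm (nuclear_vector n) = norm (blinfun_apply (op_pow A2 i) (blinfun_apply (op2.semigroup (node n)) (blinfun_apply B 1))) / fact i"
      by (simp add: nuclear_vector_def mi abs_divide power_abs)
    also have "\<dots> \<le> (norm A2 ^ i * ((M * exp (- \<omega> * real m)) * norm (blinfun_apply B 1))) / fact i"
    proof (intro divide_right_mono)
      have "norm (op2.semigroup (node n)) \<le> M * exp (- \<omega> * node n)" by (rule decay2[OF node(1)])
      also have "\<dots> \<le> M * exp (- \<omega> * real m)"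
        using node(2) M_nonneg \<omega>_pos by (intro mult_left_mono) auto
      finally have "norm (blinfun_apply (op2.semigroup (node n)) (blinfun_apply B 1)) \<le> (M * exp (- \<omega> * real m)) * norm (blinfun_apply B 1)"
        by (rule order_trans[OF norm_blinfun mult_right_mono]) simp
      then show "norm (blinfun_apply (op_pow A2 i) (blinfun_apply (op2.semigroup (node n)) (blinfun_apply B 1)))
          \<le> norm A2 ^ i * ((M * exp (- \<omega> * real m)) * norm (blinfun_apply B 1))"
        by (rule order_trans[OF norm_blinfun mult_mono[OF norm_op_pow_le]]) auto
    qed simp
    finally show ?thesis by simp
  qed
  have 2: "real n + 1 \<le> (real m + 1)\<^sup>2 * (real i + 1)\<^sup>2"
  proof -
    have "real (Suc n) \<le> real ((m + 1)\<^sup>2 * (i + 1)\<^sup>2)"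
      unfolding n by (rule of_nat_mono[OF Suc_prod_encode_le])
    then show ?thesis by (simp add: add.commute)
  qed
  have "(real n + 1) * norm (nuclear_vector n)
      \<le> ((real m + 1)\<^sup>2 * (real i + 1)\<^sup>2) * (norm A2 ^ i / fact i * (M * exp (- \<omega> * real m) * norm (blinfun_apply B 1)))"
    by (rule mult_mono[OF 2 1]) auto
  then show "norm ((real n + 1) * norm (nuclear_vector n)) \<le> M * norm (blinfun_apply B 1) *
    (((real (fst (prod_decode n)) + 1)\<^sup>2 * exp (- \<omega> * real (fst (prod_decode n)))) *
     ((real (snd (prod_decode n)) + 1)\<^sup>2 * (norm A2 ^ snd (prod_decode n) / fact (snd (prod_decode n)))))"
    by (simp add: mi mult_ac)
qed

text \<open>
  For fixed \<open>v\<close> only the interval that contains \<open>v\<close> contributes, and there the sum is the Taylor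
  series of the kernel; summation and integration are interchanged by dominated convergence.
\<close>

lemma nuclear_sums: "(\<lambda>n. blinfun_apply (nuclear_functional n) h *\<^sub>C nuclear_vector n) sums blinfun_apply R h"
proof -
  let ?f = "\<lambda>n v. (weight n v *\<^sub>R blinfun_apply C (blinfun_apply (op1.semigroup v) h)) *\<^sub>C nuclear_vector n"
  let ?b = "blinfun_apply B 1"
  have f_bound: "norm (?f n v) \<le> (norm C * M * norm h * norm (nuclear_vector n)) * exp (- \<omega> * v)" if "x < v" for n v
    using mult_right_mono[OF functional_integrand(2)[OF that, of n h] norm_ge_zero[of "nuclear_vector n"]]
    by (simp add: norm_scaleC mult_ac)
  have f_meas: "?f n \<in> borel_measurable \<mu>" for n
    using borel_measurable_integrable[OF integrable_bounded_linear[OF scaleC.bounded_linear_left functional_integrable]] .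
  have pointwise: "(\<lambda>n. ?f n v) sums blinfun_apply (kernel v) h \<and> summable (\<lambda>n. norm (?f n v))" if v: "x < v" for v
  proof -
    \<comment> \<open>The intervals are open on the left, so the number of the one containing \<open>v\<close> is a ceiling.\<close>
  define m where "m = nat (\<lceil>v - x\<rceil> - 1)"
    define y where "y = x + real m"
    have m: "y < v" "v \<le> y + 1"
    proof -
      have "0 < \<lceil>v - x\<rceil>" using v by simp
      then have "real m = of_int \<lceil>v - x\<rceil> - 1" by (simp add: m_def)
      then show "y < v" "v \<le> y + 1" unfolding y_def by linarith+
    qed
    let ?c = "blinfun_apply C (blinfun_apply (op1.semigroup v) h)"
    let ?t = "\<lambda>i. ?c *\<^sub>C blinfun_apply (((- (v - y)) ^ i / fact i) *\<^sub>R op_pow A2 i) (blinfun_apply (op2.semigroup y) ?b)"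
    have row: "?f n v = (if fst (prod_decode n) = m then ?t (snd (prod_decode n)) else 0)" for n
    proof (cases "fst (prod_decode n) = m")
      case True
      then have "node n = y" by (simp add: node_def y_def)
      have "(- (v - y)) ^ i = (v - y) ^ i * (- 1) ^ i" for i
        using power_mult_distrib[of "v - y" "- 1" i] by simp
      then show ?thesis
        using True m \<open>node n = y\<close>
        by (simp add: weight_def nuclear_vector_def blinfun.scaleR_left scaleC.scaleR_left scaleC.scaleR_right)
    next
      case False
      then have "v \<notin> {node n<..node n + 1}" using m by (auto simp: node_def y_def)
      then show ?thesis using False by (simp add: weight_def scaleC.zero_left)
    qed
    have "(\<lambda>i. ?t i) sums (?c *\<^sub>C blinfun_apply (op2.semigroup (v - y)) (blinfun_apply (op2.semigroup y) ?b))"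
      by (intro bounded_linear.sums[OF bounded_linear_scaleC]
          bounded_linear.sums[OF blinfun.bounded_linear_left] op2.semigroup_sums)
    moreover have "?c *\<^sub>C blinfun_apply (op2.semigroup (v - y)) (blinfun_apply (op2.semigroup y) ?b) = blinfun_apply (kernel v) h"
    proof -
      have "blinfun_apply (op2.semigroup v) ?b = blinfun_apply (op2.semigroup (v - y)) (blinfun_apply (op2.semigroup y) ?b)"
        using op2.semigroup_add[of "v - y" y] by simp
      then show ?thesis by (simp only: kernel_apply)
    qed
    ultimately have t_sums: "?t sums blinfun_apply (kernel v) h" by simp
    have t_summable: "summable (\<lambda>i. norm (?t i))"
    proof (rule summable_comparison_test'[of "\<lambda>i. cmod ?c * norm (blinfun_apply (op2.semigroup y) ?b) *
        (inverse (fact i) * (\<bar>v - y\<bar> * norm A2) ^ i)" 0])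
      show "summable (\<lambda>i. cmod ?c * norm (blinfun_apply (op2.semigroup y) ?b) * (inverse (fact i) * (\<bar>v - y\<bar> * norm A2) ^ i))"
        by (intro summable_mult summable_exp)
      fix i
      have "norm (?t i) = cmod ?c * (\<bar>v - y\<bar> ^ i / fact i * norm (blinfun_apply (op_pow A2 i) (blinfun_apply (op2.semigroup y) ?b)))"
        by (simp add: norm_scaleC blinfun.scaleR_left power_abs abs_minus_commute)
      also have "\<dots> \<le> cmod ?c * (\<bar>v - y\<bar> ^ i / fact i * (norm A2 ^ i * norm (blinfun_apply (op2.semigroup y) ?b)))"
        by (intro mult_left_mono order_trans[OF norm_blinfun] mult_right_mono norm_op_pow_le) auto
      finally show "norm (norm (?t i)) \<le> cmod ?c * norm (blinfun_apply (op2.semigroup y) ?b) *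
          (inverse (fact i) * (\<bar>v - y\<bar> * norm A2) ^ i)"
        by (simp add: power_mult_distrib divide_inverse mult_ac)
    qed
    have "(\<lambda>n. ?f n v) sums blinfun_apply (kernel v) h"
      unfolding row by (rule sums_prod_decode_row[OF t_summable t_sums])
    moreover have "summable (\<lambda>n. norm (?f n v))"
    proof -
      have "(\<lambda>n. if fst (prod_decode n) = m then norm (?t (snd (prod_decode n))) else 0) sums (\<Sum>i. norm (?t i))"
        using t_summable by (intro sums_prod_decode_row) (auto intro: summable_sums)
      moreover have "norm (?f n v) = (if fst (prod_decode n) = m then norm (?t (snd (prod_decode n))) else 0)" for n
        unfolding row by simp
      ultimately show ?thesis by (simp only: sums_summable)
    qed
    ultimately show ?thesis ..
  qed
  have f_int: "integrable \<mu> (?f n)" for n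
    by (rule integrable_dominated(1)[OF f_meas f_bound])
  have "(\<lambda>n. integral\<^sup>L \<mu> (?f n)) sums (LINT v|\<mu>. (\<Sum>n. ?f n v))"
  proof (rule sums_integral[OF f_int])
    show "AE v in \<mu>. summable (\<lambda>n. norm (?f n v))"
      using pointwise by (intro AE_I2) simp
    have le: "(LINT v|\<mu>. norm (?f n v)) \<le> functional_const * norm h * ((real n + 1) * norm (nuclear_vector n))" for n
    proof -
      have "(LINT v|\<mu>. norm (?f n v)) \<le> (norm C * M * norm h * norm (nuclear_vector n)) * (LINT v|\<mu>. exp (- \<omega> * v))"
        by (rule integrable_dominated(3)[OF f_meas f_bound])
      also have "\<dots> = functional_const * norm h * (1 * norm (nuclear_vector n))" by (simp add: functional_const_def)
      also have "\<dots> \<le> functional_const * norm h * ((real n + 1) * norm (nuclear_vector n))"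
        using M_nonneg by (intro mult_left_mono mult_right_mono)
          (auto simp: functional_const_def intro!: mult_nonneg_nonneg integral_nonneg)
      finally show ?thesis .
    qed
    show "summable (\<lambda>n. LINT v|\<mu>. norm (?f n v))"
      by (rule summable_comparison_test'[OF summable_mult[OF summable_nuclear_vector], of 0])
         (use le in \<open>simp add: integral_nonneg\<close>)
  qed
  moreover have "(LINT v|\<mu>. (\<Sum>n. ?f n v)) = blinfun_apply R h"
    unfolding R_apply using pointwise by (intro Bochner_Integration.integral_cong refl) (simp add: sums_iff)
  moreover have "integral\<^sup>L \<mu> (?f n) = blinfun_apply (nuclear_functional n) h *\<^sub>C nuclear_vector n" for n
    unfolding nuclear_functional(1)
    by (rule integral_bounded_linear[OF scaleC.bounded_linear_left functional_integrable])
  ultimately show ?thesis by simp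
qed

end

section \<open>Orthonormal systems\<close>

lemma cinner_scaleR_left: "cinner (r *\<^sub>R a) b = complex_of_real r * cinner a b"
  by (simp add: scaleC_of_real[symmetric] cinner_scaleC_left)

lemma norm_cinner_le: "cmod (cinner a b) \<le> norm a * norm b"
proof (cases "cinner a b = 0")
  case False
  define c where "c = cnj (cinner a b) / complex_of_real (cmod (cinner a b))"
  have "cmod c = 1" using False by (simp add: c_def norm_divide)
  have "cinner (c *\<^sub>C a) b = complex_of_real (cmod (cinner a b))"
    using False complex_norm_square[of "cinner a b"]
    by (simp add: cinner_scaleC_left c_def power2_eq_square mult.commute divide_eq_eq)
  then have "cmod (cinner a b) = inner (c *\<^sub>C a) b"
    using Re_cinner[of "c *\<^sub>C a" b] by simp
  also have "\<dots> \<le> norm (c *\<^sub>C a) * norm b" by (rule norm_cauchy_schwarz)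
  finally show ?thesis by (simp add: norm_scaleC \<open>cmod c = 1\<close>)
qed simp

lemma bounded_linear_cinner_left: "bounded_linear (\<lambda>a. cinner a b)"
  by (rule bounded_linear_intro[of _ "norm b"])
     (simp_all add: cinner_add_left cinner_scaleR_left scaleR_conv_of_real norm_cinner_le)

lemma cinner_sum_scaleC_left: "cinner (\<Sum>e\<in>F. c e *\<^sub>C a e) b = (\<Sum>e\<in>F. c e * cinner (a e) b)"
  by (simp add: linear_sum[OF bounded_linear.linear[OF bounded_linear_cinner_left]] cinner_scaleC_left)

lemma norm_orthonormal_sum:
  assumes "finite F" "orthonormal F"
  shows "(norm (\<Sum>e\<in>F. c e *\<^sub>C e))\<^sup>2 = (\<Sum>e\<in>F. (cmod (c e))\<^sup>2)"
proof -
  let ?p = "\<Sum>e\<in>F. c e *\<^sub>C e"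
  have coeff: "cinner ?p e = c e" if "e \<in> F" for e
  proof -
    have "cinner ?p e = (\<Sum>f\<in>F. if f = e then c f else 0)"
      unfolding cinner_sum_scaleC_left
      using assms(2) that by (intro sum.cong) (auto simp: orthonormal_def)
    with assms(1) that show ?thesis by simp
  qed
  have "complex_of_real ((norm ?p)\<^sup>2) = cinner ?p ?p" by (simp add: cinner_self)
  also have "\<dots> = (\<Sum>e\<in>F. c e * cinner e ?p)" by (rule cinner_sum_scaleC_left)
  also have "\<dots> = (\<Sum>e\<in>F. c e * cnj (c e))"
    by (intro sum.cong refl) (simp add: cinner_commute[of _ ?p] coeff)
  also have "\<dots> = complex_of_real (\<Sum>e\<in>F. (cmod (c e))\<^sup>2)"
    by (simp only: of_real_sum complex_norm_square)
  finally show ?thesis by (simp only: of_real_eq_iff)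
qed

text \<open>
  Test the functional on the vector whose coefficients are the conjugates of its own values.
\<close>

lemma Bessel_functional:
  assumes "finite F" "orthonormal F" and w: "cbounded (w :: 'h::complex_hilbert \<Rightarrow>\<^sub>L complex)"
  shows "(\<Sum>e\<in>F. (cmod (blinfun_apply w e))\<^sup>2) \<le> (norm w)\<^sup>2"
proof -
  let ?S = "\<Sum>e\<in>F. (cmod (blinfun_apply w e))\<^sup>2"
  let ?p = "\<Sum>e\<in>F. cnj (blinfun_apply w e) *\<^sub>C e"
  have S0: "0 \<le> ?S" by (rule sum_nonneg) simp
  have "blinfun_apply w ?p = (\<Sum>e\<in>F. blinfun_apply w e * cnj (blinfun_apply w e))"
    by (simp add: blinfun.sum_right cboundedD[OF w] scaleC_complex_def mult.commute)
  also have "\<dots> = complex_of_real ?S"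
    by (simp only: of_real_sum complex_norm_square)
  finally have "blinfun_apply w ?p = complex_of_real ?S" .
  then have "?S = cmod (blinfun_apply w ?p)" using S0 by (simp only: norm_of_real abs_of_nonneg)
  also have "\<dots> \<le> norm w * norm ?p" by (rule norm_blinfun)
  also have "norm ?p = sqrt ?S"
    using norm_orthonormal_sum[OF assms(1,2), of "\<lambda>e. cnj (blinfun_apply w e)"]
    by (simp add: real_sqrt_unique)
  finally have le: "sqrt ?S * sqrt ?S \<le> norm w * sqrt ?S" using S0 by simp
  have "sqrt ?S \<le> norm w"
  proof (cases "?S = 0")
    case False
    with S0 have "0 < sqrt ?S" by simp
    with le show ?thesis by (simp only: mult_le_cancel_right_pos)
  qed simp
  then show ?thesis by (rule sqrt_le_D)
qed

text \<open>
  Apply the inequality for functionals to $b \mapsto \langle b, a\rangle$.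
\<close>

lemma Bessel:
  assumes "finite F" "orthonormal (F :: 'h::complex_hilbert set)"
  shows "(\<Sum>e\<in>F. (cmod (cinner a e))\<^sup>2) \<le> (norm a)\<^sup>2"
proof -
  let ?w = "\<lambda>b. cnj (cinner a b)"
  have eq: "?w b = cinner b a" for b using cinner_commute[of a b] by simp
  then have bl: "bounded_linear ?w" using bounded_linear_cinner_left by simp
  have "cbounded (Blinfun ?w)"
    by (simp add: cbounded_def bounded_linear_Blinfun_apply[OF bl] scaleC_complex_def)
       (simp add: eq cinner_scaleC_left)
  then have "(\<Sum>e\<in>F. (cmod (blinfun_apply (Blinfun ?w) e))\<^sup>2) \<le> (norm (Blinfun ?w))\<^sup>2"
    by (rule Bessel_functional[OF assms])
  also have "(norm (Blinfun ?w))\<^sup>2 \<le> (norm a)\<^sup>2"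
    by (intro power_mono norm_blinfun_bound norm_ge_zero)
       (simp add: bounded_linear_Blinfun_apply[OF bl] norm_cinner_le)
  finally show ?thesis by (simp add: bounded_linear_Blinfun_apply[OF bl])
qed

text \<open>
  Distinct orthonormal vectors have distance $\sqrt 2$, so balls of radius one half about them
  contain distinct points of a countable dense set.
\<close>

lemma countable_orthonormal:
  assumes "orthonormal (E :: 'h::{complex_hilbert, second_countable_topology} set)"
  shows "countable E"
proof -
  obtain D :: "'h set" where D: "countable D" "\<And>X. open X \<Longrightarrow> X \<noteq> {} \<Longrightarrow> \<exists>d\<in>D. d \<in> X"
    using countable_dense_setE by blast
  have "\<exists>d. d \<in> D \<and> dist e d < 1 / 2" for e
    using D(2)[of "ball e (1 / 2)"] by auto
  then obtain d where d: "\<And>e. d e \<in> D" "\<And>e. dist e (d e) < 1 / 2" by metis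
  have "inj_on d E"
  proof (rule inj_onI, rule ccontr)
    fix e f assume e: "e \<in> E" "f \<in> E" "d e = d f" "e \<noteq> f"
    have on: "cinner a b = (if a = b then 1 else 0)" if "a \<in> {e, f}" "b \<in> {e, f}" for a b
      using assms e that unfolding orthonormal_def by blast
    have "inner e e = 1" "inner f f = 1" "inner e f = 0"
      using on[of e e] on[of f f] on[of e f] e(4) by (simp_all flip: Re_cinner)
    then have "(norm (e - f))\<^sup>2 = 2"
      by (simp add: power2_norm_eq_inner inner_diff_left inner_diff_right inner_commute)
    moreover have "norm (e - f) < 1"
      using d(2)[of e] d(2)[of f] e(3) dist_triangle_half_l[of e "d e" 1 f] by (simp add: dist_norm)
    then have "(norm (e - f))\<^sup>2 < 1" by (simp add: power_less_one_iff)
    ultimately show False by simp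
  qed
  moreover have "d ` E \<subseteq> D" using d(1) by auto
  ultimately show ?thesis using D(1) countable_image_inj_on countable_subset by blast
qed

section \<open>Fredholm determinants as limits of compressed determinants\<close>

definition minor :: "('h::complex_hilbert \<Rightarrow> 'h) \<Rightarrow> 'h set \<Rightarrow> complex"
  where "minor T S = det_on S (\<lambda>e f. cinner (T f) e)"

definition compressed_det :: "'h::complex_hilbert set \<Rightarrow> ('h \<Rightarrow> 'h) \<Rightarrow> complex"
  where "compressed_det F T = (\<Sum>S\<in>Pow F. minor T S)"

text \<open>
  An exhaustion of the basis by a sequence of finite sets; a sequence is needed because dominated
  convergence fails for nets.
\<close>

definition onb_segment :: "nat \<Rightarrow> 'h::complex_hilbert set"
  where "onb_segment i = {e \<in> some_onb. to_nat_on some_onb e < i}"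

lemma onb_segment:
  fixes i :: nat
  shows "finite (onb_segment i :: 'h::{complex_hilbert, second_countable_topology} set)"
    and "onb_segment i \<subseteq> (some_onb :: 'h set)"
    and "orthonormal (onb_segment i :: 'h set)"
proof -
  have on: "orthonormal (some_onb :: 'h set)"
    using orthonormal_basis_some_onb unfolding orthonormal_basis_def by blast
  show "onb_segment i \<subseteq> (some_onb :: 'h set)" by (auto simp: onb_segment_def)
  then show "orthonormal (onb_segment i :: 'h set)"
    using on unfolding orthonormal_def by blast
  have "inj_on (to_nat_on (some_onb :: 'h set)) (onb_segment i)"
    using inj_on_to_nat_on[OF countable_orthonormal[OF on]]
    by (rule inj_on_subset) (auto simp: onb_segment_def)
  then show "finite (onb_segment i :: 'h set)"
    by (rule inj_on_finite[of _ _ "{..<i}"]) (auto simp: onb_segment_def)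
qed

text \<open>
  The bound makes the minors absolutely summable over all finite subsets of the basis.  Grouped
  by cardinality their sum is the Fredholm determinant; over the subsets of a finite section it is the
  determinant of the compression to that section.
\<close>

lemma det_I_plus_limit:
  fixes T :: "'h::{complex_hilbert, second_countable_topology} \<Rightarrow> 'h"
  assumes bound: "\<And>F. finite F \<Longrightarrow> orthonormal F \<Longrightarrow> (\<Sum>S\<in>Pow F. cmod (minor T S)) \<le> \<beta>"
  shows "(\<lambda>i. compressed_det (onb_segment i) T) \<longlonglongrightarrow> det_I_plus T"
    and "cmod (compressed_det (onb_segment i) T) \<le> \<beta>"
proof -
  let ?E = "some_onb :: 'h set"
  define U where "U = {S. S \<subseteq> ?E \<and> finite S}"
  have on: "orthonormal ?E"
    using orthonormal_basis_some_onb unfolding orthonormal_basis_def by blast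
  have onF: "orthonormal F" if "F \<subseteq> ?E" for F using on that unfolding orthonormal_def by blast
  have "(\<lambda>S. cmod (minor T S)) summable_on U"
  proof (rule nonneg_bdd_above_summable_on)
    show "bdd_above (sum (\<lambda>S. cmod (minor T S)) ` {\<F>. \<F> \<subseteq> U \<and> finite \<F>})"
    proof (rule bdd_aboveI2)
      fix \<F> assume \<F>: "\<F> \<in> {\<F>. \<F> \<subseteq> U \<and> finite \<F>}"
      then have fin: "finite (\<Union>\<F>)" "\<Union>\<F> \<subseteq> ?E" by (auto simp: U_def)
      have "sum (\<lambda>S. cmod (minor T S)) \<F> \<le> (\<Sum>S\<in>Pow (\<Union>\<F>). cmod (minor T S))"
        by (rule sum_mono2) (use fin in auto)
      also have "\<dots> \<le> \<beta>" by (rule bound[OF fin(1) onF[OF fin(2)]])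
      finally show "sum (\<lambda>S. cmod (minor T S)) \<F> \<le> \<beta>" .
    qed
  qed simp
  then have summ: "minor T summable_on U" by (rule abs_summable_summable)
  then have tot: "(minor T has_sum infsum (minor T) U) U" by (rule has_sum_infsum)
  define U' where "U' k = {S. S \<subseteq> ?E \<and> finite S \<and> card S = k}" for k
  have "bij_betw snd (Sigma UNIV U') U"
    by (rule bij_betwI[where g = "\<lambda>S. (card S, S)"]) (auto simp: U_def U'_def)
  then have "((\<lambda>p. minor T (snd p)) has_sum infsum (minor T) U) (Sigma UNIV U')"
    using tot by (subst has_sum_reindex_bij_betw)
  then have "((\<lambda>k. trace_ext_power k T) has_sum infsum (minor T) U) UNIV"
  proof (rule has_sum_SigmaD)
    fix k :: nat
    have "U' k \<subseteq> U" by (auto simp: U_def U'_def)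
    then have "minor T summable_on U' k" by (rule summable_on_subset_banach[OF summ])
    then show "((\<lambda>S. minor T (snd (k, S))) has_sum trace_ext_power k T) (U' k)"
      unfolding trace_ext_power_def minor_def[symmetric] U'_def[symmetric] by simp
  qed
  then have det: "det_I_plus T = infsum (minor T) U"
    unfolding det_I_plus_def by (simp add: has_sum_imp_sums sums_unique[symmetric])
  have "filterlim (\<lambda>i. Pow (onb_segment i)) (finite_subsets_at_top U) sequentially"
    unfolding filterlim_finite_subsets_at_top
  proof (intro allI impI)
    fix X assume X: "finite X \<and> X \<subseteq> U"
    then have fin: "finite (\<Union>X)" "\<Union>X \<subseteq> ?E" by (auto simp: U_def)
    have "\<forall>\<^sub>F i in sequentially. \<forall>e\<in>\<Union>X. to_nat_on ?E e < i"
      using fin(1) by (intro eventually_ball_finite ballI) (auto intro: eventually_gt_at_top)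
    then show "\<forall>\<^sub>F i in sequentially. finite (Pow (onb_segment i :: 'h set)) \<and> X \<subseteq> Pow (onb_segment i) \<and> Pow (onb_segment i) \<subseteq> U"
    proof eventually_elim
      case (elim i)
      have "finite S" if "S \<subseteq> onb_segment i" for S :: "'h set"
        using that onb_segment(1) finite_subset by blast
      then show ?case using elim fin(2) onb_segment(1,2)[where 'h = 'h, of i] unfolding U_def onb_segment_def by auto
    qed
  qed
  then have "(\<lambda>i. sum (minor T) (Pow (onb_segment i))) \<longlonglongrightarrow> infsum (minor T) U"
    using tot unfolding has_sum_def by (rule filterlim_compose[rotated])
  then show "(\<lambda>i. compressed_det (onb_segment i) T) \<longlonglongrightarrow> det_I_plus T"
    by (simp add: det compressed_det_def)
  have "cmod (compressed_det (onb_segment i) T) \<le> (\<Sum>S\<in>Pow (onb_segment i). cmod (minor T S))"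
    unfolding compressed_det_def by (rule norm_sum)
  also have "\<dots> \<le> \<beta>" by (rule bound[OF onb_segment(1) onb_segment(3)])
  finally show "cmod (compressed_det (onb_segment i) T) \<le> \<beta>" .
qed

context linear_system
begin

definition nuclear_bound where "nuclear_bound = functional_const * (\<Sum>n. (real n + 1) * norm (nuclear_vector n))"

text \<open>
  The estimate for finite sums of rank-one operators passes to the limit, as each minor depends
  continuously on finitely many matrix entries; Bessel's inequality bounds the columns and rows.
\<close>

lemma minors_bound:
  assumes "finite F" "orthonormal F" and P: "cbounded P" and Q: "cbounded Q"
  shows "(\<Sum>S\<in>Pow F. cmod (minor (blinfun_apply (P o\<^sub>L R o\<^sub>L Q)) S)) \<le> exp (norm P * norm Q * nuclear_bound)"
proof -
  define u where "u n e = cinner (blinfun_apply P (nuclear_vector n)) e" for n e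
  define w where "w n f = blinfun_apply (nuclear_functional n) (blinfun_apply Q f)" for n f
  let ?\<alpha> = "\<lambda>n. norm P * norm (nuclear_vector n)" and ?\<beta> = "\<lambda>n. norm (nuclear_functional n) * norm Q"
  have L0: "0 \<le> functional_const" using order_trans[OF norm_ge_zero nuclear_functional(3)] .
  have entry: "(\<lambda>N. \<Sum>n<N. u n e * w n f) \<longlonglongrightarrow> cinner (blinfun_apply (P o\<^sub>L R o\<^sub>L Q) f) e" for e f
  proof -
    have "(\<lambda>n. cinner (blinfun_apply P (w n f *\<^sub>C nuclear_vector n)) e) sums cinner (blinfun_apply P (blinfun_apply R (blinfun_apply Q f))) e"
      unfolding w_def
      by (intro bounded_linear.sums[OF bounded_linear_cinner_left] bounded_linear.sums[OF blinfun.bounded_linear_right] nuclear_sums)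
    then show ?thesis
      by (simp add: sums_def cboundedD[OF P] cinner_scaleC_left u_def mult.commute)
  qed
  have fin: "(\<Sum>S\<in>Pow F. cmod (det_on S (\<lambda>e f. \<Sum>n<N. u n e * w n f))) \<le> exp (norm P * norm Q * nuclear_bound)" for N
  proof -
    have "(\<Sum>S\<in>Pow F. cmod (det_on S (\<lambda>e f. \<Sum>n<N. u n e * w n f)))
        \<le> (\<Prod>n<N. 1 + (real n + 1) * (?\<alpha> n * ?\<beta> n))"
    proof (rule sum_minors_le_prod[OF assms(1)])
      fix n
      have "(\<Sum>e\<in>F. (cmod (u n e))\<^sup>2) \<le> (norm (blinfun_apply P (nuclear_vector n)))\<^sup>2"
        unfolding u_def by (rule Bessel[OF assms(1,2)])
      also have "\<dots> \<le> (?\<alpha> n)\<^sup>2" by (intro power_mono norm_blinfun) simp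
      finally show "(\<Sum>e\<in>F. (cmod (u n e))\<^sup>2) \<le> (?\<alpha> n)\<^sup>2" .
      have "(\<Sum>f\<in>F. (cmod (w n f))\<^sup>2) \<le> (norm (nuclear_functional n o\<^sub>L Q))\<^sup>2"
        unfolding w_def blinfun_apply_blinfun_compose[symmetric]
        by (intro Bessel_functional assms(1,2) cbounded_compose Q nuclear_functional(2))
      also have "\<dots> \<le> (?\<beta> n)\<^sup>2" by (intro power_mono norm_blinfun_compose) simp
      finally show "(\<Sum>f\<in>F. (cmod (w n f))\<^sup>2) \<le> (?\<beta> n)\<^sup>2" .
    qed auto
    also have "\<dots> \<le> (\<Prod>n<N. exp ((real n + 1) * (?\<alpha> n * ?\<beta> n)))"
      by (intro prod_mono conjI exp_ge_add_one_self) auto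
    also have "\<dots> = exp (\<Sum>n<N. (real n + 1) * (?\<alpha> n * ?\<beta> n))" by (simp add: exp_sum)
    also have "(\<Sum>n<N. (real n + 1) * (?\<alpha> n * ?\<beta> n)) \<le> norm P * norm Q * nuclear_bound"
    proof -
      have "(\<Sum>n<N. (real n + 1) * (?\<alpha> n * ?\<beta> n))
          \<le> (\<Sum>n<N. norm P * norm Q * functional_const * ((real n + 1) * norm (nuclear_vector n)))"
      proof (rule sum_mono)
        fix n
        have "((real n + 1) * norm P * norm Q * norm (nuclear_vector n)) * norm (nuclear_functional n)
          \<le> ((real n + 1) * norm P * norm Q * norm (nuclear_vector n)) * functional_const"
          by (intro mult_left_mono nuclear_functional(3)) auto
        then show "(real n + 1) * (?\<alpha> n * ?\<beta> n) \<le> norm P * norm Q * functional_const * ((real n + 1) * norm (nuclear_vector n))"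
          by (simp only: mult_ac)
      qed
      also have "\<dots> = norm P * norm Q * functional_const * (\<Sum>n<N. (real n + 1) * norm (nuclear_vector n))"
        by (simp only: sum_distrib_left)
      also have "\<dots> \<le> norm P * norm Q * functional_const * (\<Sum>n. (real n + 1) * norm (nuclear_vector n))"
        using L0 by (intro mult_left_mono sum_le_suminf summable_nuclear_vector) auto
      finally show ?thesis by (simp add: nuclear_bound_def mult.assoc)
    qed
    finally show ?thesis by simp
  qed
  have "(\<lambda>N. \<Sum>S\<in>Pow F. cmod (det_on S (\<lambda>e f. \<Sum>n<N. u n e * w n f)))
      \<longlonglongrightarrow> (\<Sum>S\<in>Pow F. cmod (minor (blinfun_apply (P o\<^sub>L R o\<^sub>L Q)) S))"
    unfolding minor_def det_on_def
    by (intro tendsto_sum tendsto_norm tendsto_mult tendsto_const tendsto_prod entry)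
  then show ?thesis
    by (rule LIMSEQ_le_const2) (use fin in blast)
qed

end

section \<open>Exact vanishing for compressions\<close>

text \<open>
  The operator \<open>W\<close> is a function of $-A_1$, so the calculus of $-A_1$ is needed as well.
\<close>

sublocale linear_system \<subseteq> neg: disc_operator "- A1" r
  by unfold_locales (simp_all add: cbounded_uminus op1.cbounded_A op1.norm_A)

lemma compressed_det_eq:
  "finite F \<Longrightarrow> compressed_det F T = det_on F (\<lambda>e f. (if e = f then 1 else 0) + cinner (T f) e)"
  unfolding compressed_det_def minor_def by (rule det_on_identity_plus[symmetric])

context linear_system
begin

text \<open>
  The Sylvester equation after adding and subtracting $\zeta R$, the form in which resolvents on
  either side can be cancelled.
\<close>

lemma kernel_Sylvester:
  "blinfun_apply (kernel x) h = blinfun_apply R (blinfun_apply (\<zeta> *\<^sub>C id_blinfun - (- A1)) h)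
    - blinfun_apply (\<zeta> *\<^sub>C id_blinfun - A2) (blinfun_apply R h)"
proof -
  have "blinfun_apply (kernel x) h = blinfun_apply A2 (blinfun_apply R h) + blinfun_apply R (blinfun_apply A1 h)"
    unfolding Sylvester[symmetric] by (simp add: blinfun.add_left)
  then show ?thesis
    by (simp add: blinfun.add_left blinfun.diff_left blinfun.add_right cboundedD[OF cbounded_R])
qed

lemma res2_apply:
  assumes "cmod \<zeta> = r"
  shows "blinfun_apply (op2.res \<zeta>) (blinfun_apply (\<zeta> *\<^sub>C id_blinfun - A2) h) = h"
  using arg_cong[OF op2.res_inverse(2)[OF assms], of "\<lambda>T. blinfun_apply T h"] by simp

lemma res1_apply:
  assumes "cmod \<zeta> = r"
  shows "blinfun_apply (\<zeta> *\<^sub>C id_blinfun - (- A1)) (blinfun_apply (neg.res \<zeta>) h) = h"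
  using arg_cong[OF neg.res_inverse(1)[OF assms], of "\<lambda>T. blinfun_apply T h"]
  by (simp only: blinfun_apply_blinfun_compose id_blinfun.rep_eq id_apply)

text \<open>
  This splits the product of two resolvents that occurs in the product of the two tau functions.
\<close>

lemma resolvent_kernel_resolvent:
  assumes "cmod \<zeta> = r"
  shows "blinfun_apply (op2.res \<zeta>) (blinfun_apply (kernel x) (blinfun_apply (neg.res \<zeta>) h))
    = blinfun_apply (op2.res \<zeta>) (blinfun_apply R h) - blinfun_apply R (blinfun_apply (neg.res \<zeta>) h)"
  unfolding kernel_Sylvester[of _ \<zeta>] res1_apply[OF assms] blinfun.diff_right res2_apply[OF assms] ..

text \<open>
  The left-hand side is the shift of \<open>R\<close> by $[1/\zeta]$; the right-hand side exhibits it as a rank-one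
  perturbation of \<open>R\<close>.
\<close>

lemma shift_forward:
  assumes "cmod \<zeta> = r"
  shows "(\<zeta> *\<^sub>C op2.res \<zeta>) o\<^sub>L R o\<^sub>L (id_blinfun - (1 / \<zeta>) *\<^sub>C (- A1)) = R + (op2.res \<zeta> o\<^sub>L kernel x)"
proof (rule blinfun_eqI)
  fix h
  have nz: "\<zeta> \<noteq> 0" using assms op1.r_pos by auto
  have "\<zeta> *\<^sub>C blinfun_apply (op2.res \<zeta>) (blinfun_apply R (blinfun_apply (id_blinfun - (1 / \<zeta>) *\<^sub>C (- A1)) h))
      = blinfun_apply (op2.res \<zeta>) (blinfun_apply R (\<zeta> *\<^sub>C blinfun_apply (id_blinfun - (1 / \<zeta>) *\<^sub>C (- A1)) h))"
    by (simp only: cboundedD[OF cbounded_R] cboundedD[OF op2.cbounded_res[OF assms]])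
  also have "\<zeta> *\<^sub>C blinfun_apply (id_blinfun - (1 / \<zeta>) *\<^sub>C (- A1)) h = blinfun_apply (\<zeta> *\<^sub>C id_blinfun - (- A1)) h"
    using nz by (simp add: blinfun.diff_left blinfun.minus_left blinfun.add_left scaleC.diff_right scaleC.minus_right
        scaleC.add_right scaleC_scaleC)
  also have "blinfun_apply R (blinfun_apply (\<zeta> *\<^sub>C id_blinfun - (- A1)) h)
      = blinfun_apply (kernel x) h + blinfun_apply (\<zeta> *\<^sub>C id_blinfun - A2) (blinfun_apply R h)"
    by (simp only: kernel_Sylvester[of h \<zeta>] diff_add_cancel)
  finally show "blinfun_apply ((\<zeta> *\<^sub>C op2.res \<zeta>) o\<^sub>L R o\<^sub>L (id_blinfun - (1 / \<zeta>) *\<^sub>C (- A1))) h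
      = blinfun_apply (R + (op2.res \<zeta> o\<^sub>L kernel x)) h"
    by (simp only: blinfun_apply_blinfun_compose blinfun_apply_scaleC blinfun.add_left blinfun.add_right
        res2_apply[OF assms] add.commute)
qed

lemma shift_backward:
  assumes "cmod \<zeta> = r"
  shows "(id_blinfun - (1 / \<zeta>) *\<^sub>C A2) o\<^sub>L R o\<^sub>L (\<zeta> *\<^sub>C neg.res \<zeta>) = R - (kernel x o\<^sub>L neg.res \<zeta>)"
proof (rule blinfun_eqI)
  fix h
  have nz: "\<zeta> \<noteq> 0" using assms op1.r_pos by auto
  let ?g = "blinfun_apply (neg.res \<zeta>) h"
  have "blinfun_apply ((id_blinfun - (1 / \<zeta>) *\<^sub>C A2) o\<^sub>L R o\<^sub>L (\<zeta> *\<^sub>C neg.res \<zeta>)) h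
      = blinfun_apply (id_blinfun - (1 / \<zeta>) *\<^sub>C A2) (\<zeta> *\<^sub>C blinfun_apply R ?g)"
    by (simp only: blinfun_apply_blinfun_compose blinfun_apply_scaleC cboundedD[OF cbounded_R])
  also have "\<dots> = blinfun_apply (\<zeta> *\<^sub>C id_blinfun - A2) (blinfun_apply R ?g)"
    using nz by (simp add: blinfun.diff_left cboundedD[OF op2.cbounded_A] scaleC_scaleC)
  also have "\<dots> = blinfun_apply R h - blinfun_apply (kernel x) ?g"
    using kernel_Sylvester[of ?g \<zeta>] by (simp only: res1_apply[OF assms] diff_diff_eq2 add_diff_cancel_left')
  finally show "blinfun_apply ((id_blinfun - (1 / \<zeta>) *\<^sub>C A2) o\<^sub>L R o\<^sub>L (\<zeta> *\<^sub>C neg.res \<zeta>)) h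
      = blinfun_apply (R - (kernel x o\<^sub>L neg.res \<zeta>)) h"
    by (simp add: blinfun.diff_left)
qed

text \<open>
  The two factors of the rank-one operator on the right of the Sylvester equation.
\<close>

definition bx :: 'h where "bx = blinfun_apply (op2.semigroup x) (blinfun_apply B 1)"
definition cx :: "'h \<Rightarrow>\<^sub>L complex" where "cx = C o\<^sub>L op1.semigroup x"

lemma kernel_rank_one: "blinfun_apply (kernel x) h = blinfun_apply cx h *\<^sub>C bx"
  by (simp add: kernel_apply bx_def cx_def)

lemma cbounded_cx: "cbounded cx"
  unfolding cx_def by (intro cbounded_compose cbounded_C op1.cbounded_semigroup)

text \<open>
  Both determinants are affine functions of a single resolvent, with the coefficients \<open>\<alpha>\<close> and \<open>y\<close> given
  by determinants in which one row or column is replaced.  After the product of the resolvents has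
  been split, Cauchy's formula leaves an identity between finite sums, in which Cramer's rule for
  \<open>K1\<close> and \<open>K2\<close> produces the cancellation.
\<close>

lemma compressed_integral_zero:
  assumes F: "finite F"
    and cb: "cbounded V" "cbounded W" "cbounded V'" "cbounded W'"
    and g: "g holomorphic_on UNIV"
    and V: "V o\<^sub>L fcalc g A2 = V'" and W: "fcalc g (- A1) o\<^sub>L W' = W"
  shows "((\<lambda>\<zeta>. compressed_det F (blinfun_apply (V o\<^sub>L (R + (op2.res \<zeta> o\<^sub>L kernel x)) o\<^sub>L W)) *
      compressed_det F (blinfun_apply (V' o\<^sub>L (R - (kernel x o\<^sub>L neg.res \<zeta>)) o\<^sub>L W')) * g \<zeta>)
      has_contour_integral 0) (circlepath 0 r)"
proof -
  \<comment> \<open>\<open>K1\<close> and \<open>K2\<close> are the unperturbed matrices; \<open>w\<close> and \<open>u\<close> are the factors of the perturbations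
    that do not depend on \<open>\<zeta>\<close>.\<close>
  define K1 where "K1 e f = (if e = f then 1 else 0) + cinner (blinfun_apply (V o\<^sub>L R o\<^sub>L W) f) e" for e f
  define K2 where "K2 e f = (if e = f then 1 else 0) + cinner (blinfun_apply (V' o\<^sub>L R o\<^sub>L W') f) e" for e f
  define w where "w f = blinfun_apply cx (blinfun_apply W f)" for f
  define u where "u e = cinner (blinfun_apply V' bx) e" for e
  define \<alpha> where "\<alpha> e = det_on F (K1(e := w))" for e
  define y where "y f = det_on F (set_column K2 f u)" for f
  define D1 where "D1 = det_on F K1"
  define D2 where "D2 = det_on F K2"
  define Y where "Y = (\<Sum>f\<in>F. y f *\<^sub>C blinfun_apply W' f)"
  define \<psi> where "\<psi> h = (\<Sum>e\<in>F. \<alpha> e * cinner h e)" for h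
  have \<psi>: "bounded_linear \<psi>" "\<And>c h. \<psi> (c *\<^sub>C h) = c * \<psi> h"
    unfolding \<psi>_def
    by (intro bounded_linear_sum bounded_linear_const_mult bounded_linear_cinner_left)
       (simp add: cinner_scaleC_left sum_distrib_left mult_ac)
  \<comment> \<open>Each functional is applied to one resolvent: \<open>\<phi>1\<close> and \<open>\<phi>2\<close> occur in the two determinants,
    \<open>\<phi>3\<close> and \<open>\<phi>4\<close> in the two parts of the product \<open>\<phi>1 \<phi>2\<close>.\<close>
  define \<phi>1 where "\<phi>1 T = \<psi> (blinfun_apply V (blinfun_apply T bx))" for T
  define \<phi>2 where "\<phi>2 T = blinfun_apply cx (blinfun_apply T Y)" for T
  define \<phi>3 where "\<phi>3 T = \<psi> (blinfun_apply V (blinfun_apply T (blinfun_apply R Y)))" for T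
  define \<phi>4 where "\<phi>4 T = \<psi> (blinfun_apply V (blinfun_apply R (blinfun_apply T Y)))" for T
  have lin: "bounded_linear \<phi>1" "bounded_linear \<phi>2" "bounded_linear \<phi>3" "bounded_linear \<phi>4"
    unfolding \<phi>1_def \<phi>2_def \<phi>3_def \<phi>4_def
    by (intro bounded_linear_compose[OF \<psi>(1)] bounded_linear_compose[OF blinfun.bounded_linear_right]
        blinfun.bounded_linear_left)+
  have hom: "\<phi>1 (c *\<^sub>C T) = c * \<phi>1 T" "\<phi>2 (c *\<^sub>C T) = c * \<phi>2 T" "\<phi>3 (c *\<^sub>C T) = c * \<phi>3 T" "\<phi>4 (c *\<^sub>C T) = c * \<phi>4 T" for c T
    unfolding \<phi>1_def \<phi>2_def \<phi>3_def \<phi>4_def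
    by (simp_all add: cboundedD[OF cb(1)] cboundedD[OF cbounded_cx] cboundedD[OF cbounded_R] \<psi>(2) scaleC_complex_def)
  have det1: "compressed_det F (blinfun_apply (V o\<^sub>L (R + (op2.res \<zeta> o\<^sub>L kernel x)) o\<^sub>L W)) = D1 + \<phi>1 (op2.res \<zeta>)"
    if \<zeta>: "cmod \<zeta> = r" for \<zeta>
  proof -
    have "compressed_det F (blinfun_apply (V o\<^sub>L (R + (op2.res \<zeta> o\<^sub>L kernel x)) o\<^sub>L W))
      = det_on F (\<lambda>e f. K1 e f + cinner (blinfun_apply V (blinfun_apply (op2.res \<zeta>) bx)) e * w f)"
      unfolding compressed_det_eq[OF F] K1_def w_def
      by (simp add: blinfun.add_left blinfun.add_right kernel_rank_one cboundedD[OF cb(1)]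
          cboundedD[OF op2.cbounded_res[OF \<zeta>]] cinner_add_left cinner_scaleC_left mult.commute add.assoc)
    also have "\<dots> = D1 + \<phi>1 (op2.res \<zeta>)"
      unfolding det_on_rank_one_rows[OF F] D1_def \<phi>1_def \<psi>_def \<alpha>_def by (simp add: mult.commute)
    finally show ?thesis .
  qed
  have det2: "compressed_det F (blinfun_apply (V' o\<^sub>L (R - (kernel x o\<^sub>L neg.res \<zeta>)) o\<^sub>L W')) = D2 - \<phi>2 (neg.res \<zeta>)"
    if \<zeta>: "cmod \<zeta> = r" for \<zeta>
  proof -
    have "compressed_det F (blinfun_apply (V' o\<^sub>L (R - (kernel x o\<^sub>L neg.res \<zeta>)) o\<^sub>L W'))
      = det_on F (\<lambda>e f. K2 e f + u e * (- blinfun_apply cx (blinfun_apply (neg.res \<zeta>) (blinfun_apply W' f))))"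
      unfolding compressed_det_eq[OF F] K2_def u_def
      by (simp add: blinfun.diff_left blinfun.diff_right kernel_rank_one cboundedD[OF cb(3)]
          linear_diff[OF bounded_linear.linear[OF bounded_linear_cinner_left]] cinner_scaleC_left mult.commute add_diff_eq)
    also have "\<dots> = D2 + (\<Sum>f\<in>F. - blinfun_apply cx (blinfun_apply (neg.res \<zeta>) (blinfun_apply W' f)) * y f)"
      unfolding det_on_rank_one_columns[OF F] D2_def y_def ..
    also have "(\<Sum>f\<in>F. - blinfun_apply cx (blinfun_apply (neg.res \<zeta>) (blinfun_apply W' f)) * y f) = - \<phi>2 (neg.res \<zeta>)"
      unfolding \<phi>2_def Y_def
      by (simp add: blinfun.sum_right cboundedD[OF neg.cbounded_res[OF \<zeta>]] cboundedD[OF cbounded_cx]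
          scaleC_complex_def sum_negf mult.commute)
    finally show ?thesis by (simp only: add_uminus_conv_diff)
  qed
  have cross: "\<phi>1 (op2.res \<zeta>) * \<phi>2 (neg.res \<zeta>) = \<phi>3 (op2.res \<zeta>) - \<phi>4 (neg.res \<zeta>)" if \<zeta>: "cmod \<zeta> = r" for \<zeta>
  proof -
    have "\<phi>1 (op2.res \<zeta>) * \<phi>2 (neg.res \<zeta>)
      = \<psi> (blinfun_apply V (blinfun_apply (op2.res \<zeta>) (blinfun_apply (kernel x) (blinfun_apply (neg.res \<zeta>) Y))))"
      unfolding \<phi>1_def \<phi>2_def kernel_rank_one cboundedD[OF op2.cbounded_res[OF \<zeta>]] cboundedD[OF cb(1)] \<psi>(2)
      by (rule mult.commute)
    then show ?thesis
      unfolding resolvent_kernel_resolvent[OF \<zeta>] \<phi>3_def \<phi>4_def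
      by (simp add: blinfun.diff_right linear_diff[OF bounded_linear.linear[OF \<psi>(1)]])
  qed
  have gb: "g holomorphic_on ball 0 r" "continuous_on (cball 0 r) g"
    using g holomorphic_on_subset holomorphic_on_imp_continuous_on by blast+
  have g0: "(g has_contour_integral 0) (circlepath 0 r)"
    by (rule Cauchy_theorem_convex_simple[OF g]) auto
  have int: "((\<lambda>\<zeta>. D1 * D2 * g \<zeta> + D2 * (g \<zeta> * \<phi>1 (op2.res \<zeta>)) - D1 * (g \<zeta> * \<phi>2 (neg.res \<zeta>))
      - g \<zeta> * \<phi>3 (op2.res \<zeta>) + g \<zeta> * \<phi>4 (neg.res \<zeta>))
    has_contour_integral (D1 * D2 * 0 + D2 * (2 * pi * \<i> * \<phi>1 (fcalc g A2)) - D1 * (2 * pi * \<i> * \<phi>2 (fcalc g (- A1)))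
      - 2 * pi * \<i> * \<phi>3 (fcalc g A2) + 2 * pi * \<i> * \<phi>4 (fcalc g (- A1)))) (circlepath 0 r)"
    by (intro has_contour_integral_add has_contour_integral_diff has_contour_integral_lmul g0
        op2.contour_integral_res[OF gb lin(1) hom(1)] op2.contour_integral_res[OF gb lin(3) hom(3)]
        neg.contour_integral_res[OF gb lin(2) hom(2)] neg.contour_integral_res[OF gb lin(4) hom(4)])
  have Vg: "blinfun_apply V (blinfun_apply (fcalc g A2) h) = blinfun_apply V' h" for h
    unfolding V[symmetric] by simp
  have gY: "blinfun_apply (fcalc g (- A1)) Y = (\<Sum>f\<in>F. y f *\<^sub>C blinfun_apply W f)"
    unfolding Y_def W[symmetric]
    by (simp add: blinfun.sum_right cboundedD[OF neg.cbounded_fcalc[OF gb(1)]])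
  have \<phi>1: "\<phi>1 (fcalc g A2) = (\<Sum>e\<in>F. \<alpha> e * u e)"
    unfolding \<phi>1_def Vg \<psi>_def u_def ..
  have \<phi>2: "\<phi>2 (fcalc g (- A1)) = (\<Sum>f\<in>F. y f * w f)"
    unfolding \<phi>2_def gY w_def
    by (simp add: blinfun.sum_right cboundedD[OF cbounded_cx] scaleC_complex_def)
  have \<phi>3: "\<phi>3 (fcalc g A2) = D2 * (\<Sum>e\<in>F. \<alpha> e * u e) - (\<Sum>e\<in>F. \<alpha> e * y e)"
  proof -
    have entry: "cinner (blinfun_apply V' (blinfun_apply R Y)) e = D2 * u e - y e" if e: "e \<in> F" for e
    proof -
      have "cinner (blinfun_apply V' (blinfun_apply R Y)) e = (\<Sum>f\<in>F. y f * (K2 e f - (if e = f then 1 else 0)))"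
        unfolding Y_def K2_def
        by (simp add: blinfun.sum_right cboundedD[OF cbounded_R] cboundedD[OF cb(3)] cinner_sum_scaleC_left)
      also have "\<dots> = (\<Sum>f\<in>F. K2 e f * y f) - (\<Sum>f\<in>F. if f = e then y f else 0)"
        unfolding sum_subtractf[symmetric] by (intro sum.cong) (auto simp: algebra_simps)
      also have "(\<Sum>f\<in>F. if f = e then y f else 0) = y e" using F e by simp
      also have "(\<Sum>f\<in>F. K2 e f * y f) = D2 * u e"
        unfolding y_def D2_def by (rule Cramer_columns[OF F e])
      finally show ?thesis .
    qed
    show ?thesis
      unfolding \<phi>3_def Vg \<psi>_def sum_distrib_left sum_subtractf[symmetric]
      by (intro sum.cong refl) (simp only: entry right_diff_distrib mult.left_commute)
  qed
  have \<phi>4: "\<phi>4 (fcalc g (- A1)) = D1 * (\<Sum>f\<in>F. y f * w f) - (\<Sum>e\<in>F. \<alpha> e * y e)"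
  proof -
    have "\<phi>4 (fcalc g (- A1)) = (\<Sum>f\<in>F. y f * \<psi> (blinfun_apply (V o\<^sub>L R o\<^sub>L W) f))"
      unfolding \<phi>4_def gY
      by (simp add: blinfun.sum_right cboundedD[OF cbounded_R] cboundedD[OF cb(1)] \<psi>(2)
          linear_sum[OF bounded_linear.linear[OF \<psi>(1)]])
    also have "\<dots> = (\<Sum>f\<in>F. y f * (D1 * w f - \<alpha> f))"
    proof (rule sum.cong[OF refl])
      fix f assume f: "f \<in> F"
      have "\<psi> (blinfun_apply (V o\<^sub>L R o\<^sub>L W) f) = (\<Sum>e\<in>F. \<alpha> e * (K1 e f - (if e = f then 1 else 0)))"
        unfolding \<psi>_def K1_def by simp
      also have "\<dots> = (\<Sum>e\<in>F. \<alpha> e * K1 e f) - (\<Sum>e\<in>F. if e = f then \<alpha> e else 0)"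
        unfolding sum_subtractf[symmetric] by (intro sum.cong) (auto simp: algebra_simps)
      also have "(\<Sum>e\<in>F. if e = f then \<alpha> e else 0) = \<alpha> f" using F f by simp
      also have "(\<Sum>e\<in>F. \<alpha> e * K1 e f) = D1 * w f"
        unfolding \<alpha>_def D1_def by (rule Cramer_rows[OF F f])
      finally show "y f * \<psi> (blinfun_apply (V o\<^sub>L R o\<^sub>L W) f) = y f * (D1 * w f - \<alpha> f)" by simp
    qed
    also have "\<dots> = D1 * (\<Sum>f\<in>F. y f * w f) - (\<Sum>e\<in>F. \<alpha> e * y e)"
      by (simp add: algebra_simps sum_subtractf sum_distrib_left)
    finally show ?thesis .
  qed
  have "D1 * D2 * 0 + D2 * (2 * pi * \<i> * \<phi>1 (fcalc g A2)) - D1 * (2 * pi * \<i> * \<phi>2 (fcalc g (- A1)))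
      - 2 * pi * \<i> * \<phi>3 (fcalc g A2) + 2 * pi * \<i> * \<phi>4 (fcalc g (- A1)) = 0"
    unfolding \<phi>1 \<phi>2 \<phi>3 \<phi>4 by (simp add: algebra_simps)
  with int have "((\<lambda>\<zeta>. D1 * D2 * g \<zeta> + D2 * (g \<zeta> * \<phi>1 (op2.res \<zeta>)) - D1 * (g \<zeta> * \<phi>2 (neg.res \<zeta>))
      - g \<zeta> * \<phi>3 (op2.res \<zeta>) + g \<zeta> * \<phi>4 (neg.res \<zeta>)) has_contour_integral 0) (circlepath 0 r)"
    by simp
  then show ?thesis
  proof (rule has_contour_integral_eq)
    fix \<zeta> assume "\<zeta> \<in> path_image (circlepath 0 r)"
    then have \<zeta>: "cmod \<zeta> = r" using op1.r_pos by simp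
    have "(D1 + \<phi>1 (op2.res \<zeta>)) * (D2 - \<phi>2 (neg.res \<zeta>)) * g \<zeta>
      = D1 * D2 * g \<zeta> + D2 * (g \<zeta> * \<phi>1 (op2.res \<zeta>)) - D1 * (g \<zeta> * \<phi>2 (neg.res \<zeta>))
        - g \<zeta> * (\<phi>1 (op2.res \<zeta>) * \<phi>2 (neg.res \<zeta>))"
      by (simp add: algebra_simps)
    also have "\<dots> = D1 * D2 * g \<zeta> + D2 * (g \<zeta> * \<phi>1 (op2.res \<zeta>)) - D1 * (g \<zeta> * \<phi>2 (neg.res \<zeta>))
      - g \<zeta> * \<phi>3 (op2.res \<zeta>) + g \<zeta> * \<phi>4 (neg.res \<zeta>)"
      unfolding cross[OF \<zeta>] by (simp add: algebra_simps)
    finally show "D1 * D2 * g \<zeta> + D2 * (g \<zeta> * \<phi>1 (op2.res \<zeta>)) - D1 * (g \<zeta> * \<phi>2 (neg.res \<zeta>))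
      - g \<zeta> * \<phi>3 (op2.res \<zeta>) + g \<zeta> * \<phi>4 (neg.res \<zeta>)
      = compressed_det F (blinfun_apply (V o\<^sub>L (R + (op2.res \<zeta> o\<^sub>L kernel x)) o\<^sub>L W)) *
        compressed_det F (blinfun_apply (V' o\<^sub>L (R - (kernel x o\<^sub>L neg.res \<zeta>)) o\<^sub>L W')) * g \<zeta>"
      by (simp only: det1[OF \<zeta>] det2[OF \<zeta>])
  qed
qed

end

section \<open>Shifts of the tau function by a bracket\<close>

text \<open>
  The exponent $\sum_{j\ge1} t_j z^j$.
\<close>

definition xi :: "(nat \<Rightarrow> complex) \<Rightarrow> complex \<Rightarrow> complex"
  where "xi t z = (\<Sum>j. t (Suc j) * z ^ Suc j)"

lemma xi_sums:
  assumes "t \<in> C_infty 0"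
  shows "(\<lambda>j. t (Suc j) * z ^ Suc j) sums xi t z"
proof -
  have "limsup (\<lambda>j. ereal (root j (cmod (t j)))) \<le> 0"
    using assms by (simp add: C_infty_def zero_ereal_def)
  moreover have "0 \<le> limsup (\<lambda>j. ereal (root j (cmod (t j))))"
    by (rule le_Limsup) (auto intro!: always_eventually real_root_ge_zero)
  ultimately have "conv_radius t = \<infinity>"
    by (simp add: conv_radius_def)
  then have "summable (\<lambda>j. t j * z ^ j)"
    by (intro summable_in_conv_radius) simp
  then have "summable (\<lambda>j. t (Suc j) * z ^ Suc j)" by (subst summable_Suc_iff)
  then show ?thesis unfolding xi_def by (rule summable_sums)
qed

text \<open>
  The exponent of a bracket is a logarithm, which is why the shift multiplies \<open>V\<close> and \<open>W\<close> by
  linear factors or their inverses.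
\<close>

lemma bracket_sums:
  assumes "cmod (c * z) < 1"
  shows "(\<lambda>j. bracket c (Suc j) * z ^ Suc j) sums (- ln (1 - c * z))"
proof -
  have "(\<lambda>n. - ((c * z) ^ n) / of_nat n) sums ln (1 - c * z)"
    using Ln_series'[of "- (c * z)"] assms by simp
  then have "(\<lambda>n. - (- ((c * z) ^ n) / of_nat n)) sums (- ln (1 - c * z))" by (rule sums_minus)
  then have "(\<lambda>n. (c * z) ^ n / of_nat n) sums (- ln (1 - c * z) + (c * z) ^ 0 / of_nat 0)" by simp
  then have "(\<lambda>j. (c * z) ^ Suc j / of_nat (Suc j)) sums (- ln (1 - c * z))"
    by (rule sums_Suc_iff[THEN iffD2])
  moreover have "(c * z) ^ Suc j / of_nat (Suc j) = bracket c (Suc j) * z ^ Suc j" for j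
    unfolding bracket_def power_mult_distrib by simp
  ultimately show ?thesis by simp
qed

lemma exp_minus_bracket:
  assumes "cmod (c * z) < 1"
  shows "exp (- (- ln (1 - c * z))) = 1 - c * z" "exp (- ln (1 - c * z)) = 1 / (1 - c * z)"
proof -
  have "1 - c * z \<noteq> 0" using assms by auto
  then show "exp (- (- ln (1 - c * z))) = 1 - c * z" "exp (- ln (1 - c * z)) = 1 / (1 - c * z)"
    by (simp_all add: exp_minus inverse_eq_divide)
qed

context disc_operator
begin

lemma tau_V_fcalc:
  assumes "\<And>z. cmod z < r \<Longrightarrow> (\<lambda>j. t (Suc j) * z ^ Suc j) sums f z"
  shows "tau_V A t = fcalc (\<lambda>z. exp (f z)) A"
proof -
  have "fcalc f A = (\<Sum>j. t (Suc j) *\<^sub>C op_pow A (Suc j))"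
    by (rule fcalc_power_series(2)[OF assms])
  then show ?thesis
    using op_exp_fcalc[OF fcalc_power_series(1)[OF assms]] by (simp only: tau_V_def)
qed

lemma tau_W_fcalc:
  assumes "\<And>z. cmod z < r \<Longrightarrow> (\<lambda>j. t (Suc j) * z ^ Suc j) sums f z"
  shows "tau_W (- A) t = fcalc (\<lambda>z. exp (- f z)) A"
proof -
  note hol = fcalc_power_series(1)[OF assms]
  have "- fcalc f A = fcalc (\<lambda>z. - f z) A"
    using fcalc_cmult[OF hol, of "- 1"] by (simp add: scaleC.minus_left)
  moreover have "op_exp (fcalc (\<lambda>z. - f z) A) = fcalc (\<lambda>z. exp (- f z)) A"
    by (rule op_exp_fcalc) (intro holomorphic_intros hol)
  moreover have "fcalc f A = (\<Sum>j. t (Suc j) *\<^sub>C op_pow A (Suc j))"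
    by (rule fcalc_power_series(2)[OF assms])
  ultimately show ?thesis by (simp only: tau_W_def minus_minus)
qed

lemma cbounded_tau:
  assumes "\<And>z. cmod z < r \<Longrightarrow> (\<lambda>j. t (Suc j) * z ^ Suc j) sums f z"
  shows "cbounded (tau_V A t)" "cbounded (tau_W (- A) t)"
proof -
  have "cbounded (fcalc (\<lambda>z. exp (f z)) A)" "cbounded (fcalc (\<lambda>z. exp (- f z)) A)"
    by (intro cbounded_fcalc holomorphic_intros fcalc_power_series(1)[OF assms]; assumption)+
  then show "cbounded (tau_V A t)" "cbounded (tau_W (- A) t)"
    by (simp_all only: tau_V_fcalc[OF assms] tau_W_fcalc[OF assms])
qed

lemma fcalc_one_minus: "fcalc (\<lambda>z. 1 - c * z) A = id_blinfun - c *\<^sub>C A"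
proof -
  have "(\<lambda>z. 1) holomorphic_on ball 0 r" "(\<lambda>z. z) holomorphic_on ball 0 r" "(\<lambda>z. c * z) holomorphic_on ball 0 r"
    by (intro holomorphic_intros)+
  then show ?thesis by (simp add: fcalc_diff fcalc_cmult fcalc_one fcalc_ident)
qed

lemma fcalc_scaled_res: "cmod \<zeta> = r \<Longrightarrow> fcalc (\<lambda>z. \<zeta> * (1 / (\<zeta> - z))) A = \<zeta> *\<^sub>C res \<zeta>"
  unfolding res_def by (rule fcalc_cmult[OF holomorphic_res])

text \<open>
  Adding a bracket to \<open>t\<close> multiplies the scalar functions behind \<open>V\<close> and \<open>W\<close> by
  $(1 - z/\zeta)^{-1}$ and $1 - z/\zeta$; the statements are the images of these factorizations under
  the calculus.
\<close>

lemma tau_shift: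
  assumes t: "\<And>z. cmod z < r \<Longrightarrow> (\<lambda>j. t (Suc j) * z ^ Suc j) sums f z" and \<zeta>: "cmod \<zeta> = r"
  shows "tau_V A (\<lambda>j. t j + bracket (1 / \<zeta>) j) = tau_V A t o\<^sub>L (\<zeta> *\<^sub>C res \<zeta>)"
    and "tau_V A (\<lambda>j. t j - bracket (1 / \<zeta>) j) = tau_V A t o\<^sub>L (id_blinfun - (1 / \<zeta>) *\<^sub>C A)"
    and "tau_W (- A) (\<lambda>j. t j + bracket (1 / \<zeta>) j) = (id_blinfun - (1 / \<zeta>) *\<^sub>C A) o\<^sub>L tau_W (- A) t"
    and "tau_W (- A) (\<lambda>j. t j - bracket (1 / \<zeta>) j) = (\<zeta> *\<^sub>C res \<zeta>) o\<^sub>L tau_W (- A) t"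
proof -
  note hol = fcalc_power_series(1)[OF t]
  have small: "cmod (1 / \<zeta> * z) < 1" if "cmod z < r" for z
    using that \<zeta> r_pos by (simp add: norm_mult norm_divide)
  have inv: "1 / (1 - 1 / \<zeta> * z) = \<zeta> * (1 / (\<zeta> - z))" if "cmod z < r" for z
    using that \<zeta> r_pos by (auto simp: field_simps)
  have plus: "(\<lambda>j. (t (Suc j) + bracket (1 / \<zeta>) (Suc j)) * z ^ Suc j) sums (f z + - ln (1 - 1 / \<zeta> * z))"
    and minus: "(\<lambda>j. (t (Suc j) - bracket (1 / \<zeta>) (Suc j)) * z ^ Suc j) sums (f z - - ln (1 - 1 / \<zeta> * z))"
    if z: "cmod z < r" for z
    using sums_add[OF t[OF z] bracket_sums[OF small[OF z]]] sums_diff[OF t[OF z] bracket_sums[OF small[OF z]]]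
    by (simp_all only: distrib_right left_diff_distrib)
  have hol_exp: "(\<lambda>z. exp (f z)) holomorphic_on ball 0 r" "(\<lambda>z. exp (- f z)) holomorphic_on ball 0 r"
    by (intro holomorphic_intros hol; assumption)+
  have hol_res: "(\<lambda>z. \<zeta> * (1 / (\<zeta> - z))) holomorphic_on ball 0 r"
    by (intro holomorphic_on_mult holomorphic_on_const holomorphic_res \<zeta>)
  have hol_lin: "(\<lambda>z. 1 - 1 / \<zeta> * z) holomorphic_on ball 0 r" by (intro holomorphic_intros)
  have "fcalc (\<lambda>z. exp (f z + - ln (1 - 1 / \<zeta> * z))) A = fcalc (\<lambda>z. exp (f z) * (\<zeta> * (1 / (\<zeta> - z)))) A"
    by (rule fcalc_cong[symmetric, OF holomorphic_on_mult[OF hol_exp(1) hol_res]])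
       (simp only: exp_add exp_minus_bracket[OF small] inv)
  then show "tau_V A (\<lambda>j. t j + bracket (1 / \<zeta>) j) = tau_V A t o\<^sub>L (\<zeta> *\<^sub>C res \<zeta>)"
    by (simp only: tau_V_fcalc[OF plus] tau_V_fcalc[OF t] fcalc_mult[OF hol_exp(1) hol_res] fcalc_scaled_res[OF \<zeta>])
  have "fcalc (\<lambda>z. exp (f z - - ln (1 - 1 / \<zeta> * z))) A = fcalc (\<lambda>z. exp (f z) * (1 - 1 / \<zeta> * z)) A"
    by (rule fcalc_cong[symmetric, OF holomorphic_on_mult[OF hol_exp(1) hol_lin]])
       (simp only: diff_conv_add_uminus[of _ "- ln _"] exp_add exp_minus_bracket[OF small])
  then show "tau_V A (\<lambda>j. t j - bracket (1 / \<zeta>) j) = tau_V A t o\<^sub>L (id_blinfun - (1 / \<zeta>) *\<^sub>C A)"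
    by (simp only: tau_V_fcalc[OF minus] tau_V_fcalc[OF t] fcalc_mult[OF hol_exp(1) hol_lin] fcalc_one_minus)
  have "fcalc (\<lambda>z. exp (- (f z + - ln (1 - 1 / \<zeta> * z)))) A = fcalc (\<lambda>z. (1 - 1 / \<zeta> * z) * exp (- f z)) A"
    by (rule fcalc_cong[symmetric, OF holomorphic_on_mult[OF hol_lin hol_exp(2)]])
       (simp only: minus_add_distrib exp_add exp_minus_bracket[OF small] mult.commute[of "exp (- f _)"])
  then show "tau_W (- A) (\<lambda>j. t j + bracket (1 / \<zeta>) j) = (id_blinfun - (1 / \<zeta>) *\<^sub>C A) o\<^sub>L tau_W (- A) t"
    by (simp only: tau_W_fcalc[OF plus] tau_W_fcalc[OF t] fcalc_mult[OF hol_lin hol_exp(2)] fcalc_one_minus)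
  have "fcalc (\<lambda>z. exp (- (f z - - ln (1 - 1 / \<zeta> * z)))) A = fcalc (\<lambda>z. (\<zeta> * (1 / (\<zeta> - z))) * exp (- f z)) A"
    by (rule fcalc_cong[symmetric, OF holomorphic_on_mult[OF hol_res hol_exp(2)]])
       (simp only: minus_diff_eq diff_conv_add_uminus[of "- ln _"] exp_add exp_minus_bracket[OF small] inv)
  then show "tau_W (- A) (\<lambda>j. t j - bracket (1 / \<zeta>) j) = (\<zeta> *\<^sub>C res \<zeta>) o\<^sub>L tau_W (- A) t"
    by (simp only: tau_W_fcalc[OF minus] tau_W_fcalc[OF t] fcalc_mult[OF hol_res hol_exp(2)] fcalc_scaled_res[OF \<zeta>])
qed

end

lemma holomorphic_xi:
  assumes "t \<in> C_infty 0"
  shows "xi t holomorphic_on UNIV"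
proof -
  have "xi t field_differentiable (at z)" for z
  proof (rule holomorphic_on_imp_differentiable_at[of _ "ball 0 (cmod z + 1)"])
    show "xi t holomorphic_on ball 0 (cmod z + 1)"
    proof (rule holomorphic_on_power_series)
      fix w
      show "(\<lambda>n. (case n of 0 \<Rightarrow> 0 | Suc j \<Rightarrow> t (Suc j)) * w ^ n) sums xi t w"
        by (rule sums_Suc[THEN sums_eq_rhs, of _ "xi t w"]) (simp_all add: xi_sums[OF assms, simplified])
    qed
  qed auto
  then show ?thesis by (simp add: holomorphic_on_def field_differentiable_at_within)
qed

section \<open>Passage to the limit\<close>

context linear_system
begin

abbreviation "V t \<equiv> tau_V A2 t"
abbreviation "W t \<equiv> tau_W A1 t"

text \<open>
  The operator $V(t)RW(t)$ with \<open>t\<close> replaced by $t + [1/\zeta]$, respectively $t - [1/\zeta]$ in the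
  next definition, in the form in which $\zeta$ occurs in one resolvent only.
\<close>

definition dressed_forward where "dressed_forward t \<zeta> = V t o\<^sub>L (R + (op2.res \<zeta> o\<^sub>L kernel x)) o\<^sub>L W t"
definition dressed_backward where "dressed_backward t \<zeta> = V t o\<^sub>L (R - (kernel x o\<^sub>L neg.res \<zeta>)) o\<^sub>L W t"

lemma nuclear_bound_nonneg: "0 \<le> nuclear_bound"
  unfolding nuclear_bound_def
  using order_trans[OF norm_ge_zero nuclear_functional(3)]
  by (intro mult_nonneg_nonneg suminf_nonneg summable_nuclear_vector) auto

lemma cbounded_VW:
  assumes "t \<in> C_infty 0"
  shows "cbounded (V t)" "cbounded (W t)"
  using op2.cbounded_tau(1)[OF xi_sums[OF assms]] neg.cbounded_tau(2)[OF xi_sums[OF assms]] by simp_all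

text \<open>
  The bounds \<open>p\<close> and \<open>q\<close> stand for constants that hold on the whole circle, so that the estimate is
  uniform there.
\<close>

lemma det_dressed:
  fixes P Q :: "'h \<Rightarrow>\<^sub>L 'h"
  assumes P: "cbounded P" "norm P \<le> p" and Q: "cbounded Q" "norm Q \<le> q"
  shows "(\<lambda>i. compressed_det (onb_segment i) (blinfun_apply (P o\<^sub>L R o\<^sub>L Q))) \<longlonglongrightarrow> det_I_plus (blinfun_apply (P o\<^sub>L R o\<^sub>L Q))"
    and "cmod (compressed_det (onb_segment i) (blinfun_apply (P o\<^sub>L R o\<^sub>L Q))) \<le> exp (p * q * nuclear_bound)"
proof -
  have "norm P * norm Q * nuclear_bound \<le> p * q * nuclear_bound"
    using P Q nuclear_bound_nonneg by (intro mult_right_mono mult_mono) (auto intro: order_trans[OF norm_ge_zero])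
  then have bound: "(\<Sum>S\<in>Pow F. cmod (minor (blinfun_apply (P o\<^sub>L R o\<^sub>L Q)) S)) \<le> exp (p * q * nuclear_bound)"
    if "finite F" "orthonormal F" for F
    using order_trans[OF minors_bound[OF that P(1) Q(1)]] by simp
  show "(\<lambda>i. compressed_det (onb_segment i) (blinfun_apply (P o\<^sub>L R o\<^sub>L Q))) \<longlonglongrightarrow> det_I_plus (blinfun_apply (P o\<^sub>L R o\<^sub>L Q))"
    by (rule det_I_plus_limit(1)[OF bound])
  show "cmod (compressed_det (onb_segment i) (blinfun_apply (P o\<^sub>L R o\<^sub>L Q))) \<le> exp (p * q * nuclear_bound)"
    by (rule det_I_plus_limit(2)[OF bound])
qed

lemma tau_eq_det:
  "tau A1 A2 B C x u = det_I_plus (blinfun_apply (V u o\<^sub>L R o\<^sub>L W u))"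
  unfolding tau_def R_op_apply by (rule arg_cong[where f = det_I_plus]) auto

lemma norm_id_minus_le:
  fixes T :: "'h \<Rightarrow>\<^sub>L 'h"
  assumes "cmod \<zeta> = r"
  shows "norm (id_blinfun - (1 / \<zeta>) *\<^sub>C T) \<le> 1 + norm T / r"
proof -
  have "norm (id_blinfun - (1 / \<zeta>) *\<^sub>C T) \<le> norm (id_blinfun :: 'h \<Rightarrow>\<^sub>L 'h) + norm ((1 / \<zeta>) *\<^sub>C T)"
    by (rule norm_triangle_ineq4)
  also have "\<dots> \<le> 1 + norm ((1 / \<zeta>) *\<^sub>C T)"
    by (intro add_mono norm_blinfun_id_le order_refl)
  also have "norm ((1 / \<zeta>) *\<^sub>C T) = norm T / r"
    by (simp add: norm_scaleC norm_divide assms)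
  finally show ?thesis .
qed

lemma tau_forward:
  assumes t: "t \<in> C_infty 0"
  obtains \<beta> where
    "\<And>\<zeta>. cmod \<zeta> = r \<Longrightarrow> (\<lambda>i. compressed_det (onb_segment i) (blinfun_apply (dressed_forward t \<zeta>)))
       \<longlonglongrightarrow> tau A1 A2 B C x (\<lambda>j. t j + bracket (1 / \<zeta>) j)"
    "\<And>\<zeta> i. cmod \<zeta> = r \<Longrightarrow> cmod (compressed_det (onb_segment i) (blinfun_apply (dressed_forward t \<zeta>))) \<le> \<beta>"
proof -
  define p where "p = norm (V t) * (r * (1 / (r - op2.s) / (1 - norm A2 / op2.s)))"
  define q where "q = (1 + norm (- A1) / r) * norm (W t)"
  have "((\<lambda>i. compressed_det (onb_segment i) (blinfun_apply (dressed_forward t \<zeta>)))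
       \<longlonglongrightarrow> tau A1 A2 B C x (\<lambda>j. t j + bracket (1 / \<zeta>) j))
    \<and> (\<forall>i. cmod (compressed_det (onb_segment i) (blinfun_apply (dressed_forward t \<zeta>))) \<le> exp (p * q * nuclear_bound))"
    if \<zeta>: "cmod \<zeta> = r" for \<zeta>
  proof -
    let ?P = "V t o\<^sub>L (\<zeta> *\<^sub>C op2.res \<zeta>)" and ?Q = "(id_blinfun - (1 / \<zeta>) *\<^sub>C (- A1)) o\<^sub>L W t"
    have P: "cbounded ?P" "norm ?P \<le> p"
    proof -
      show "cbounded ?P" by (intro cbounded_compose cbounded_scaleC op2.cbounded_res \<zeta> cbounded_VW(1)[OF t])
      have "norm ?P \<le> norm (V t) * (r * norm (op2.res \<zeta>))"
        using norm_blinfun_compose[of "V t" "\<zeta> *\<^sub>C op2.res \<zeta>"] by (simp add: norm_scaleC \<zeta>)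
      also have "\<dots> \<le> p"
        unfolding p_def using op1.r_pos by (intro mult_left_mono op2.norm_res_le[OF \<zeta>]) auto
      finally show "norm ?P \<le> p" .
    qed
    have Q: "cbounded ?Q" "norm ?Q \<le> q"
    proof -
      have "cbounded (id_blinfun - (1 / \<zeta>) *\<^sub>C (- A1))"
        unfolding neg.fcalc_one_minus[symmetric] by (intro neg.cbounded_fcalc holomorphic_intros)
      then show "cbounded ?Q" by (intro cbounded_compose cbounded_VW(2)[OF t])
      show "norm ?Q \<le> q"
        unfolding q_def by (rule order_trans[OF norm_blinfun_compose mult_right_mono[OF norm_id_minus_le[OF \<zeta>]]]) simp
    qed
    have eq: "?P o\<^sub>L R o\<^sub>L ?Q = dressed_forward t \<zeta>"
      unfolding dressed_forward_def shift_forward[OF \<zeta>, symmetric] compose_assoc ..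
    have "tau A1 A2 B C x (\<lambda>j. t j + bracket (1 / \<zeta>) j) = det_I_plus (blinfun_apply (?P o\<^sub>L R o\<^sub>L ?Q))"
      using op2.tau_shift(1)[OF xi_sums[OF t] \<zeta>] neg.tau_shift(3)[OF xi_sums[OF t] \<zeta>]
      unfolding tau_eq_det minus_minus by (simp only:)
    then show ?thesis
      using det_dressed[OF P Q] unfolding eq by simp
  qed
  then show thesis by (intro that[of "exp (p * q * nuclear_bound)"]) auto
qed

lemma tau_backward:
  assumes t: "t \<in> C_infty 0"
  obtains \<beta> where
    "\<And>\<zeta>. cmod \<zeta> = r \<Longrightarrow> (\<lambda>i. compressed_det (onb_segment i) (blinfun_apply (dressed_backward t \<zeta>)))
       \<longlonglongrightarrow> tau A1 A2 B C x (\<lambda>j. t j - bracket (1 / \<zeta>) j)"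
    "\<And>\<zeta> i. cmod \<zeta> = r \<Longrightarrow> cmod (compressed_det (onb_segment i) (blinfun_apply (dressed_backward t \<zeta>))) \<le> \<beta>"
proof -
  define p where "p = norm (V t) * (1 + norm A2 / r)"
  define q where "q = (r * (1 / (r - neg.s) / (1 - norm (- A1) / neg.s))) * norm (W t)"
  have "((\<lambda>i. compressed_det (onb_segment i) (blinfun_apply (dressed_backward t \<zeta>)))
       \<longlonglongrightarrow> tau A1 A2 B C x (\<lambda>j. t j - bracket (1 / \<zeta>) j))
    \<and> (\<forall>i. cmod (compressed_det (onb_segment i) (blinfun_apply (dressed_backward t \<zeta>))) \<le> exp (p * q * nuclear_bound))"
    if \<zeta>: "cmod \<zeta> = r" for \<zeta>
  proof -
    let ?P = "V t o\<^sub>L (id_blinfun - (1 / \<zeta>) *\<^sub>C A2)" and ?Q = "(\<zeta> *\<^sub>C neg.res \<zeta>) o\<^sub>L W t"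
    have P: "cbounded ?P" "norm ?P \<le> p"
    proof -
      have "cbounded (id_blinfun - (1 / \<zeta>) *\<^sub>C A2)"
        unfolding op2.fcalc_one_minus[symmetric] by (intro op2.cbounded_fcalc holomorphic_intros)
      then show "cbounded ?P" by (intro cbounded_compose cbounded_VW(1)[OF t])
      show "norm ?P \<le> p"
        unfolding p_def by (rule order_trans[OF norm_blinfun_compose mult_left_mono[OF norm_id_minus_le[OF \<zeta>]]]) simp
    qed
    have Q: "cbounded ?Q" "norm ?Q \<le> q"
    proof -
      show "cbounded ?Q" by (intro cbounded_compose cbounded_scaleC neg.cbounded_res \<zeta> cbounded_VW(2)[OF t])
      have "norm ?Q \<le> (r * norm (neg.res \<zeta>)) * norm (W t)"
        using norm_blinfun_compose[of "\<zeta> *\<^sub>C neg.res \<zeta>" "W t"] by (simp add: norm_scaleC \<zeta>)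
      also have "\<dots> \<le> q"
        unfolding q_def using op1.r_pos by (intro mult_right_mono mult_left_mono neg.norm_res_le[OF \<zeta>]) auto
      finally show "norm ?Q \<le> q" .
    qed
    have eq: "?P o\<^sub>L R o\<^sub>L ?Q = dressed_backward t \<zeta>"
      unfolding dressed_backward_def shift_backward[OF \<zeta>, symmetric] compose_assoc ..
    have "tau A1 A2 B C x (\<lambda>j. t j - bracket (1 / \<zeta>) j) = det_I_plus (blinfun_apply (?P o\<^sub>L R o\<^sub>L ?Q))"
      using op2.tau_shift(2)[OF xi_sums[OF t] \<zeta>] neg.tau_shift(4)[OF xi_sums[OF t] \<zeta>]
      unfolding tau_eq_det minus_minus by (simp only:)
    then show ?thesis
      using det_dressed[OF P Q] unfolding eq by simp
  qed
  then show thesis by (intro that[of "exp (p * q * nuclear_bound)"]) auto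
qed

text \<open>
  The integral vanishes for every finite section of the basis, and the integrands converge boundedly.
\<close>

lemma Sato_integral:
  assumes t: "t \<in> C_infty 0" and t': "t' \<in> C_infty 0"
  shows "((\<lambda>\<zeta>. tau A1 A2 B C x (\<lambda>j. t j + bracket (1 / \<zeta>) j)
              * tau A1 A2 B C x (\<lambda>j. t' j - bracket (1 / \<zeta>) j)
              * exp (- (\<Sum>j. (t (Suc j) - t' (Suc j)) * \<zeta> ^ Suc j)))
          has_contour_integral 0) (circlepath 0 r)"
proof -
  define g where "g z = exp (xi t' z - xi t z)" for z
  have g_eq: "exp (- (\<Sum>j. (t (Suc j) - t' (Suc j)) * z ^ Suc j)) = g z" for z
  proof -
    have "(\<Sum>j. (t (Suc j) - t' (Suc j)) * z ^ Suc j) = xi t z - xi t' z"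
      unfolding left_diff_distrib by (rule sums_unique[OF sums_diff[OF xi_sums[OF t] xi_sums[OF t']], symmetric])
    then show ?thesis by (simp only: g_def minus_diff_eq)
  qed
  have hol: "g holomorphic_on UNIV"
    unfolding g_def by (intro holomorphic_intros holomorphic_xi t t')
  have gb: "g holomorphic_on ball 0 r" using hol holomorphic_on_subset by blast
  have hol_exp: "(\<lambda>z. exp (xi u z)) holomorphic_on ball 0 r" "(\<lambda>z. exp (- xi u z)) holomorphic_on ball 0 r"
    if "u \<in> C_infty 0" for u
    using holomorphic_xi[OF that] by (auto intro!: holomorphic_intros intro: holomorphic_on_subset)
  have V: "V t o\<^sub>L fcalc g A2 = V t'"
    unfolding op2.tau_V_fcalc[OF xi_sums[OF t]] op2.tau_V_fcalc[OF xi_sums[OF t']]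
      op2.fcalc_mult[OF hol_exp(1)[OF t] gb, symmetric]
    by (simp add: g_def flip: exp_add)
  have W: "fcalc g (- A1) o\<^sub>L W t' = W t"
    using neg.tau_W_fcalc[OF xi_sums[OF t]] neg.tau_W_fcalc[OF xi_sums[OF t']]
      neg.fcalc_mult[OF gb hol_exp(2)[OF t'], symmetric]
    by (simp add: g_def flip: exp_add)
  obtain \<beta>1 where lim1: "\<And>\<zeta>. cmod \<zeta> = r \<Longrightarrow>
      (\<lambda>i. compressed_det (onb_segment i) (blinfun_apply (dressed_forward t \<zeta>)))
        \<longlonglongrightarrow> tau A1 A2 B C x (\<lambda>j. t j + bracket (1 / \<zeta>) j)"
    and bound1: "\<And>\<zeta> i. cmod \<zeta> = r \<Longrightarrow>
      cmod (compressed_det (onb_segment i) (blinfun_apply (dressed_forward t \<zeta>))) \<le> \<beta>1"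
    using tau_forward[OF t] by blast
  obtain \<beta>2 where lim2: "\<And>\<zeta>. cmod \<zeta> = r \<Longrightarrow>
      (\<lambda>i. compressed_det (onb_segment i) (blinfun_apply (dressed_backward t' \<zeta>)))
        \<longlonglongrightarrow> tau A1 A2 B C x (\<lambda>j. t' j - bracket (1 / \<zeta>) j)"
    and bound2: "\<And>\<zeta> i. cmod \<zeta> = r \<Longrightarrow>
      cmod (compressed_det (onb_segment i) (blinfun_apply (dressed_backward t' \<zeta>))) \<le> \<beta>2"
    using tau_backward[OF t'] by blast
  have "bounded (g ` sphere 0 r)"
    using hol holomorphic_on_subset
    by (intro compact_imp_bounded compact_continuous_image holomorphic_on_imp_continuous_on) auto
  then obtain G where "\<forall>z\<in>sphere 0 r. cmod (g z) \<le> G" unfolding bounded_iff by auto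
  then have G: "cmod (g z) \<le> G" if "cmod z = r" for z using that by simp
  let ?p = "circlepath 0 r"
  let ?F = "\<lambda>i \<zeta>. compressed_det (onb_segment i) (blinfun_apply (dressed_forward t \<zeta>)) *
      compressed_det (onb_segment i) (blinfun_apply (dressed_backward t' \<zeta>)) * g \<zeta>"
  let ?T = "\<lambda>\<zeta>. tau A1 A2 B C x (\<lambda>j. t j + bracket (1 / \<zeta>) j) *
      tau A1 A2 B C x (\<lambda>j. t' j - bracket (1 / \<zeta>) j) * g \<zeta>"
  let ?d = "\<lambda>u. vector_derivative ?p (at u within {0..1})"
  have int: "((\<lambda>u. ?F i (?p u) * ?d u) has_integral 0) {0..1}" for i
    using compressed_integral_zero[OF onb_segment(1) cbounded_VW[OF t] cbounded_VW[OF t'] hol V W, of i]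
    unfolding has_contour_integral_def dressed_forward_def dressed_backward_def .
  have p: "cmod (?p u) = r" for u
    using op1.r_pos by (simp add: circlepath_def part_circlepath_def norm_mult)
  have d: "cmod (?d u) = 2 * pi * r" if "u \<in> {0..1}" for u
    using that op1.r_pos by (simp add: vector_derivative_circlepath01 norm_mult norm_exp_eq_Re)
  have int': "(\<lambda>u. ?F i (?p u) * ?d u) integrable_on {0..1}" for i
    using int by blast
  have const: "(\<lambda>_. \<beta>1 * \<beta>2 * G * (2 * pi * r)) integrable_on {0..1::real}"
    by (rule integrable_const_ivl)
  have bound: "norm (?F i (?p u) * ?d u) \<le> \<beta>1 * \<beta>2 * G * (2 * pi * r)" if "u \<in> {0..1}" for i u
    unfolding norm_mult d[OF that]
    using order_trans[OF norm_ge_zero bound1[OF p]] order_trans[OF norm_ge_zero bound2[OF p]]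
      order_trans[OF norm_ge_zero G[OF p]] op1.r_pos
    by (intro mult_right_mono mult_mono bound1 bound2 G p) auto
  have pointwise: "(\<lambda>i. ?F i (?p u) * ?d u) \<longlonglongrightarrow> ?T (?p u) * ?d u" for u
    by (intro tendsto_mult lim1 lim2 p tendsto_const)
  note limit = dominated_convergence[OF int' const bound pointwise]
  have "integral {0..1} (\<lambda>u. ?T (?p u) * ?d u) = 0"
    using limit(2) unfolding integral_unique[OF int] by (simp add: LIMSEQ_const_iff)
  then have "((\<lambda>u. ?T (?p u) * ?d u) has_integral 0) {0..1}"
    using integrable_integral[OF limit(1)] by simp
  then show ?thesis
    unfolding has_contour_integral_def g_eq .
qed

end

theorem theorem9p5:
  fixes A1 A2 :: "'h::{complex_hilbert, second_countable_topology} \<Rightarrow>\<^sub>L 'h"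
    and B :: "complex \<Rightarrow>\<^sub>L 'h" and C :: "'h \<Rightarrow>\<^sub>L complex"
    and r x :: real and t t' :: "nat \<Rightarrow> complex"
  assumes "cbounded A1" and "cbounded A2" and "cbounded B" and "cbounded C"
    and "sectorial (- A1)" and "sectorial (- A2)"
    and "\<exists>t0>0. norm (op_exp (- (t0 *\<^sub>R A1))) < 1"
    and "\<exists>t0>0. norm (op_exp (- (t0 *\<^sub>R A2))) < 1"
    and "admissible_2_2 (- A1) B C" and "admissible_2_2 (- A2) B C"
    and "r > max (norm A1) (norm A2)" and "x > 0"
    and "t \<in> C_infty 0" and "t' \<in> C_infty 0"
  shows "((\<lambda>\<zeta>. tau A1 A2 B C x (\<lambda>j. t j + bracket (1 / \<zeta>) j)
              * tau A1 A2 B C x (\<lambda>j. t' j - bracket (1 / \<zeta>) j)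
              * exp (- (\<Sum>j. (t (Suc j) - t' (Suc j)) * \<zeta> ^ Suc j)))
          has_contour_integral 0) (circlepath 0 r)"
proof -
  interpret op1: disc_operator A1 r using assms by unfold_locales auto
  interpret op2: disc_operator A2 r using assms by unfold_locales auto
  obtain t1 t2 where t12: "t1 > 0" "norm (op1.semigroup t1) < 1" "t2 > 0" "norm (op2.semigroup t2) < 1"
    using assms(7,8) unfolding op1.semigroup_def op2.semigroup_def by blast
  obtain M1 \<omega>1 where 1: "\<omega>1 > 0" "\<And>v. v \<ge> 0 \<Longrightarrow> norm (op1.semigroup v) \<le> M1 * exp (- \<omega>1 * v)"
    using op1.semigroup_decay[OF t12(1,2)] by blast
  obtain M2 \<omega>2 where 2: "\<omega>2 > 0" "\<And>v. v \<ge> 0 \<Longrightarrow> norm (op2.semigroup v) \<le> M2 * exp (- \<omega>2 * v)"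
    using op2.semigroup_decay[OF t12(3,4)] by blast
  define M where "M = max M1 M2"
  define \<omega> where "\<omega> = min \<omega>1 \<omega>2"
  have nonneg: "0 \<le> M1" "0 \<le> M2"
    using order_trans[OF norm_ge_zero 1(2)[of 0]] order_trans[OF norm_ge_zero 2(2)[of 0]] by simp_all
  have le: "m * exp (- w * v) \<le> M * exp (- \<omega> * v)"
    if "0 \<le> m" "m \<le> M" "\<omega> \<le> w" "0 \<le> v" for m w v
    using that by (intro mult_mono) (auto intro: mult_right_mono)
  interpret linear_system A1 A2 r B C x M \<omega>
  proof unfold_locales
    show "0 < \<omega>" using 1 2 by (simp add: \<omega>_def)
    show "norm (op1.semigroup v) \<le> M * exp (- \<omega> * v)" if "0 \<le> v" for v
      by (rule order_trans[OF 1(2)[OF that] le]) (use nonneg that in \<open>auto simp: M_def \<omega>_def\<close>)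
    show "norm (op2.semigroup v) \<le> M * exp (- \<omega> * v)" if "0 \<le> v" for v
      by (rule order_trans[OF 2(2)[OF that] le]) (use nonneg that in \<open>auto simp: M_def \<omega>_def\<close>)
  qed (use assms in auto)
  show ?thesis by (rule Sato_integral[OF assms(13,14)])
qed

end
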